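(* Let $(M,g)$ be a pseudo-Riemannian manifold, let $\varepsilon\in\{1,-1\}$, and let $T_\varepsilon M=\{(x,u)\in TM: g_x(u,u)=\varepsilon\}$ (assumed nonempty) be equipped with its standard contact pseudo-metric structure $(\varphi,\xi,\eta,g_{cm})$. This structure is $K$-contact if and only if the base manifold $(M,g)$ has constant sectional curvature $\varepsilon$.
   Context: Conventions. $(M,g)$ is a pseudo-Riemannian manifold with Levi-Civita connection $\nabla$ and curvature $R(X,Y)Z=\nabla_X\nabla_YZ-\nabla_Y\nabla_XZ-\nabla_{[X,Y]}Z$. Constant sectional curvature $c$ means $R(X,Y)Z=c(g(Y,Z)X-g(X,Z)Y)$. Lifts. Let $\pi:TM\to M$ be the projection. For $X\in T_xM$ and $(x,u)\in TM$, $X^v\in T_{(x,u)}TM$ is the vertical lift (the velocity of $t\mapsto u+tX$ at $t=0$) and $X^h$ is the horizontal lift with respect to $\nabla$ (the unique horizontal vector with $\pi_*X^h=X$). The Sasaki pseudo-metric $Tg$ on $TM$ is $Tg(X^h,Y^h)=Tg(X^v,Y^v)=g(X,Y)$, $Tg(X^h,Y^v)=0$. Let $\bar g$ be the metric induced by $Tg$ on the hypersurface $T_\varepsilon M$. The tangential lift of $X\in T_xM$ to $(x,u)\in T_\varepsilon M$ is $X^t=X^v-\varepsilon g(X,u)u^v$; the tangent space of $T_\varepsilon M$ at $(x,u)$ consists of the vectors $X^h+Y^t$, $X,Y\in T_xM$. The standard structure on $T_\varepsilon M$. At $(x,u)\in T_\varepsilon M$: $\xi=2u^h$; $\eta(X^t)=0$,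 $\eta(X^h)=\tfrac{\varepsilon}{2}g(X,u)$; $\varphi(X^t)=-X^h+\varepsilon g(X,u)u^h$, $\varphi(X^h)=X^t$; $g_{cm}=\tfrac14\bar g$. The structure is called $K$-contact if $\xi$ is a Killing vector field with respect to $g_{cm}$. *)

theory Defs
  imports "HOL-Analysis.Analysis" "HOL-Library.Function_Algebras"
begin

text \<open>Pointwise scalar multiplication, so that families of coordinate vectors (the tangent
  vectors below) live in a real vector space.\<close>

instantiation "fun" :: (type, real_vector) real_vector
begin

definition "scaleR_fun a f = (\<lambda>x. a *\<^sub>R f x)"

instance
  by standard (auto simp: fun_eq_iff scaleR_fun_def scaleR_add_right scaleR_add_left)

end

lemma scaleR_fun_apply [simp]: "(a *\<^sub>R f) x = a *\<^sub>R f x"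
  by (simp add: scaleR_fun_def)


section \<open>Smooth manifolds\<close>

text \<open>The predicates \<open>Ck_on\<close> and \<open>smooth_on\<close> are only meant for open sets.\<close>

primrec Ck_on :: "nat \<Rightarrow> 'x::real_normed_vector set \<Rightarrow> ('x \<Rightarrow> 'y::real_normed_vector) \<Rightarrow> bool"
  where
    "Ck_on 0 U f \<longleftrightarrow> continuous_on U f"
  | "Ck_on (Suc k) U f \<longleftrightarrow> (\<forall>x\<in>U. f differentiable (at x)) \<and>
       (\<forall>v. Ck_on k U (\<lambda>x. frechet_derivative f (at x) v))"

definition smooth_on :: "'x::real_normed_vector set \<Rightarrow> ('x \<Rightarrow> 'y::real_normed_vector) \<Rightarrow> bool"
  where "smooth_on U f \<longleftrightarrow> (\<forall>k. Ck_on k U f)"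

type_synonym ('a, 'e) chart = "'a set \<times> ('a \<Rightarrow> 'e)"

abbreviation chart_dom :: "('a, 'e) chart \<Rightarrow> 'a set" where "chart_dom \<equiv> fst"

abbreviation chart_map :: "('a, 'e) chart \<Rightarrow> 'a \<Rightarrow> 'e" where "chart_map \<equiv> snd"

definition points :: "('a, 'e) chart set \<Rightarrow> 'a set"
  where "points A = (\<Union>c\<in>A. chart_dom c)"

definition atlas_topology :: "('a, 'e::topological_space) chart set \<Rightarrow> 'a topology"
  where "atlas_topology A =
    topology_generated_by {chart_dom c \<inter> chart_map c -` V |c V. c \<in> A \<and> open V}"

definition smooth_manifold :: "('a, 'e::euclidean_space) chart set \<Rightarrow> bool"
  where "smooth_manifold A \<longleftrightarrow>
    (\<forall>c\<in>A. inj_on (chart_map c) (chart_dom c) \<and> open (chart_map c ` chart_dom c)) \<and>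
    (\<forall>c\<in>A. \<forall>d\<in>A. open (chart_map c ` (chart_dom c \<inter> chart_dom d)) \<and>
       smooth_on (chart_map c ` (chart_dom c \<inter> chart_dom d))
         (chart_map d \<circ> inv_into (chart_dom c) (chart_map c))) \<and>
    Hausdorff_space (atlas_topology A) \<and> second_countable (atlas_topology A)"


section \<open>Tangent vectors and calculus on submanifolds\<close>

text \<open>
  A tangent vector at \<open>p\<close> is the velocity at time 0 of a smooth curve through \<open>p\<close>. It is recorded
  as the family of its coordinate vectors in all charts around \<open>p\<close>, with value 0 at every other
  argument, so that two curves have the same velocity iff they agree to first order at \<open>p\<close>.

  The notions below take an atlas \<open>A\<close> and a subset \<open>S\<close> of the manifold it describes, which is meant
  to be a regular (embedded) submanifold; open submanifolds, in particular the whole manifold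
  \<open>points A\<close>, are a special case. Smoothness on \<open>S\<close> is existence of smooth local extensions, and
  differentiation along \<open>S\<close> uses only curves that lie in \<open>S\<close>.
\<close>

type_synonym ('a, 'e) tangent = "('a, 'e) chart \<Rightarrow> 'e"

definition velocity :: "('a, 'e::real_normed_vector) chart set \<Rightarrow> (real \<Rightarrow> 'a) \<Rightarrow> ('a, 'e) tangent"
  where "velocity A \<gamma> = (\<lambda>c. if c \<in> A \<and> \<gamma> 0 \<in> chart_dom c
    then vector_derivative (chart_map c \<circ> \<gamma>) (at 0) else 0)"

definition curve_through ::
    "('a, 'e::real_normed_vector) chart set \<Rightarrow> 'a set \<Rightarrow> 'a \<Rightarrow> ('a, 'e) tangent \<Rightarrow> (real \<Rightarrow> 'a) \<Rightarrow> bool"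
  where "curve_through A S p v \<gamma> \<longleftrightarrow> \<gamma> 0 = p \<and> velocity A \<gamma> = v \<and>
    (\<exists>c\<in>A. \<exists>\<delta>>0. \<gamma> ` {-\<delta><..<\<delta>} \<subseteq> S \<inter> chart_dom c \<and> smooth_on {-\<delta><..<\<delta>} (chart_map c \<circ> \<gamma>))"

definition tangent_space ::
    "('a, 'e::real_normed_vector) chart set \<Rightarrow> 'a set \<Rightarrow> 'a \<Rightarrow> ('a, 'e) tangent set"
  where "tangent_space A S p = {v. \<exists>\<gamma>. curve_through A S p v \<gamma>}"

definition dir_deriv ::
    "('a, 'e::real_normed_vector) chart set \<Rightarrow> 'a set \<Rightarrow> 'a \<Rightarrow> ('a, 'e) tangent \<Rightarrow>
     ('a \<Rightarrow> 'b::real_normed_vector) \<Rightarrow> 'b"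
  where "dir_deriv A S p v f =
    (THE d. \<exists>\<gamma>. curve_through A S p v \<gamma> \<and> ((f \<circ> \<gamma>) has_vector_derivative d) (at 0))"

text \<open>The differential at \<open>p\<close> of a map \<open>F\<close> from the manifold of \<open>A\<close> to that of \<open>B\<close>.\<close>

definition pushforward ::
    "('a, 'e::real_normed_vector) chart set \<Rightarrow> ('b, 'f::real_normed_vector) chart set \<Rightarrow>
     ('a \<Rightarrow> 'b) \<Rightarrow> 'a \<Rightarrow> ('a, 'e) tangent \<Rightarrow> ('b, 'f) tangent"
  where "pushforward A B F p v =
    (THE w. \<exists>\<gamma>. curve_through A (points A) p v \<gamma> \<and> w = velocity B (F \<circ> \<gamma>))"

definition smooth_fun ::
    "('a, 'e::real_normed_vector) chart set \<Rightarrow> 'a set \<Rightarrow> ('a \<Rightarrow> 'b::real_normed_vector) \<Rightarrow> bool"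
  where "smooth_fun A S f \<longleftrightarrow> (\<forall>p\<in>S. \<exists>c\<in>A. p \<in> chart_dom c \<and>
    (\<exists>V F. open V \<and> chart_map c p \<in> V \<and> smooth_on V F \<and>
      (\<forall>q\<in>S \<inter> chart_dom c. chart_map c q \<in> V \<longrightarrow> f q = F (chart_map c q))))"

definition vector_field ::
    "('a, 'e::real_normed_vector) chart set \<Rightarrow> 'a set \<Rightarrow> ('a \<Rightarrow> ('a, 'e) tangent) \<Rightarrow> bool"
  where "vector_field A S X \<longleftrightarrow> (\<forall>p\<in>S. X p \<in> tangent_space A S p) \<and>
    (\<forall>c\<in>A. smooth_fun A (S \<inter> chart_dom c) (\<lambda>q. X q c))"

text \<open>In every chart the bracket has components \<open>X(Y\<^sup>i) - Y(X\<^sup>i)\<close>.\<close>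

definition lie_bracket ::
    "('a, 'e::real_normed_vector) chart set \<Rightarrow> 'a set \<Rightarrow> ('a \<Rightarrow> ('a, 'e) tangent) \<Rightarrow>
     ('a \<Rightarrow> ('a, 'e) tangent) \<Rightarrow> 'a \<Rightarrow> ('a, 'e) tangent"
  where "lie_bracket A S X Y p = (\<lambda>c. if c \<in> A \<and> p \<in> chart_dom c
    then dir_deriv A S p (X p) (\<lambda>q. Y q c) - dir_deriv A S p (Y p) (\<lambda>q. X q c) else 0)"

text \<open>The Lie derivative along \<open>X\<close> of the covariant 2-tensor field \<open>G\<close> on \<open>S\<close>,
  evaluated on the fields \<open>Y\<close> and \<open>Z\<close>.\<close>

definition lie_derivative ::
    "('a, 'e::real_normed_vector) chart set \<Rightarrow> 'a set \<Rightarrow> ('a \<Rightarrow> ('a, 'e) tangent) \<Rightarrow>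
     ('a \<Rightarrow> ('a, 'e) tangent \<Rightarrow> ('a, 'e) tangent \<Rightarrow> real) \<Rightarrow>
     ('a \<Rightarrow> ('a, 'e) tangent) \<Rightarrow> ('a \<Rightarrow> ('a, 'e) tangent) \<Rightarrow> 'a \<Rightarrow> real"
  where "lie_derivative A S X G Y Z p = dir_deriv A S p (X p) (\<lambda>q. G q (Y q) (Z q))
    - G p (lie_bracket A S X Y p) (Z p) - G p (Y p) (lie_bracket A S X Z p)"

definition killing_field ::
    "('a, 'e::real_normed_vector) chart set \<Rightarrow> 'a set \<Rightarrow>
     ('a \<Rightarrow> ('a, 'e) tangent \<Rightarrow> ('a, 'e) tangent \<Rightarrow> real) \<Rightarrow> ('a \<Rightarrow> ('a, 'e) tangent) \<Rightarrow> bool"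
  where "killing_field A S G X \<longleftrightarrow> vector_field A S X \<and>
    (\<forall>W Y Z. openin (atlas_topology A) W \<longrightarrow>
       vector_field A (S \<inter> W) Y \<longrightarrow> vector_field A (S \<inter> W) Z \<longrightarrow>
       (\<forall>p\<in>S \<inter> W. lie_derivative A S X G Y Z p = 0))"


section \<open>Pseudo-Riemannian manifolds\<close>

abbreviation full_tangent_space ::
    "('a, 'e::real_normed_vector) chart set \<Rightarrow> 'a \<Rightarrow> ('a, 'e) tangent set"
  where "full_tangent_space A p \<equiv> tangent_space A (points A) p"

definition metric_index ::
    "('a, 'e::real_normed_vector) chart set \<Rightarrow>
     ('a \<Rightarrow> ('a, 'e) tangent \<Rightarrow> ('a, 'e) tangent \<Rightarrow> real) \<Rightarrow> 'a \<Rightarrow> nat"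
  where "metric_index A g p = Max {dim V |V. subspace V \<and> V \<subseteq> full_tangent_space A p \<and>
    (\<forall>v\<in>V. v \<noteq> 0 \<longrightarrow> g p v v < 0)}"

text \<open>A metric tensor is required to have constant index, as usual. The manifold need not be
  connected.\<close>

definition pseudo_riemannian_manifold ::
    "('a, 'e::euclidean_space) chart set \<Rightarrow>
     ('a \<Rightarrow> ('a, 'e) tangent \<Rightarrow> ('a, 'e) tangent \<Rightarrow> real) \<Rightarrow> bool"
  where "pseudo_riemannian_manifold A g \<longleftrightarrow> smooth_manifold A \<and>
    (\<forall>p\<in>points A.
       (\<forall>u\<in>full_tangent_space A p. \<forall>v\<in>full_tangent_space A p. \<forall>w\<in>full_tangent_space A p. \<forall>a.
          g p (a *\<^sub>R u + v) w = a * g p u w + g p v w) \<and>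
       (\<forall>u\<in>full_tangent_space A p. \<forall>v\<in>full_tangent_space A p. g p u v = g p v u) \<and>
       (\<forall>u\<in>full_tangent_space A p. (\<forall>v\<in>full_tangent_space A p. g p u v = 0) \<longrightarrow> u = 0)) \<and>
    (\<forall>W X Y. openin (atlas_topology A) W \<longrightarrow> vector_field A W X \<longrightarrow> vector_field A W Y \<longrightarrow>
       smooth_fun A W (\<lambda>q. g q (X q) (Y q))) \<and>
    (\<exists>\<nu>. \<forall>p\<in>points A. metric_index A g p = \<nu>)"

text \<open>
  A connection is given as \<open>nabla p v Y\<close>, the covariant derivative at \<open>p\<close> in direction
  \<open>v \<in> T\<^sub>pM\<close> of a vector field \<open>Y\<close> defined on some neighbourhood \<open>W\<close> of \<open>p\<close>. The fourth condition
  says that it depends only on the restriction of \<open>Y\<close> to \<open>W\<close>; as \<open>W\<close> may be shrunk, only on the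
  germ of \<open>Y\<close> at \<open>p\<close>.
\<close>

definition affine_connection ::
    "('a, 'e::real_normed_vector) chart set \<Rightarrow>
     ('a \<Rightarrow> ('a, 'e) tangent \<Rightarrow> ('a \<Rightarrow> ('a, 'e) tangent) \<Rightarrow> ('a, 'e) tangent) \<Rightarrow> bool"
  where "affine_connection A nabla \<longleftrightarrow> (\<forall>W. openin (atlas_topology A) W \<longrightarrow>
    (\<forall>Y p v w a. vector_field A W Y \<longrightarrow> p \<in> W \<longrightarrow>
       v \<in> full_tangent_space A p \<longrightarrow> w \<in> full_tangent_space A p \<longrightarrow>
       nabla p (a *\<^sub>R v + w) Y = a *\<^sub>R nabla p v Y + nabla p w Y) \<and>
    (\<forall>Y Z p v. vector_field A W Y \<longrightarrow> vector_field A W Z \<longrightarrow> p \<in> W \<longrightarrow>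
       v \<in> full_tangent_space A p \<longrightarrow>
       nabla p v (\<lambda>q. Y q + Z q) = nabla p v Y + nabla p v Z) \<and>
    (\<forall>f Y p v. smooth_fun A W (f :: 'a \<Rightarrow> real) \<longrightarrow> vector_field A W Y \<longrightarrow> p \<in> W \<longrightarrow>
       v \<in> full_tangent_space A p \<longrightarrow>
       nabla p v (\<lambda>q. f q *\<^sub>R Y q) =
         dir_deriv A (points A) p v f *\<^sub>R Y p + f p *\<^sub>R nabla p v Y) \<and>
    (\<forall>Y Z p v. vector_field A W Y \<longrightarrow> vector_field A W Z \<longrightarrow> p \<in> W \<longrightarrow>
       v \<in> full_tangent_space A p \<longrightarrow> (\<forall>q\<in>W. Y q = Z q) \<longrightarrow> nabla p v Y = nabla p v Z) \<and>
    (\<forall>X Y. vector_field A W X \<longrightarrow> vector_field A W Y \<longrightarrow>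
       vector_field A W (\<lambda>q. nabla q (X q) Y)))"

definition levi_civita ::
    "('a, 'e::real_normed_vector) chart set \<Rightarrow>
     ('a \<Rightarrow> ('a, 'e) tangent \<Rightarrow> ('a, 'e) tangent \<Rightarrow> real) \<Rightarrow>
     ('a \<Rightarrow> ('a, 'e) tangent \<Rightarrow> ('a \<Rightarrow> ('a, 'e) tangent) \<Rightarrow> ('a, 'e) tangent) \<Rightarrow> bool"
  where "levi_civita A g nabla \<longleftrightarrow> affine_connection A nabla \<and>
    (\<forall>W X Y p. openin (atlas_topology A) W \<longrightarrow>
       vector_field A W X \<longrightarrow> vector_field A W Y \<longrightarrow> p \<in> W \<longrightarrow>
       nabla p (X p) Y - nabla p (Y p) X = lie_bracket A (points A) X Y p) \<and>
    (\<forall>W X Y Z p. openin (atlas_topology A) W \<longrightarrow>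
       vector_field A W X \<longrightarrow> vector_field A W Y \<longrightarrow> vector_field A W Z \<longrightarrow> p \<in> W \<longrightarrow>
       dir_deriv A (points A) p (X p) (\<lambda>q. g q (Y q) (Z q)) =
         g p (nabla p (X p) Y) (Z p) + g p (Y p) (nabla p (X p) Z))"

definition curvature ::
    "('a, 'e::real_normed_vector) chart set \<Rightarrow>
     ('a \<Rightarrow> ('a, 'e) tangent \<Rightarrow> ('a \<Rightarrow> ('a, 'e) tangent) \<Rightarrow> ('a, 'e) tangent) \<Rightarrow>
     ('a \<Rightarrow> ('a, 'e) tangent) \<Rightarrow> ('a \<Rightarrow> ('a, 'e) tangent) \<Rightarrow> ('a \<Rightarrow> ('a, 'e) tangent) \<Rightarrow>
     'a \<Rightarrow> ('a, 'e) tangent"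
  where "curvature A nabla X Y Z p =
    nabla p (X p) (\<lambda>q. nabla q (Y q) Z) - nabla p (Y p) (\<lambda>q. nabla q (X q) Z)
    - nabla p (lie_bracket A (points A) X Y p) Z"

definition constant_sectional_curvature ::
    "('a, 'e::real_normed_vector) chart set \<Rightarrow>
     ('a \<Rightarrow> ('a, 'e) tangent \<Rightarrow> ('a, 'e) tangent \<Rightarrow> real) \<Rightarrow>
     ('a \<Rightarrow> ('a, 'e) tangent \<Rightarrow> ('a \<Rightarrow> ('a, 'e) tangent) \<Rightarrow> ('a, 'e) tangent) \<Rightarrow> real \<Rightarrow> bool"
  where "constant_sectional_curvature A g nabla \<kappa> \<longleftrightarrow>
    (\<forall>W X Y Z. openin (atlas_topology A) W \<longrightarrow>
       vector_field A W X \<longrightarrow> vector_field A W Y \<longrightarrow> vector_field A W Z \<longrightarrow>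
       (\<forall>p\<in>W. curvature A nabla X Y Z p =
          \<kappa> *\<^sub>R (g p (Y p) (Z p) *\<^sub>R X p - g p (X p) (Z p) *\<^sub>R Y p)))"


section \<open>The tangent bundle, lifts and the Sasaki metric\<close>

definition tangent_bundle :: "('a, 'e::real_normed_vector) chart set \<Rightarrow> ('a \<times> ('a, 'e) tangent) set"
  where "tangent_bundle A = {(x, u). x \<in> points A \<and> u \<in> full_tangent_space A x}"

definition bundle_chart ::
    "('a, 'e::real_normed_vector) chart set \<Rightarrow> ('a, 'e) chart \<Rightarrow>
     ('a \<times> ('a, 'e) tangent, 'e \<times> 'e) chart"
  where "bundle_chart A c =
    ({(x, u) \<in> tangent_bundle A. x \<in> chart_dom c}, \<lambda>(x, u). (chart_map c x, u c))"

definition bundle_atlas ::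
    "('a, 'e::real_normed_vector) chart set \<Rightarrow> ('a \<times> ('a, 'e) tangent, 'e \<times> 'e) chart set"
  where "bundle_atlas A = bundle_chart A ` A"

definition vertical_lift ::
    "('a, 'e::real_normed_vector) chart set \<Rightarrow> 'a \<times> ('a, 'e) tangent \<Rightarrow> ('a, 'e) tangent \<Rightarrow>
     ('a \<times> ('a, 'e) tangent, 'e \<times> 'e) tangent"
  where "vertical_lift A p X = velocity (bundle_atlas A) (\<lambda>t. (fst p, snd p + t *\<^sub>R X))"

text \<open>The horizontal vectors at \<open>(x, u)\<close> are the vectors \<open>dY\<^sub>x(v)\<close>, for local sections \<open>Y\<close> of the
  tangent bundle with \<open>Y(x) = u\<close> that are parallel at \<open>x\<close> in the direction \<open>v\<close>.\<close>

definition horizontal_space ::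
    "('a, 'e::real_normed_vector) chart set \<Rightarrow>
     ('a \<Rightarrow> ('a, 'e) tangent \<Rightarrow> ('a \<Rightarrow> ('a, 'e) tangent) \<Rightarrow> ('a, 'e) tangent) \<Rightarrow>
     'a \<times> ('a, 'e) tangent \<Rightarrow> ('a \<times> ('a, 'e) tangent, 'e \<times> 'e) tangent set"
  where "horizontal_space A nabla p =
    {pushforward A (bundle_atlas A) (\<lambda>q. (q, Y q)) (fst p) v |Y v W.
       openin (atlas_topology A) W \<and> fst p \<in> W \<and> vector_field A W Y \<and> Y (fst p) = snd p \<and>
       v \<in> full_tangent_space A (fst p) \<and> nabla (fst p) v Y = 0}"

definition horizontal_lift ::
    "('a, 'e::real_normed_vector) chart set \<Rightarrow>
     ('a \<Rightarrow> ('a, 'e) tangent \<Rightarrow> ('a \<Rightarrow> ('a, 'e) tangent) \<Rightarrow> ('a, 'e) tangent) \<Rightarrow>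
     'a \<times> ('a, 'e) tangent \<Rightarrow> ('a, 'e) tangent \<Rightarrow> ('a \<times> ('a, 'e) tangent, 'e \<times> 'e) tangent"
  where "horizontal_lift A nabla p X =
    (THE w. w \<in> horizontal_space A nabla p \<and> pushforward (bundle_atlas A) A fst p w = X)"

definition sasaki_metric ::
    "('a, 'e::real_normed_vector) chart set \<Rightarrow>
     ('a \<Rightarrow> ('a, 'e) tangent \<Rightarrow> ('a, 'e) tangent \<Rightarrow> real) \<Rightarrow>
     ('a \<Rightarrow> ('a, 'e) tangent \<Rightarrow> ('a \<Rightarrow> ('a, 'e) tangent) \<Rightarrow> ('a, 'e) tangent) \<Rightarrow>
     'a \<times> ('a, 'e) tangent \<Rightarrow> ('a \<times> ('a, 'e) tangent, 'e \<times> 'e) tangent \<Rightarrow>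
     ('a \<times> ('a, 'e) tangent, 'e \<times> 'e) tangent \<Rightarrow> real"
  where "sasaki_metric A g nabla p a b =
    (THE r. \<exists>X\<in>full_tangent_space A (fst p). \<exists>Y\<in>full_tangent_space A (fst p).
            \<exists>X'\<in>full_tangent_space A (fst p). \<exists>Y'\<in>full_tangent_space A (fst p).
       a = horizontal_lift A nabla p X + vertical_lift A p Y \<and>
       b = horizontal_lift A nabla p X' + vertical_lift A p Y' \<and>
       r = g (fst p) X X' + g (fst p) Y Y')"


section \<open>The standard structure on the unit tangent bundle\<close>

definition unit_bundle ::
    "('a, 'e::real_normed_vector) chart set \<Rightarrow>
     ('a \<Rightarrow> ('a, 'e) tangent \<Rightarrow> ('a, 'e) tangent \<Rightarrow> real) \<Rightarrow> real \<Rightarrow> ('a \<times> ('a, 'e) tangent) set"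
  where "unit_bundle A g \<epsilon> = {(x, u) \<in> tangent_bundle A. g x u u = \<epsilon>}"

definition tangential_lift ::
    "('a, 'e::real_normed_vector) chart set \<Rightarrow>
     ('a \<Rightarrow> ('a, 'e) tangent \<Rightarrow> ('a, 'e) tangent \<Rightarrow> real) \<Rightarrow> real \<Rightarrow>
     'a \<times> ('a, 'e) tangent \<Rightarrow> ('a, 'e) tangent \<Rightarrow> ('a \<times> ('a, 'e) tangent, 'e \<times> 'e) tangent"
  where "tangential_lift A g \<epsilon> p X =
    vertical_lift A p X - (\<epsilon> * g (fst p) X (snd p)) *\<^sub>R vertical_lift A p (snd p)"

record ('p, 't) contact_metric_structure =
  cm_phi :: "'p \<Rightarrow> 't \<Rightarrow> 't"
  cm_xi :: "'p \<Rightarrow> 't"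
  cm_eta :: "'p \<Rightarrow> 't \<Rightarrow> real"
  cm_metric :: "'p \<Rightarrow> 't \<Rightarrow> 't \<Rightarrow> real"

text \<open>The tensors \<open>\<phi>\<close> and \<open>\<eta>\<close> are the linear extensions to all \<open>X\<^sup>h + Y\<^sup>t\<close> of their values on
  horizontal and tangential lifts. The vector \<open>Y\<close> is determined only up to multiples of \<open>u\<close>
  (as \<open>u\<^sup>t = 0\<close>), which does not affect the values below.\<close>

definition standard_structure ::
    "('a, 'e::real_normed_vector) chart set \<Rightarrow>
     ('a \<Rightarrow> ('a, 'e) tangent \<Rightarrow> ('a, 'e) tangent \<Rightarrow> real) \<Rightarrow>
     ('a \<Rightarrow> ('a, 'e) tangent \<Rightarrow> ('a \<Rightarrow> ('a, 'e) tangent) \<Rightarrow> ('a, 'e) tangent) \<Rightarrow> real \<Rightarrow>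
     ('a \<times> ('a, 'e) tangent, ('a \<times> ('a, 'e) tangent, 'e \<times> 'e) tangent) contact_metric_structure"
  where "standard_structure A g nabla \<epsilon> =
    \<lparr> cm_phi = (\<lambda>p w. THE z.
        \<exists>X\<in>full_tangent_space A (fst p). \<exists>Y\<in>full_tangent_space A (fst p).
          w = horizontal_lift A nabla p X + tangential_lift A g \<epsilon> p Y \<and>
          z = tangential_lift A g \<epsilon> p X +
            (- horizontal_lift A nabla p Y
             + (\<epsilon> * g (fst p) Y (snd p)) *\<^sub>R horizontal_lift A nabla p (snd p))),
      cm_xi = (\<lambda>p. 2 *\<^sub>R horizontal_lift A nabla p (snd p)),
      cm_eta = (\<lambda>p w. THE r.
        \<exists>X\<in>full_tangent_space A (fst p). \<exists>Y\<in>full_tangent_space A (fst p).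
          w = horizontal_lift A nabla p X + tangential_lift A g \<epsilon> p Y \<and>
          r = \<epsilon> / 2 * g (fst p) X (snd p)),
      cm_metric = (\<lambda>p a b. 1 / 4 * sasaki_metric A g nabla p a b) \<rparr>"

text \<open>Here \<open>S\<close> is the submanifold (of the manifold of \<open>A\<close>) carrying the structure.\<close>

definition K_contact ::
    "('a, 'e::real_normed_vector) chart set \<Rightarrow> 'a set \<Rightarrow>
     ('a, ('a, 'e) tangent) contact_metric_structure \<Rightarrow> bool"
  where "K_contact A S C \<longleftrightarrow> killing_field A S (cm_metric C) (cm_xi C)"

end

theory Submission
  imports Defs
begin

text \<open>
  In a bundle chart with base point \<open>y\<close> and fibre coordinate \<open>u\<close>, let \<open>K (a, b) = b + \<Gamma> a u\<close> be the
  vertical part of a tangent vector \<open>(a, b)\<close>. The Sasaki metric is \<open>g a a' + g (K w) (K w')\<close>, the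
  horizontal lift of \<open>a\<close> is \<open>(a, - \<Gamma> a u)\<close>, and the tangent space of the unit bundle is cut out by
  \<open>g u (K w) = 0\<close>. Torsion-freeness and metric compatibility turn the Lie derivative of \<open>g_cm\<close> along
  \<open>\<xi>\<close> into one half of
  \<open>g (a - R(a,u)u) (K w') + g (K w) (a' - R(a',u)u)\<close>
  for \<open>w = (a, b)\<close> and \<open>w' = (a', b')\<close>. Hence \<open>\<xi>\<close> is Killing iff \<open>a - R(a,u)u\<close> is a multiple of \<open>u\<close> for
  all unit \<open>u\<close>, and then \<open>R(a,u)u = a - \<epsilon> g(a,u) u\<close> because \<open>g (R(a,u)u) u = 0\<close>.

  As the index is constant, every tangent space contains vectors \<open>u\<close> with \<open>\<epsilon> g(u,u) > 0\<close>, so the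
  quadratic map \<open>u \<mapsto> R(a,u)u - \<epsilon> (g(u,u) a - g(a,u) u)\<close> vanishes on a nonempty open cone and thus
  everywhere. After polarization the difference of the two curvature tensors is totally
  antisymmetric, and the first Bianchi identity makes it zero.
\<close>

section \<open>Differentiability of class \<open>Ck\<close>\<close>

text \<open>Directional derivatives, push-forwards, horizontal lifts and the Sasaki metric are
  definite descriptions, so nothing can be computed with them until the described object is known to
  exist and to be unique. This shapes the proof: each notion gets a formula in one chart, and the
  geometry is done with the metric coefficients and Christoffel symbols as bilinear maps depending
  on a point of the model space. Fields on the unit bundle live on the submanifold only; they are
  differentiated through smooth local extensions, and the result is independent of the extension
  because it is a derivative along a curve inside the submanifold.

  The Killing equation is tested on one horizontal and one vertical vector at a time, which isolates
  \<open>g (a - R(a,u)u) k\<close> for \<open>k\<close> orthogonal to \<open>u\<close>. The manifold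
  may be disconnected and the unit bundle is only known to be nonempty over some point; the index is
  what carries the existence of a vector of the right sign to every other point. The Bianchi
  identity finishes the argument because the three cyclic terms of a totally antisymmetric trilinear
  map coincide.\<close>

lemma frechet_has_derivative:
  "f differentiable (at x) \<Longrightarrow> (f has_derivative frechet_derivative f (at x)) (at x)"
  by (simp add: frechet_derivative_works)

lemma frechet_derivative_eq:
  "(f has_derivative D) (at x) \<Longrightarrow> frechet_derivative f (at x) = D"
  by (metis frechet_derivative_at)

lemma frechet_derivative_cong_open:
  assumes "open U" "x \<in> U" "\<And>y. y \<in> U \<Longrightarrow> f y = g y"
  shows "frechet_derivative f (at x) = frechet_derivative g (at x)"
proof -
  have "(f has_derivative D) (at x) = (g has_derivative D) (at x)" for D
    using assms by (metis has_derivative_transform_within_open)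
  then show ?thesis unfolding frechet_derivative_def by simp
qed

lemma Ck_on_cong:
  assumes "open U" "\<And>x. x \<in> U \<Longrightarrow> f x = g x" "Ck_on k U f"
  shows "Ck_on k U g"
  using assms(2,3)
proof (induction k arbitrary: f g)
  case 0
  then show ?case by (metis Ck_on.simps(1) continuous_on_cong)
next
  case (Suc k)
  have "g differentiable (at x)" if "x \<in> U" for x
  proof -
    have "(f has_derivative frechet_derivative f (at x)) (at x)"
      using Suc.prems(2) that frechet_has_derivative by auto
    then have "(g has_derivative frechet_derivative f (at x)) (at x)"
      using has_derivative_transform_within_open[OF _ assms(1) that] Suc.prems(1) by blast
    then show ?thesis unfolding differentiable_def by blast
  qed
  moreover have "Ck_on k U (\<lambda>x. frechet_derivative g (at x) v)" for v
  proof (rule Suc.IH)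
    show "frechet_derivative f (at x) v = frechet_derivative g (at x) v" if "x \<in> U" for x
      using frechet_derivative_cong_open[OF assms(1) that, of f g] Suc.prems(1) by simp
    show "Ck_on k U (\<lambda>x. frechet_derivative f (at x) v)" using Suc.prems(2) by simp
  qed
  ultimately show ?case by simp
qed

text \<open>Derivatives are unique, so an explicitly known \<open>D\<close> may stand for the one
  chosen by \<open>frechet_derivative\<close>. All closure properties below are inductions on the
  order that use this rule.\<close>

lemma Ck_on_SucI:
  assumes "open U" "\<And>x. x \<in> U \<Longrightarrow> (f has_derivative D x) (at x)"
    "\<And>v. Ck_on k U (\<lambda>x. D x v)"
  shows "Ck_on (Suc k) U f"
proof -
  have "Ck_on k U (\<lambda>x. frechet_derivative f (at x) v)" for v
    by (rule Ck_on_cong[OF assms(1) _ assms(3)[of v]]) (simp add: frechet_derivative_eq[OF assms(2)])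
  then show ?thesis using assms(2) unfolding Ck_on.simps differentiable_def by blast
qed

lemma Ck_on_Suc_has_derivative:
  "Ck_on (Suc k) U f \<Longrightarrow> x \<in> U \<Longrightarrow> (f has_derivative frechet_derivative f (at x)) (at x)"
  by (simp add: frechet_has_derivative)

lemma Ck_on_Suc_frechet:
  "Ck_on (Suc k) U f \<Longrightarrow> Ck_on k U (\<lambda>x. frechet_derivative f (at x) v)"
  by simp

lemma Ck_on_SucD: "Ck_on (Suc k) U f \<Longrightarrow> Ck_on k U f"
proof (induction k arbitrary: f)
  case 0
  then show ?case
    by (simp add: continuous_at_imp_continuous_on differentiable_imp_continuous_within)
qed auto

lemma Ck_on_subset: "Ck_on k U f \<Longrightarrow> V \<subseteq> U \<Longrightarrow> Ck_on k V f"
  by (induction k arbitrary: f) (auto intro: continuous_on_subset)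

lemma Ck_on_local:
  assumes "\<And>x. x \<in> U \<Longrightarrow> \<exists>V. open V \<and> x \<in> V \<and> Ck_on k V f"
  shows "Ck_on k U f"
  using assms
proof (induction k arbitrary: f)
  case 0
  then show ?case
    by (metis Ck_on.simps(1) continuous_at_imp_continuous_on continuous_on_eq_continuous_at)
next
  case (Suc k)
  have "f differentiable (at x)" if "x \<in> U" for x
    using Suc.prems[OF that] by auto
  moreover have "Ck_on k U (\<lambda>x. frechet_derivative f (at x) v)" for v
    by (rule Suc.IH) (use Suc.prems in force)
  ultimately show ?case by simp
qed

lemma Ck_on_const: "open U \<Longrightarrow> Ck_on k U (\<lambda>x. a)"
proof (induction k arbitrary: a)
  case (Suc k)
  then show ?case
    by (intro Ck_on_SucI[where D = "\<lambda>x v. 0"]) auto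
qed simp

lemma Ck_on_bounded_linear: "open U \<Longrightarrow> bounded_linear L \<Longrightarrow> Ck_on k U L"
proof (cases k)
  case 0
  assume "bounded_linear L"
  then show ?thesis using 0 by (simp add: linear_continuous_on)
next
  case (Suc j)
  assume "open U" "bounded_linear L"
  then show ?thesis unfolding Suc
    by (intro Ck_on_SucI[where D = "\<lambda>x. L"])
      (auto intro: bounded_linear_imp_has_derivative Ck_on_const)
qed

lemma Ck_on_add:
  "open U \<Longrightarrow> Ck_on k U f \<Longrightarrow> Ck_on k U g \<Longrightarrow> Ck_on k U (\<lambda>x. f x + g x)"
proof (induction k arbitrary: f g)
  case (Suc k)
  show ?case
    by (rule Ck_on_SucI[where D = "\<lambda>x v. frechet_derivative f (at x) v + frechet_derivative g (at x) v"])
      (use Suc in \<open>auto intro!: derivative_eq_intros Ck_on_Suc_has_derivative\<close>)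
qed (auto intro: continuous_intros)

lemma Ck_on_sum:
  assumes "open U" "\<And>i. i \<in> I \<Longrightarrow> Ck_on k U (f i)"
  shows "Ck_on k U (\<lambda>x. \<Sum>i\<in>I. f i x)"
  using assms(2)
  by (induction I rule: infinite_finite_induct) (auto intro: Ck_on_const Ck_on_add assms(1))

text \<open>The product rule yields two products, each with one differentiated and one
  undifferentiated factor. The induction therefore runs over both functions, and the
  undifferentiated factor is lowered to order \<open>k\<close> by \<open>Ck_on_SucD\<close>.\<close>

lemma Ck_on_bilinear:
  assumes "bounded_bilinear B" "open U"
  shows "Ck_on k U f \<Longrightarrow> Ck_on k U g \<Longrightarrow> Ck_on k U (\<lambda>x. B (f x) (g x))"
proof (induction k arbitrary: f g)
  case 0
  then show ?case using bounded_bilinear.continuous_on[OF assms(1)] by auto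
next
  case (Suc k)
  show ?case
  proof (rule Ck_on_SucI[where D = "\<lambda>x v. B (f x) (frechet_derivative g (at x) v)
      + B (frechet_derivative f (at x) v) (g x)"])
    show "((\<lambda>x. B (f x) (g x)) has_derivative (\<lambda>v. B (f x) (frechet_derivative g (at x) v)
      + B (frechet_derivative f (at x) v) (g x))) (at x)" if "x \<in> U" for x
      by (rule bounded_bilinear.FDERIV[OF assms(1) Ck_on_Suc_has_derivative[OF Suc.prems(1) that]
            Ck_on_Suc_has_derivative[OF Suc.prems(2) that]])
    show "Ck_on k U (\<lambda>x. B (f x) (frechet_derivative g (at x) v)
      + B (frechet_derivative f (at x) v) (g x))" for v
      using Suc.prems Ck_on_SucD[OF Suc.prems(1)] Ck_on_SucD[OF Suc.prems(2)]
      by (intro Ck_on_add assms Suc.IH) auto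
  qed (fact assms)
qed

lemma linear_euclidean_sum:
  fixes D :: "'y::euclidean_space \<Rightarrow> 'z::real_vector"
  assumes "linear D"
  shows "D v = (\<Sum>b\<in>Basis. (v \<bullet> b) *\<^sub>R D b)"
proof -
  have "D v = D (\<Sum>b\<in>Basis. (v \<bullet> b) *\<^sub>R b)" by (simp add: euclidean_representation)
  also have "\<dots> = (\<Sum>b\<in>Basis. (v \<bullet> b) *\<^sub>R D b)"
    by (simp add: linear_sum[OF assms] linear_scale[OF assms])
  finally show ?thesis .
qed

text \<open>\<open>Ck_on\<close> controls the derivative of \<open>g\<close> only in fixed
  directions, while the chain rule evaluates it in the moving direction given by the derivative of
  \<open>f\<close>. Expanding that direction in the basis of the intermediate Euclidean space
  reduces the moving direction to scalar coefficients.\<close>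

lemma Ck_on_compose:
  fixes f :: "'x::real_normed_vector \<Rightarrow> 'y::euclidean_space" and g :: "'y \<Rightarrow> 'z::real_normed_vector"
  assumes "open U" "open V" "f ` U \<subseteq> V"
  shows "Ck_on k U f \<Longrightarrow> Ck_on k V g \<Longrightarrow> Ck_on k U (\<lambda>x. g (f x))"
proof (induction k arbitrary: g)
  case 0
  then show ?case using assms(3) by (auto intro: continuous_on_compose2)
next
  case (Suc k)
  let ?D = "\<lambda>x v. \<Sum>b\<in>Basis. (frechet_derivative f (at x) v \<bullet> b) *\<^sub>R frechet_derivative g (at (f x)) b"
  show ?case
  proof (rule Ck_on_SucI[where D = ?D])
    fix x assume x: "x \<in> U"
    then have g: "(g has_derivative frechet_derivative g (at (f x))) (at (f x))"
      using Suc.prems(2) assms(3) by (intro Ck_on_Suc_has_derivative) auto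
    have "((\<lambda>x. g (f x)) has_derivative (\<lambda>v. frechet_derivative g (at (f x)) (frechet_derivative f (at x) v))) (at x)"
      using has_derivative_compose[OF Ck_on_Suc_has_derivative[OF Suc.prems(1) x] g] .
    then show "((\<lambda>x. g (f x)) has_derivative ?D x) (at x)"
      by (subst (asm) linear_euclidean_sum[OF has_derivative_linear[OF g]])
  next
    fix v
    have "Ck_on k U (\<lambda>x. frechet_derivative f (at x) v \<bullet> b)" for b
      using Suc.prems(1) by (intro Ck_on_bilinear[OF bounded_bilinear_inner assms(1)])
        (auto intro: Ck_on_const assms)
    moreover have "Ck_on k U (\<lambda>x. frechet_derivative g (at (f x)) b)" for b
      using Suc.IH[of "\<lambda>y. frechet_derivative g (at y) b"] Suc.prems Ck_on_SucD by auto
    ultimately show "Ck_on k U (\<lambda>x. ?D x v)"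
      by (intro Ck_on_sum assms(1) Ck_on_bilinear[OF bounded_bilinear_scaleR assms(1)])
  qed (fact assms)
qed

lemma smooth_on_cong:
  "open U \<Longrightarrow> smooth_on U f \<Longrightarrow> (\<And>x. x \<in> U \<Longrightarrow> f x = g x) \<Longrightarrow> smooth_on U g"
  unfolding smooth_on_def by (meson Ck_on_cong)

lemma smooth_on_subset: "smooth_on U f \<Longrightarrow> V \<subseteq> U \<Longrightarrow> smooth_on V f"
  unfolding smooth_on_def using Ck_on_subset by blast

lemma smooth_on_local:
  "(\<And>x. x \<in> U \<Longrightarrow> \<exists>V. open V \<and> x \<in> V \<and> smooth_on V f) \<Longrightarrow> smooth_on U f"
  unfolding smooth_on_def by (meson Ck_on_local)

lemma smooth_on_const: "open U \<Longrightarrow> smooth_on U (\<lambda>x. a)"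
  unfolding smooth_on_def using Ck_on_const by blast

lemma smooth_on_bounded_linear: "open U \<Longrightarrow> bounded_linear L \<Longrightarrow> smooth_on U L"
  unfolding smooth_on_def using Ck_on_bounded_linear by blast

lemma smooth_on_id: "open U \<Longrightarrow> smooth_on U (\<lambda>x. x)"
  by (simp add: smooth_on_bounded_linear)

lemma smooth_on_add:
  "open U \<Longrightarrow> smooth_on U f \<Longrightarrow> smooth_on U g \<Longrightarrow> smooth_on U (\<lambda>x. f x + g x)"
  unfolding smooth_on_def using Ck_on_add by blast

lemma smooth_on_sum:
  "open U \<Longrightarrow> (\<And>i. i \<in> I \<Longrightarrow> smooth_on U (f i)) \<Longrightarrow> smooth_on U (\<lambda>x. \<Sum>i\<in>I. f i x)"
  unfolding smooth_on_def by (simp add: Ck_on_sum)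

lemma smooth_on_bilinear:
  "bounded_bilinear B \<Longrightarrow> open U \<Longrightarrow> smooth_on U f \<Longrightarrow> smooth_on U g \<Longrightarrow> smooth_on U (\<lambda>x. B (f x) (g x))"
  unfolding smooth_on_def using Ck_on_bilinear by blast

lemmas smooth_on_inner = smooth_on_bilinear[OF bounded_bilinear_inner]
lemmas smooth_on_scaleR = smooth_on_bilinear[OF bounded_bilinear_scaleR]
lemmas smooth_on_mult = smooth_on_bilinear[OF bounded_bilinear_mult]

lemma smooth_on_uminus:
  "open U \<Longrightarrow> smooth_on U f \<Longrightarrow> smooth_on U (\<lambda>x. - f x)"
  using smooth_on_scaleR[OF _ smooth_on_const, of U f "-1"] by simp

lemma smooth_on_compose:
  fixes f :: "'x::real_normed_vector \<Rightarrow> 'y::euclidean_space"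
  shows "open U \<Longrightarrow> open V \<Longrightarrow> f ` U \<subseteq> V \<Longrightarrow> smooth_on U f \<Longrightarrow> smooth_on V g \<Longrightarrow>
    smooth_on U (\<lambda>x. g (f x))"
  unfolding smooth_on_def using Ck_on_compose by blast

lemma smooth_on_linear_compose:
  fixes f :: "'x::real_normed_vector \<Rightarrow> 'y::euclidean_space"
  shows "open U \<Longrightarrow> bounded_linear L \<Longrightarrow> smooth_on U f \<Longrightarrow> smooth_on U (\<lambda>x. L (f x))"
  using smooth_on_compose[of U UNIV f L] smooth_on_bounded_linear by auto

lemma smooth_on_Pair:
  fixes f :: "'x::real_normed_vector \<Rightarrow> 'y::euclidean_space"
    and g :: "'x::real_normed_vector \<Rightarrow> 'z::euclidean_space"
  assumes "open U" "smooth_on U f" "smooth_on U g"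
  shows "smooth_on U (\<lambda>x. (f x, g x))"
proof -
  have "bounded_linear (\<lambda>a::'y. (a, 0::'z))" "bounded_linear (\<lambda>b::'z. (0::'y, b))"
    by (auto intro!: bounded_linear_intros)
  then have "smooth_on U (\<lambda>x. (f x, 0) + (0, g x))"
    using smooth_on_linear_compose[OF assms(1) _ assms(2)] smooth_on_linear_compose[OF assms(1) _ assms(3)]
    by (intro smooth_on_add assms(1))
  then show ?thesis by simp
qed

lemma smooth_on_fst:
  fixes f :: "'x::real_normed_vector \<Rightarrow> 'y::euclidean_space \<times> 'z::euclidean_space"
  shows "open U \<Longrightarrow> smooth_on U f \<Longrightarrow> smooth_on U (\<lambda>x. fst (f x))"
  by (rule smooth_on_linear_compose[OF _ bounded_linear_fst])

lemma smooth_on_snd: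
  fixes f :: "'x::real_normed_vector \<Rightarrow> 'y::euclidean_space \<times> 'z::euclidean_space"
  shows "open U \<Longrightarrow> smooth_on U f \<Longrightarrow> smooth_on U (\<lambda>x. snd (f x))"
  by (rule smooth_on_linear_compose[OF _ bounded_linear_snd])

lemma smooth_on_has_derivative:
  "smooth_on U f \<Longrightarrow> x \<in> U \<Longrightarrow> (f has_derivative frechet_derivative f (at x)) (at x)"
  unfolding smooth_on_def using Ck_on_Suc_has_derivative by blast

lemma smooth_on_frechet: "smooth_on U f \<Longrightarrow> smooth_on U (\<lambda>x. frechet_derivative f (at x) v)"
  unfolding smooth_on_def using Ck_on_Suc_frechet by fast

text \<open>Here both the base point and the direction move, as in the fibre component of a change
  of bundle charts. The basis expansion of the direction again reduces this to fixed
  directions.\<close>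

lemma smooth_on_frechet_apply:
  fixes f :: "'x::euclidean_space \<Rightarrow> 'y::real_normed_vector"
    and F h :: "'z::real_normed_vector \<Rightarrow> 'x"
  assumes "open U" "open V" "F ` V \<subseteq> U" "smooth_on U f" "smooth_on V F" "smooth_on V h"
  shows "smooth_on V (\<lambda>x. frechet_derivative f (at (F x)) (h x))"
proof (rule smooth_on_cong[OF assms(2)])
  show "smooth_on V (\<lambda>x. \<Sum>b\<in>Basis. (h x \<bullet> b) *\<^sub>R frechet_derivative f (at (F x)) b)"
    using smooth_on_compose[OF assms(2,1,3,5) smooth_on_frechet[OF assms(4)]]
    by (intro smooth_on_sum smooth_on_scaleR smooth_on_inner assms smooth_on_const)
  show "(\<Sum>b\<in>Basis. (h x \<bullet> b) *\<^sub>R frechet_derivative f (at (F x)) b) =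
      frechet_derivative f (at (F x)) (h x)" if "x \<in> V" for x
    using linear_euclidean_sum[OF has_derivative_linear[OF smooth_on_has_derivative[OF assms(4)]], of "F x" "h x"]
      that assms(3) by auto
qed

lemma smooth_on_continuous: "smooth_on U f \<Longrightarrow> continuous_on U f"
  unfolding smooth_on_def by (meson Ck_on.simps(1))

text \<open>The factor \<open>c\<close> and the free exponent make the class of functions closed
  under differentiation. The case needed later is the exponent -1/2, which normalises vectors to
  unit length.\<close>

lemma Ck_on_powr: "Ck_on k {0<..} (\<lambda>r::real. c * r powr \<alpha>)"
proof (induction k arbitrary: \<alpha> c)
  case 0
  show ?case by (auto intro!: continuous_intros)
next
  case (Suc k)
  show ?case
  proof (rule Ck_on_SucI[where D = "\<lambda>x v. c * (\<alpha> * x powr (\<alpha> - 1)) * v"])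
    show "((\<lambda>r. c * r powr \<alpha>) has_derivative (\<lambda>v. c * (\<alpha> * x powr (\<alpha> - 1)) * v)) (at x)"
      if "x \<in> {0<..}" for x
    proof -
      have "((\<lambda>r. c * r powr \<alpha>) has_real_derivative c * (\<alpha> * x powr (\<alpha> - 1))) (at x)"
        using that by (intro DERIV_cmult has_real_derivative_powr) auto
      then show ?thesis by (simp add: has_field_derivative_def)
    qed
    show "Ck_on k {0<..} (\<lambda>x. c * (\<alpha> * x powr (\<alpha> - 1)) * v)" for v
      using Suc.IH[of "c * \<alpha> * v" "\<alpha> - 1"] by (simp add: algebra_simps)
  qed simp
qed

lemma smooth_on_powr: "smooth_on {0<..} (\<lambda>r::real. r powr \<alpha>)"
  unfolding smooth_on_def using Ck_on_powr[of _ 1] by simp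

section \<open>Symmetry of second derivatives\<close>

text \<open>Two applications of the mean value theorem, in the direction \<open>a\<close> and then
  in the direction \<open>b\<close>. The left-hand side is symmetric in \<open>a\<close> and
  \<open>b\<close> while the right-hand side is not, and this is where the symmetry of second
  derivatives comes from.\<close>

lemma second_difference:
  fixes f :: "'x::real_normed_vector \<Rightarrow> real"
  assumes f: "\<And>y. y \<in> ball x r \<Longrightarrow> f differentiable (at y)"
    and f': "\<And>y. y \<in> ball x r \<Longrightarrow> (\<lambda>y. frechet_derivative f (at y) a) differentiable (at y)"
    and h: "0 < h" "h * (norm a + norm b) < r"
  shows "\<exists>z. norm (z - x) \<le> h * (norm a + norm b) \<and>
    f (x + h *\<^sub>R a + h *\<^sub>R b) - f (x + h *\<^sub>R a) - f (x + h *\<^sub>R b) + f x =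
    h^2 * frechet_derivative (\<lambda>y. frechet_derivative f (at y) a) (at z) b"
proof -
  have nb: "norm (s *\<^sub>R a + t *\<^sub>R b) \<le> h * (norm a + norm b)" if "0 \<le> s" "s \<le> h" "0 \<le> t" "t \<le> h" for s t
  proof -
    have "norm (s *\<^sub>R a + t *\<^sub>R b) \<le> s * norm a + t * norm b"
      using norm_triangle_ineq[of "s *\<^sub>R a" "t *\<^sub>R b"] that by simp
    also have "\<dots> \<le> h * norm a + h * norm b"
      using that by (intro add_mono mult_right_mono) auto
    finally show ?thesis by (simp add: algebra_simps)
  qed
  have inb: "x + s *\<^sub>R a + t *\<^sub>R b \<in> ball x r" if "0 \<le> s" "s \<le> h" "0 \<le> t" "t \<le> h" for s t
  proof -
    have "dist x (x + s *\<^sub>R a + t *\<^sub>R b) = norm (s *\<^sub>R a + t *\<^sub>R b)"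
      by (metis add.assoc add_diff_cancel_left' dist_commute dist_norm)
    then show ?thesis using nb[OF that] h by simp
  qed
  have D: "((\<lambda>s. f (x + s *\<^sub>R a + t *\<^sub>R b)) has_derivative
      (\<lambda>v. v * frechet_derivative f (at (x + s *\<^sub>R a + t *\<^sub>R b)) a)) (at s)"
    if "0 \<le> s" "s \<le> h" "0 \<le> t" "t \<le> h" for s t
  proof -
    have F: "(f has_derivative frechet_derivative f (at (x + s *\<^sub>R a + t *\<^sub>R b))) (at (x + s *\<^sub>R a + t *\<^sub>R b))"
      using f[OF inb[OF that]] frechet_has_derivative by blast
    have "((\<lambda>s. x + s *\<^sub>R a + t *\<^sub>R b) has_derivative (\<lambda>v. v *\<^sub>R a)) (at s)"
      by (auto intro!: derivative_eq_intros)
    from has_derivative_compose[OF this F] show ?thesis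
      by (simp add: linear_scale[OF has_derivative_linear[OF F]])
  qed
  obtain s where s: "s \<in> {0<..<h}" and e1:
    "(f (x + h *\<^sub>R a + h *\<^sub>R b) - f (x + h *\<^sub>R a)) - (f (x + h *\<^sub>R b) - f x) =
     h * (frechet_derivative f (at (x + s *\<^sub>R a + h *\<^sub>R b)) a - frechet_derivative f (at (x + s *\<^sub>R a)) a)"
  proof -
    \<comment> \<open>The summand \<open>0 *\<^sub>R b\<close> turns the subtracted function into
      the instance of \<open>D\<close> with \<open>t = 0\<close>.\<close>
    have "\<exists>s\<in>{0<..<h}. (\<lambda>s. f (x + s *\<^sub>R a + h *\<^sub>R b) - f (x + s *\<^sub>R a + 0 *\<^sub>R b)) h
        - (\<lambda>s. f (x + s *\<^sub>R a + h *\<^sub>R b) - f (x + s *\<^sub>R a + 0 *\<^sub>R b)) 0 =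
       (\<lambda>s v. v * frechet_derivative f (at (x + s *\<^sub>R a + h *\<^sub>R b)) a -
           v * frechet_derivative f (at (x + s *\<^sub>R a + 0 *\<^sub>R b)) a) s (h - 0)"
    proof (rule mvt_simple[OF h(1)])
      fix s assume s: "0 \<le> s" "s \<le> h"
      show "((\<lambda>s. f (x + s *\<^sub>R a + h *\<^sub>R b) - f (x + s *\<^sub>R a + 0 *\<^sub>R b)) has_derivative
        (\<lambda>v. v * frechet_derivative f (at (x + s *\<^sub>R a + h *\<^sub>R b)) a -
           v * frechet_derivative f (at (x + s *\<^sub>R a + 0 *\<^sub>R b)) a)) (at s within {0..h})"
        using s h by (intro has_derivative_at_withinI[OF has_derivative_diff] D) auto
    qed
    then show ?thesis using that by (auto simp: algebra_simps)
  qed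
  have D2: "((\<lambda>t. frechet_derivative f (at (x + s *\<^sub>R a + t *\<^sub>R b)) a) has_derivative
      (\<lambda>v. v * frechet_derivative (\<lambda>y. frechet_derivative f (at y) a) (at (x + s *\<^sub>R a + t *\<^sub>R b)) b)) (at t)"
    if "0 \<le> t" "t \<le> h" for t
  proof -
    have F: "((\<lambda>y. frechet_derivative f (at y) a) has_derivative
        frechet_derivative (\<lambda>y. frechet_derivative f (at y) a) (at (x + s *\<^sub>R a + t *\<^sub>R b))) (at (x + s *\<^sub>R a + t *\<^sub>R b))"
      using s that by (intro frechet_has_derivative f' inb) auto
    have "((\<lambda>t. x + s *\<^sub>R a + t *\<^sub>R b) has_derivative (\<lambda>v. v *\<^sub>R b)) (at t)"
      by (auto intro!: derivative_eq_intros)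
    from has_derivative_compose[OF this F] show ?thesis
      by (simp add: linear_scale[OF has_derivative_linear[OF F]])
  qed
  have "\<exists>t\<in>{0<..<h}. frechet_derivative f (at (x + s *\<^sub>R a + h *\<^sub>R b)) a
      - frechet_derivative f (at (x + s *\<^sub>R a + 0 *\<^sub>R b)) a =
      (h - 0) * frechet_derivative (\<lambda>y. frechet_derivative f (at y) a) (at (x + s *\<^sub>R a + t *\<^sub>R b)) b"
    by (rule mvt_simple[OF h(1), where f="\<lambda>t. frechet_derivative f (at (x + s *\<^sub>R a + t *\<^sub>R b)) a"])
      (auto intro: has_derivative_at_withinI D2)
  then obtain t where t: "t \<in> {0<..<h}" and e2:
    "frechet_derivative f (at (x + s *\<^sub>R a + h *\<^sub>R b)) a
      - frechet_derivative f (at (x + s *\<^sub>R a)) a =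
      h * frechet_derivative (\<lambda>y. frechet_derivative f (at y) a) (at (x + s *\<^sub>R a + t *\<^sub>R b)) b"
    by auto
  show ?thesis
    by (rule exI[of _ "x + s *\<^sub>R a + t *\<^sub>R b"])
      (use e1 e2 nb[of s t] s t in \<open>auto simp: algebra_simps power2_eq_square\<close>)
qed

text \<open>The same second difference equals \<open>h^2\<close> times either mixed derivative,
  taken at two different points near \<open>x\<close>. By continuity each is within
  \<open>e\<close>, half the supposed gap, of its value at \<open>x\<close>, which contradicts their
  being equal.\<close>

lemma second_derivative_symmetric_real:
  fixes f :: "'x::real_normed_vector \<Rightarrow> real"
  assumes U: "open U" "x \<in> U" and f: "smooth_on U f"
  shows "frechet_derivative (\<lambda>y. frechet_derivative f (at y) a) (at x) b =
    frechet_derivative (\<lambda>y. frechet_derivative f (at y) b) (at x) a"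
proof (rule ccontr)
  let ?A = "\<lambda>z. frechet_derivative (\<lambda>y. frechet_derivative f (at y) a) (at z) b"
  let ?B = "\<lambda>z. frechet_derivative (\<lambda>y. frechet_derivative f (at y) b) (at z) a"
  assume ne: "?A x \<noteq> ?B x"
  define e where "e = \<bar>?A x - ?B x\<bar> / 2"
  have e: "0 < e" using ne by (simp add: e_def)
  have "continuous_on U ?A" "continuous_on U ?B"
    by (intro smooth_on_continuous smooth_on_frechet f)+
  then have "isCont ?A x" "isCont ?B x" using U by (simp_all add: continuous_on_eq_continuous_at)
  then have "\<exists>d>0. \<forall>y. dist y x < d \<longrightarrow> dist (?A y) (?A x) < e"
      "\<exists>d>0. \<forall>y. dist y x < d \<longrightarrow> dist (?B y) (?B x) < e"
    using e unfolding continuous_at_eps_delta by simp_all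
  then obtain d1 d2 where d: "d1 > 0" "d2 > 0" "\<And>y. dist y x < d1 \<Longrightarrow> dist (?A y) (?A x) < e"
      "\<And>y. dist y x < d2 \<Longrightarrow> dist (?B y) (?B x) < e"
    by (elim exE conjE) simp
  obtain d3 where d3: "d3 > 0" "ball x d3 \<subseteq> U" using U openE by blast
  define r where "r = min d1 (min d2 d3)"
  have r: "r > 0" "r \<le> d1" "r \<le> d2" "r \<le> d3" using d d3 by (auto simp: r_def)
  \<comment> \<open>The summand 1 keeps \<open>n\<close> positive when \<open>a\<close> and
    \<open>b\<close> are both zero, so that \<open>h\<close> is well defined and
    \<open>h * n\<close> is half of \<open>r\<close>.\<close>
  define n where "n = norm a + norm b + 1"
  define h where "h = r / (2 * n)"
  have n: "n > 0" by (simp add: n_def add_nonneg_pos)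
  have h: "h > 0" using r n by (simp add: h_def)
  have hn: "h * n = r / 2" using n by (simp add: h_def)
  have "h * (norm a + norm b) \<le> h * n" using h by (intro mult_left_mono) (auto simp: n_def)
  with hn r have hr: "h * (norm a + norm b) < r" "h * (norm b + norm a) < r" by (auto simp: add.commute)
  have S: "smooth_on (ball x r) f" using f d3 r by (meson smooth_on_subset subset_ball subset_trans)
  have df: "f differentiable (at y)" if "y \<in> ball x r" for y
    using smooth_on_has_derivative[OF S that] differentiable_def by blast
  have df': "(\<lambda>y. frechet_derivative f (at y) c) differentiable (at y)" if "y \<in> ball x r" for y c
    using smooth_on_has_derivative[OF smooth_on_frechet[OF S] that] differentiable_def by blast
  obtain z1 where z1: "norm (z1 - x) \<le> h * (norm a + norm b)"
    "f (x + h *\<^sub>R a + h *\<^sub>R b) - f (x + h *\<^sub>R a) - f (x + h *\<^sub>R b) + f x = h^2 * ?A z1"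
    using second_difference[OF df df' h hr(1)] by blast
  obtain z2 where z2: "norm (z2 - x) \<le> h * (norm b + norm a)"
    "f (x + h *\<^sub>R b + h *\<^sub>R a) - f (x + h *\<^sub>R b) - f (x + h *\<^sub>R a) + f x = h^2 * ?B z2"
    using second_difference[OF df df' h hr(2)] by blast
  have "h^2 * ?A z1 = h^2 * ?B z2"
    using z1(2) z2(2) by (simp add: add.commute add.left_commute algebra_simps)
  then have "?A z1 = ?B z2" using h by simp
  moreover have "dist (?A z1) (?A x) < e" using z1(1) hr r by (intro d) (auto simp: dist_norm)
  moreover have "dist (?B z2) (?B x) < e" using z2(1) hr r by (intro d) (auto simp: dist_norm)
  ultimately show False by (auto simp: e_def dist_real_def abs_if split: if_splits)
qed

lemma frechet_derivative_inner:
  assumes "f differentiable (at x)"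
  shows "frechet_derivative (\<lambda>y. f y \<bullet> c) (at x) v = frechet_derivative f (at x) v \<bullet> c"
  by (rule fun_cong[OF frechet_derivative_eq, of _ "\<lambda>v. frechet_derivative f (at x) v \<bullet> c"])
    (auto intro!: derivative_eq_intros frechet_has_derivative assms)

lemma second_derivative_symmetric:
  fixes f :: "'x::real_normed_vector \<Rightarrow> 'y::euclidean_space"
  assumes U: "open U" "x \<in> U" and f: "smooth_on U f"
  shows "frechet_derivative (\<lambda>y. frechet_derivative f (at y) a) (at x) b =
    frechet_derivative (\<lambda>y. frechet_derivative f (at y) b) (at x) a"
proof (rule euclidean_eqI)
  fix c :: 'y
  have d: "f differentiable (at y)" if "y \<in> U" for y
    using smooth_on_has_derivative[OF f that] differentiable_def by blast
  have d': "(\<lambda>y. frechet_derivative f (at y) v) differentiable (at y)" if "y \<in> U" for y v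
    using smooth_on_has_derivative[OF smooth_on_frechet[OF f] that] differentiable_def by blast
  have *: "frechet_derivative (\<lambda>y. frechet_derivative f (at y) v) (at x) w \<bullet> c =
      frechet_derivative (\<lambda>y. frechet_derivative (\<lambda>y. f y \<bullet> c) (at y) v) (at x) w" for v w
    using frechet_derivative_cong_open[OF U, of "\<lambda>y. frechet_derivative (\<lambda>y. f y \<bullet> c) (at y) v"
        "\<lambda>y. frechet_derivative f (at y) v \<bullet> c"]
    by (simp add: frechet_derivative_inner d d' U)
  show "frechet_derivative (\<lambda>y. frechet_derivative f (at y) a) (at x) b \<bullet> c =
    frechet_derivative (\<lambda>y. frechet_derivative f (at y) b) (at x) a \<bullet> c"
    unfolding * using U f by (intro second_derivative_symmetric_real[OF U] smooth_on_inner smooth_on_const)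
qed

section \<open>Smooth families of bilinear maps\<close>

text \<open>Smoothness is asked only for fixed arguments, so no norm on a space of bilinear maps
  enters; joint smoothness in base point and arguments follows from a finite basis expansion. Metric
  coefficients and Christoffel symbols are the two instances.\<close>

definition bilin_field ::
    "'e::euclidean_space set \<Rightarrow> ('e \<Rightarrow> 'e \<Rightarrow> 'e \<Rightarrow> 'b::real_normed_vector) \<Rightarrow> bool"
  where "bilin_field U h \<longleftrightarrow> open U \<and> (\<forall>y\<in>U. bilinear (h y)) \<and> (\<forall>a b. smooth_on U (\<lambda>y. h y a b))"

text \<open>The derivative with respect to the base point alone, in direction \<open>v\<close>, with
  both arguments frozen.\<close>

definition bilin_deriv ::
    "('e::euclidean_space \<Rightarrow> 'e \<Rightarrow> 'e \<Rightarrow> 'b::real_normed_vector) \<Rightarrow> 'e \<Rightarrow> 'e \<Rightarrow> 'e \<Rightarrow> 'e \<Rightarrow> 'b"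
  where "bilin_deriv h y v a b = frechet_derivative (\<lambda>y. h y a b) (at y) v"

lemma bilinear_basis_sum:
  fixes B :: "'e::euclidean_space \<Rightarrow> 'e \<Rightarrow> 'b::real_normed_vector"
  assumes "bilinear B"
  shows "B a b = (\<Sum>i\<in>Basis. \<Sum>j\<in>Basis. ((a \<bullet> i) * (b \<bullet> j)) *\<^sub>R B i j)"
proof -
  have "B a b = B (\<Sum>i\<in>Basis. (a \<bullet> i) *\<^sub>R i) (\<Sum>j\<in>Basis. (b \<bullet> j) *\<^sub>R j)"
    by (simp add: euclidean_representation)
  also have "\<dots> = (\<Sum>i\<in>Basis. \<Sum>j\<in>Basis. ((a \<bullet> i) * (b \<bullet> j)) *\<^sub>R B i j)"
    by (simp add: bilinear_sum[OF assms] sum.cartesian_product bilinear_lmul[OF assms] bilinear_rmul[OF assms] case_prod_unfold ac_simps)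
  finally show ?thesis .
qed

lemma bilin_field_sum:
  assumes "bilin_field U h" "y \<in> U"
  shows "h y a b = (\<Sum>i\<in>Basis. \<Sum>j\<in>Basis. ((a \<bullet> i) * (b \<bullet> j)) *\<^sub>R h y i j)"
  using bilinear_basis_sum assms unfolding bilin_field_def by blast

lemma bilin_field_smooth:
  fixes F a b :: "'x::real_normed_vector \<Rightarrow> 'e::euclidean_space"
  assumes h: "bilin_field U h" and V: "open V" "F ` V \<subseteq> U"
    and s: "smooth_on V F" "smooth_on V a" "smooth_on V b"
  shows "smooth_on V (\<lambda>z. h (F z) (a z) (b z))"
proof -
  have U: "open U" "\<And>i j. smooth_on U (\<lambda>y. h y i j)" using h by (auto simp: bilin_field_def)
  have "smooth_on V (\<lambda>z. \<Sum>i\<in>Basis. \<Sum>j\<in>Basis. ((a z \<bullet> i) * (b z \<bullet> j)) *\<^sub>R h (F z) i j)"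
    using smooth_on_compose[OF V(1) U(1) V(2) s(1) U(2)]
    by (intro smooth_on_sum V smooth_on_scaleR smooth_on_mult smooth_on_inner s smooth_on_const)
  then show ?thesis
    by (rule smooth_on_cong[OF V(1)]) (use bilin_field_sum[OF h] V in auto)
qed

lemma bilin_field_add_scale:
  assumes "bilin_field U h" "y \<in> U"
  shows "h y (a + a') b = h y a b + h y a' b" "h y a (b + b') = h y a b + h y a b'"
    "h y (r *\<^sub>R a) b = r *\<^sub>R h y a b" "h y a (r *\<^sub>R b) = r *\<^sub>R h y a b"
    "h y (- a) b = - h y a b" "h y a (- b) = - h y a b"
    "h y (a - a') b = h y a b - h y a' b" "h y a (b - b') = h y a b - h y a b'"
    "h y 0 b = 0" "h y a 0 = 0"
  using assms unfolding bilin_field_def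
  by (auto simp: bilinear_ladd bilinear_radd bilinear_lmul bilinear_rmul bilinear_lneg bilinear_rneg
      bilinear_lsub bilinear_rsub bilinear_lzero bilinear_rzero)

lemma bilin_field_has_derivative_const:
  assumes "bilin_field U h" "y \<in> U"
  shows "((\<lambda>y. h y a b) has_derivative (\<lambda>v. bilin_deriv h y v a b)) (at y)"
  using smooth_on_has_derivative[of U "\<lambda>y. h y a b" y] assms unfolding bilin_field_def bilin_deriv_def by blast

text \<open>The coefficients of the basis expansion do not involve the base point, so
  differentiation passes through the sum. Bilinearity of the derivative is read off from this
  formula.\<close>

lemma bilin_deriv_sum:
  assumes h: "bilin_field U h" and y: "y \<in> U"
  shows "bilin_deriv h y v a b = (\<Sum>i\<in>Basis. \<Sum>j\<in>Basis. ((a \<bullet> i) * (b \<bullet> j)) *\<^sub>R bilin_deriv h y v i j)"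
proof -
  have "((\<lambda>y. \<Sum>i\<in>Basis. \<Sum>j\<in>Basis. ((a \<bullet> i) * (b \<bullet> j)) *\<^sub>R h y i j) has_derivative
      (\<lambda>v. \<Sum>i\<in>Basis. \<Sum>j\<in>Basis. ((a \<bullet> i) * (b \<bullet> j)) *\<^sub>R bilin_deriv h y v i j)) (at y)"
    by (intro has_derivative_sum has_derivative_scaleR_right bilin_field_has_derivative_const[OF h y])
  then have "((\<lambda>y. h y a b) has_derivative
      (\<lambda>v. \<Sum>i\<in>Basis. \<Sum>j\<in>Basis. ((a \<bullet> i) * (b \<bullet> j)) *\<^sub>R bilin_deriv h y v i j)) (at y)"
    apply (rule has_derivative_transform_within_open[of _ _ _ UNIV U])
    using h y bilin_field_sum[OF h] by (auto simp: bilin_field_def)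
  from has_derivative_unique[OF this bilin_field_has_derivative_const[OF h y, of a b]]
  show ?thesis by metis
qed

lemma bilin_deriv_bilinear:
  assumes h: "bilin_field U h" and y: "y \<in> U"
  shows "bilinear (bilin_deriv h y v)"
proof -
  have "bilin_deriv h y v a b = (\<Sum>i\<in>Basis. \<Sum>j\<in>Basis. ((a \<bullet> i) * (b \<bullet> j)) *\<^sub>R bilin_deriv h y v i j)" for a b
    by (rule bilin_deriv_sum[OF h y])
  then have *: "bilin_deriv h y v = (\<lambda>a b. (\<Sum>i\<in>Basis. \<Sum>j\<in>Basis. ((a \<bullet> i) * (b \<bullet> j)) *\<^sub>R bilin_deriv h y v i j))"
    by blast
  show ?thesis
    by (subst *) (auto simp: bilinear_def linear_iff inner_add_left algebra_simps sum.distrib scaleR_sum_right)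
qed

lemma bilin_deriv_linear:
  assumes h: "bilin_field U h" and y: "y \<in> U"
  shows "linear (\<lambda>v. bilin_deriv h y v a b)"
  using bilin_field_has_derivative_const[OF assms] has_derivative_linear by blast

text \<open>A product rule with three terms, one for the base point and one for each argument.
  Nearly every derivative in the geometric part is an instance of it.\<close>

lemma bilin_field_has_derivative:
  fixes F a b :: "'x::real_normed_vector \<Rightarrow> 'e::euclidean_space"
  assumes h: "bilin_field U h" and z: "F z \<in> U"
    and D: "(F has_derivative F') (at z)" "(a has_derivative a') (at z)" "(b has_derivative b') (at z)"
  shows "((\<lambda>z. h (F z) (a z) (b z)) has_derivative
    (\<lambda>v. bilin_deriv h (F z) (F' v) (a z) (b z) + h (F z) (a' v) (b z) + h (F z) (a z) (b' v))) (at z)"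
proof -
  have c: "((\<lambda>z. h (F z) i j) has_derivative (\<lambda>v. bilin_deriv h (F z) (F' v) i j)) (at z)" for i j
    using has_derivative_compose[OF D(1) bilin_field_has_derivative_const[OF h z]] .
  have s: "((\<lambda>z. \<Sum>i\<in>Basis. \<Sum>j\<in>Basis. ((a z \<bullet> i) * (b z \<bullet> j)) *\<^sub>R h (F z) i j) has_derivative
    (\<lambda>v. \<Sum>i\<in>Basis. \<Sum>j\<in>Basis. ((a z \<bullet> i) * (b z \<bullet> j)) *\<^sub>R bilin_deriv h (F z) (F' v) i j
       + ((a z \<bullet> i) * (b' v \<bullet> j) + (a' v \<bullet> i) * (b z \<bullet> j)) *\<^sub>R h (F z) i j)) (at z)"
    by (intro has_derivative_sum has_derivative_scaleR has_derivative_mult c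
        has_derivative_inner_left D)
  have e: "(\<Sum>i\<in>Basis. \<Sum>j\<in>Basis. ((a z \<bullet> i) * (b z \<bullet> j)) *\<^sub>R bilin_deriv h (F z) (F' v) i j
       + ((a z \<bullet> i) * (b' v \<bullet> j) + (a' v \<bullet> i) * (b z \<bullet> j)) *\<^sub>R h (F z) i j)
    = bilin_deriv h (F z) (F' v) (a z) (b z) + h (F z) (a' v) (b z) + h (F z) (a z) (b' v)" for v
    by (simp add: bilin_deriv_sum[OF h z, of _ "a z"] bilin_field_sum[OF h z, of "a' v" "b z"]
        bilin_field_sum[OF h z, of "a z" "b' v"] sum.distrib scaleR_add_left)
  \<comment> \<open>The basis expansion of \<open>h\<close> is valid only while \<open>F\<close>
    stays in \<open>U\<close>; continuity of \<open>F\<close> at \<open>z\<close> supplies a ball on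
    which this holds.\<close>
  obtain d where d: "d > 0" "ball (F z) d \<subseteq> U" using h z unfolding bilin_field_def by (meson openE)
  have "isCont F z" using D(1) has_derivative_continuous by blast
  then obtain k where k: "k > 0" "\<And>x. dist x z < k \<Longrightarrow> dist (F x) (F z) < d"
    using d(1) unfolding continuous_at_eps_delta by auto
  show ?thesis
  proof (rule has_derivative_transform_within_open[OF s[unfolded e], of "ball z k"])
    show "(\<Sum>i\<in>Basis. \<Sum>j\<in>Basis. (a x \<bullet> i * (b x \<bullet> j)) *\<^sub>R h (F x) i j) = h (F x) (a x) (b x)" if "x \<in> ball z k" for x
      using k(2)[of x] that d(2) bilin_field_sum[OF h, of "F x" "a x" "b x"] by (auto simp: dist_commute)
  qed (use k in auto)
qed

section \<open>Atlases and tangent vectors in a chart\<close>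

abbreviation chart_inv :: "('a, 'e) chart \<Rightarrow> 'e \<Rightarrow> 'a"
  where "chart_inv c \<equiv> inv_into (chart_dom c) (chart_map c)"

text \<open>The tangent vector at \<open>p\<close> whose coordinate vector in the chart \<open>c\<close> is \<open>a\<close>.\<close>

definition chart_tangent ::
    "('a, 'e::euclidean_space) chart set \<Rightarrow> ('a, 'e) chart \<Rightarrow> 'a \<Rightarrow> 'e \<Rightarrow> ('a, 'e) tangent"
  where "chart_tangent A c p a = (\<lambda>d. if d \<in> A \<and> p \<in> chart_dom d
    then frechet_derivative (chart_map d \<circ> chart_inv c) (at (chart_map c p)) a else 0)"

text \<open>The calculus in charts is developed for an arbitrary atlas so that it serves both the
  base \<open>A\<close> and its tangent bundle \<open>bundle_atlas A\<close>.\<close>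

locale smooth_atlas =
  fixes A :: "('a, 'e::euclidean_space) chart set"
  assumes chart_inj: "c \<in> A \<Longrightarrow> inj_on (chart_map c) (chart_dom c)"
    and chart_open: "c \<in> A \<Longrightarrow> open (chart_map c ` chart_dom c)"
    and overlap_open: "c \<in> A \<Longrightarrow> d \<in> A \<Longrightarrow> open (chart_map c ` (chart_dom c \<inter> chart_dom d))"
    and transition_smooth: "c \<in> A \<Longrightarrow> d \<in> A \<Longrightarrow>
      smooth_on (chart_map c ` (chart_dom c \<inter> chart_dom d)) (chart_map d \<circ> chart_inv c)"

lemma smooth_manifold_atlas: "smooth_manifold A \<Longrightarrow> smooth_atlas A"
  by (simp add: smooth_manifold_def smooth_atlas_def)

lemma chart_inv_mem:
  assumes "y \<in> chart_map c ` chart_dom c"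
  shows "chart_inv c y \<in> chart_dom c" "chart_map c (chart_inv c y) = y"
  using assms by (auto simp: inv_into_into f_inv_into_f)

lemma in_pointsI: "c \<in> A \<Longrightarrow> p \<in> chart_dom c \<Longrightarrow> p \<in> points A"
  by (auto simp: points_def)

context smooth_atlas
begin

lemma inv_chart: "c \<in> A \<Longrightarrow> p \<in> chart_dom c \<Longrightarrow> chart_inv c (chart_map c p) = p"
  by (simp add: chart_inj)

lemma transition_deriv:
  assumes "c \<in> A" "d \<in> A" "p \<in> chart_dom c" "p \<in> chart_dom d"
  shows "((chart_map d \<circ> chart_inv c) has_derivative (\<lambda>a. chart_tangent A c p a d)) (at (chart_map c p))"
  using smooth_on_has_derivative[OF transition_smooth[OF assms(1,2)], of "chart_map c p"] assms
  by (simp add: chart_tangent_def)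

lemma chart_tangent_self:
  assumes "c \<in> A" "p \<in> chart_dom c"
  shows "chart_tangent A c p a c = a"
proof -
  have "((\<lambda>x. x) has_derivative (\<lambda>a. chart_tangent A c p a c)) (at (chart_map c p))"
    by (rule has_derivative_transform_within_open[OF transition_deriv[OF assms(1,1) assms(2,2)]
        chart_open[OF assms(1)]]) (use assms chart_inv_mem(2) in simp_all)
  from has_derivative_unique[OF this has_derivative_ident] show ?thesis by metis
qed

lemma chart_tangent_linear:
  assumes "c \<in> A" "p \<in> chart_dom c"
  shows "linear (chart_tangent A c p)"
proof -
  have "linear (\<lambda>a. chart_tangent A c p a d)" for d
  proof (cases "d \<in> A \<and> p \<in> chart_dom d")
    case True
    then show ?thesis using has_derivative_linear[OF transition_deriv] assms by blast
  next
    case False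
    then have "(\<lambda>a. chart_tangent A c p a d) = (\<lambda>a. 0)" by (auto simp: chart_tangent_def)
    then show ?thesis by (simp add: linear_zero)
  qed
  then show ?thesis by (auto simp: linear_iff fun_eq_iff)
qed

lemmas chart_tangent_add = linear_add[OF chart_tangent_linear]
lemmas chart_tangent_scale = linear_scale[OF chart_tangent_linear]

text \<open>A velocity known in one chart determines all others by the chain rule for transition
  maps. The curve is a total function that may leave the chart away from time 0, hence the eventual
  condition.\<close>

lemma velocity_eq:
  assumes c: "c \<in> A" "\<gamma> 0 \<in> chart_dom c"
    and D: "((chart_map c \<circ> \<gamma>) has_vector_derivative a) (at 0)"
    and ev: "eventually (\<lambda>t. \<gamma> t \<in> chart_dom c) (at 0)"
  shows "velocity A \<gamma> = chart_tangent A c (\<gamma> 0) a"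
proof
  fix d
  show "velocity A \<gamma> d = chart_tangent A c (\<gamma> 0) a d"
  proof (cases "d \<in> A \<and> \<gamma> 0 \<in> chart_dom d")
    case True
    have T: "((chart_map d \<circ> chart_inv c) has_derivative (\<lambda>a. chart_tangent A c (\<gamma> 0) a d)) (at ((chart_map c \<circ> \<gamma>) 0))"
      using transition_deriv[OF c(1) _ c(2)] True by simp
    have "((\<lambda>t. (chart_map d \<circ> chart_inv c) ((chart_map c \<circ> \<gamma>) t)) has_derivative
        (\<lambda>t. chart_tangent A c (\<gamma> 0) (t *\<^sub>R a) d)) (at 0)"
      using has_derivative_compose[OF D[unfolded has_vector_derivative_def] T] .
    then have "((chart_map d \<circ> \<gamma>) has_derivative (\<lambda>t. chart_tangent A c (\<gamma> 0) (t *\<^sub>R a) d)) (at 0)"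
      by (rule has_derivative_transform_eventually)
        (use ev c in \<open>auto elim!: eventually_mono simp: inv_chart\<close>)
    then have "((chart_map d \<circ> \<gamma>) has_vector_derivative chart_tangent A c (\<gamma> 0) a d) (at 0)"
      by (simp add: has_vector_derivative_def chart_tangent_scale c)
    then show ?thesis using True by (simp add: velocity_def vector_derivative_at)
  qed (auto simp: velocity_def chart_tangent_def)
qed

lemma eventually_interval: "\<delta> > 0 \<Longrightarrow> (\<And>t. t \<in> {-\<delta><..<\<delta>} \<Longrightarrow> P t) \<Longrightarrow> eventually P (at (0::real))"
  unfolding eventually_at by (rule exI[of _ \<delta>]) (auto simp: dist_real_def abs_less_iff)

lemma curve_throughI:
  assumes "\<gamma> 0 = p" "c \<in> A" "\<delta> > 0" "\<gamma> ` {-\<delta><..<\<delta>} \<subseteq> S \<inter> chart_dom c"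
    "smooth_on {-\<delta><..<\<delta>} (chart_map c \<circ> \<gamma>)" "((chart_map c \<circ> \<gamma>) has_vector_derivative a) (at 0)"
  shows "curve_through A S p (chart_tangent A c p a) \<gamma>"
proof -
  have "\<gamma> 0 \<in> chart_dom c" using assms(3,4) by auto
  moreover have "eventually (\<lambda>t. \<gamma> t \<in> chart_dom c) (at 0)"
    using assms(3) by (rule eventually_interval) (use assms(4) in auto)
  ultimately have "velocity A \<gamma> = chart_tangent A c p a"
    using velocity_eq assms(1,2,6) by blast
  then show ?thesis using assms unfolding curve_through_def by blast
qed

text \<open>The definition of \<open>curve_through\<close> offers some chart of its own choosing.
  Passing to a prescribed chart \<open>c\<close> requires shrinking the time interval until the
  curve stays in the overlap; injectivity of the chart map turns membership of coordinates into
  membership of points.\<close>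

lemma curve_throughD:
  assumes \<gamma>: "curve_through A S p v \<gamma>" and c: "c \<in> A" "p \<in> chart_dom c"
  obtains \<delta> where "\<delta> > 0" "\<gamma> 0 = p" "\<gamma> ` {-\<delta><..<\<delta>} \<subseteq> S \<inter> chart_dom c"
    "smooth_on {-\<delta><..<\<delta>} (chart_map c \<circ> \<gamma>)" "((chart_map c \<circ> \<gamma>) has_vector_derivative v c) (at 0)"
    "v = chart_tangent A c p (v c)"
proof -
  obtain d \<delta> where \<gamma>0: "\<gamma> 0 = p" and v: "velocity A \<gamma> = v" and d: "d \<in> A" "\<delta> > 0"
      "\<gamma> ` {-\<delta><..<\<delta>} \<subseteq> S \<inter> chart_dom d" and s: "smooth_on {-\<delta><..<\<delta>} (chart_map d \<circ> \<gamma>)"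
    using \<gamma> unfolding curve_through_def by blast
  let ?T = "chart_map d ` (chart_dom d \<inter> chart_dom c)"
  have pd: "p \<in> chart_dom d" using d \<gamma>0 by auto
  have "open ({-\<delta><..<\<delta>} \<inter> (chart_map d \<circ> \<gamma>) -` ?T)"
    using continuous_open_preimage[OF smooth_on_continuous[OF s] _ overlap_open[OF d(1) c(1)]] by simp
  moreover have "0 \<in> {-\<delta><..<\<delta>} \<inter> (chart_map d \<circ> \<gamma>) -` ?T"
    using d(2) \<gamma>0 pd c by auto
  ultimately obtain e where e: "e > 0" "ball 0 e \<subseteq> {-\<delta><..<\<delta>} \<inter> (chart_map d \<circ> \<gamma>) -` ?T"
    by (meson openE)
  have I: "ball 0 e = {-e<..<e}" by (auto simp: dist_real_def)
  have eT: "t \<in> {-\<delta><..<\<delta>}" "chart_map d (\<gamma> t) \<in> ?T" if "t \<in> {-e<..<e}" for t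
    using e(2) that unfolding I by auto
  have dom: "\<gamma> t \<in> S \<inter> chart_dom c \<inter> chart_dom d" if t: "t \<in> {-e<..<e}" for t
  proof -
    have g: "\<gamma> t \<in> S \<inter> chart_dom d" using d(3) eT(1)[OF t] by auto
    obtain q where "q \<in> chart_dom d \<inter> chart_dom c" "chart_map d (\<gamma> t) = chart_map d q"
      using eT(2)[OF t] by auto
    then show ?thesis using g inj_onD[OF chart_inj[OF d(1)]] by auto
  qed
  have "smooth_on {-e<..<e} (\<lambda>t. (chart_map c \<circ> chart_inv d) ((chart_map d \<circ> \<gamma>) t))"
    by (rule smooth_on_compose[OF _ overlap_open[OF d(1) c(1)] _ smooth_on_subset[OF s] transition_smooth[OF d(1) c(1)]])
      (simp, rule image_subsetI, use eT in simp, rule subsetI, use eT in simp)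
  then have sc: "smooth_on {-e<..<e} (chart_map c \<circ> \<gamma>)"
    by (rule smooth_on_cong[rotated]) (use dom inv_chart d in auto)
  define w where "w = vector_derivative (chart_map c \<circ> \<gamma>) (at 0)"
  have w: "((chart_map c \<circ> \<gamma>) has_vector_derivative w) (at 0)"
    unfolding w_def vector_derivative_works[symmetric] differentiable_def
    using smooth_on_has_derivative[OF sc, of 0] e(1) by auto
  have "v = chart_tangent A c p w"
    using velocity_eq[of c \<gamma> w] c w \<gamma>0 v eventually_interval[OF e(1), of "\<lambda>t. \<gamma> t \<in> chart_dom c"] dom
    by auto
  then have "v c = w" "v = chart_tangent A c p (v c)" using chart_tangent_self[OF c] by auto
  then show thesis using dom by (intro that[OF e(1) \<gamma>0 _ sc] image_subsetI) (simp_all add: w)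
qed

lemma tangent_space_chart:
  assumes "v \<in> tangent_space A S p" "c \<in> A" "p \<in> chart_dom c"
  shows "p \<in> S" "v = chart_tangent A c p (v c)"
proof -
  obtain \<gamma> where \<gamma>: "curve_through A S p v \<gamma>" using assms unfolding tangent_space_def by blast
  obtain \<delta> :: real where "\<delta> > 0" "\<gamma> 0 = p" "\<gamma> ` {-\<delta><..<\<delta>} \<subseteq> S \<inter> chart_dom c" "v = chart_tangent A c p (v c)"
    using curve_throughD[OF \<gamma> assms(2,3)] by blast
  moreover from this have "\<gamma> 0 \<in> S" by auto
  ultimately show "p \<in> S" "v = chart_tangent A c p (v c)" by auto
qed

lemma tangent_space_ex_chart:
  assumes "v \<in> tangent_space A S p"
  obtains c where "c \<in> A" "p \<in> chart_dom c"
proof -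
  obtain \<gamma> c and \<delta> :: real where "\<gamma> 0 = p" "c \<in> A" "\<delta> > 0" "\<gamma> ` {-\<delta><..<\<delta>} \<subseteq> S \<inter> chart_dom c"
    using assms unfolding tangent_space_def curve_through_def by blast
  moreover from this have "\<gamma> 0 \<in> chart_dom c" by auto
  ultimately show thesis using that by auto
qed

text \<open>The chain rule through a local extension \<open>F\<close> of \<open>f\<close>. Agreement
  of \<open>f\<close> with \<open>F\<close> is needed only on \<open>S\<close>, because the curve
  does not leave \<open>S\<close> near time 0; the outcome depends on the curve through its velocity
  alone.\<close>

lemma curve_has_derivative:
  assumes \<gamma>: "curve_through A S p v \<gamma>" and c: "c \<in> A" "p \<in> chart_dom c"
    and V: "open V" "chart_map c p \<in> V" "\<And>q. q \<in> S \<inter> chart_dom c \<Longrightarrow> chart_map c q \<in> V \<Longrightarrow> f q = F (chart_map c q)"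
    and F: "(F has_derivative D) (at (chart_map c p))"
  shows "((f \<circ> \<gamma>) has_vector_derivative D (v c)) (at 0)"
proof -
  obtain \<delta> where \<delta>: "\<delta> > 0" "\<gamma> 0 = p" "\<gamma> ` {-\<delta><..<\<delta>} \<subseteq> S \<inter> chart_dom c"
    "smooth_on {-\<delta><..<\<delta>} (chart_map c \<circ> \<gamma>)" "((chart_map c \<circ> \<gamma>) has_vector_derivative v c) (at 0)"
    using curve_throughD[OF \<gamma> c] by blast
  have F': "(F has_derivative D) (at ((chart_map c \<circ> \<gamma>) 0))" using F \<delta> by simp
  have "((\<lambda>t. F ((chart_map c \<circ> \<gamma>) t)) has_derivative (\<lambda>t. D (t *\<^sub>R v c))) (at 0)"
    using has_derivative_compose[OF \<delta>(5)[unfolded has_vector_derivative_def] F'] .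
  then have 1: "((\<lambda>t. F ((chart_map c \<circ> \<gamma>) t)) has_vector_derivative D (v c)) (at 0)"
    by (simp add: has_vector_derivative_def linear_scale[OF has_derivative_linear[OF F]])
  have o: "open ({-\<delta><..<\<delta>} \<inter> (chart_map c \<circ> \<gamma>) -` V)"
    using continuous_open_preimage[OF smooth_on_continuous[OF \<delta>(4)] _ V(1)] by simp
  show ?thesis
  proof (rule has_vector_derivative_transform_within_open[OF 1 o])
    show "0 \<in> {-\<delta><..<\<delta>} \<inter> (chart_map c \<circ> \<gamma>) -` V" using \<delta> V by auto
    fix t assume "t \<in> {-\<delta><..<\<delta>} \<inter> (chart_map c \<circ> \<gamma>) -` V"
    then have "\<gamma> t \<in> S \<inter> chart_dom c" "chart_map c (\<gamma> t) \<in> V" using subsetD[OF \<delta>(3) imageI, of t] by simp_all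
    then show "F ((chart_map c \<circ> \<gamma>) t) = (f \<circ> \<gamma>) t" using V(3)[of "\<gamma> t"] by simp
  qed
qed

lemma dir_deriv_eq:
  assumes v: "v \<in> tangent_space A S p" and c: "c \<in> A" "p \<in> chart_dom c"
    and V: "open V" "chart_map c p \<in> V" "\<And>q. q \<in> S \<inter> chart_dom c \<Longrightarrow> chart_map c q \<in> V \<Longrightarrow> f q = F (chart_map c q)"
    and F: "(F has_derivative D) (at (chart_map c p))"
  shows "dir_deriv A S p v f = D (v c)"
  unfolding dir_deriv_def
proof (rule the_equality)
  show "\<exists>\<gamma>. curve_through A S p v \<gamma> \<and> ((f \<circ> \<gamma>) has_vector_derivative D (v c)) (at 0)"
    using v curve_has_derivative[OF _ c V F] unfolding tangent_space_def by blast
  show "d = D (v c)" if "\<exists>\<gamma>. curve_through A S p v \<gamma> \<and> ((f \<circ> \<gamma>) has_vector_derivative d) (at 0)" for d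
    using that curve_has_derivative[OF _ c V F] vector_derivative_unique_at by blast
qed

section \<open>The atlas topology and tangent spaces of open sets\<close>

text \<open>Induction over the generation of the topology. Binary intersections use injectivity of
  the chart map, and a generating set coming from another chart uses continuity of the transition
  map.\<close>

lemma openin_chart_image:
  assumes "openin (atlas_topology A) W" "c \<in> A"
  shows "open (chart_map c ` (W \<inter> chart_dom c))"
proof -
  let ?\<S> = "{chart_dom c \<inter> chart_map c -` V |c V. c \<in> A \<and> open V}"
  have "generate_topology_on ?\<S> W"
    using assms(1) unfolding atlas_topology_def openin_topology_generated_by_iff .
  then show ?thesis
  proof induction
    case (Int a b)
    have "chart_map c ` (a \<inter> b \<inter> chart_dom c) =
        chart_map c ` (a \<inter> chart_dom c) \<inter> chart_map c ` (b \<inter> chart_dom c)"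
      using inj_onD[OF chart_inj[OF assms(2)]] by auto
    then show ?case using Int by auto
  next
    case (UN K)
    have "chart_map c ` (\<Union>K \<inter> chart_dom c) = (\<Union>k\<in>K. chart_map c ` (k \<inter> chart_dom c))" by auto
    then show ?case using UN by auto
  next
    case (Basis s)
    then obtain d V where d: "s = chart_dom d \<inter> chart_map d -` V" "d \<in> A" "open V" by blast
    let ?T = "chart_map c ` (chart_dom c \<inter> chart_dom d)"
    have "chart_map c ` (s \<inter> chart_dom c) = ?T \<inter> (chart_map d \<circ> chart_inv c) -` V"
      unfolding d(1) using inv_chart[OF assms(2)] by force
    then show ?case
      using continuous_open_preimage[OF smooth_on_continuous[OF transition_smooth[OF assms(2) d(2)]]
          overlap_open[OF assms(2) d(2)] d(3)] by simp
  qed simp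
qed

lemma openin_chart_preimage: "c \<in> A \<Longrightarrow> open V \<Longrightarrow> openin (atlas_topology A) (chart_dom c \<inter> chart_map c -` V)"
  unfolding atlas_topology_def by (intro topology_generated_by_Basis) blast

lemma openin_chart_dom: "c \<in> A \<Longrightarrow> openin (atlas_topology A) (chart_dom c)"
  using openin_chart_preimage[of c UNIV] by simp

lemma topspace_atlas: "topspace (atlas_topology A) = points A"
proof
  show "topspace (atlas_topology A) \<subseteq> points A"
    unfolding atlas_topology_def topology_generated_by_topspace points_def by auto
  show "points A \<subseteq> topspace (atlas_topology A)"
    using openin_chart_dom openin_subset unfolding points_def by blast
qed

lemma openin_points: "openin (atlas_topology A) (points A)"
  using openin_topspace topspace_atlas by metis

lemma openin_subset_points: "openin (atlas_topology A) W \<Longrightarrow> W \<subseteq> points A"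
  using openin_subset topspace_atlas by metis

text \<open>The witness is the straight line with direction \<open>a\<close> in the chart, which
  remains in the open image of \<open>W\<close> for small times. Consequently an open set has the
  full tangent space at each of its points.\<close>

lemma chart_tangent_in_open:
  assumes W: "openin (atlas_topology A) W" "p \<in> W" and c: "c \<in> A" "p \<in> chart_dom c"
  shows "chart_tangent A c p a \<in> tangent_space A W p"
proof -
  let ?V = "chart_map c ` (W \<inter> chart_dom c)"
  define \<gamma> where "\<gamma> = (\<lambda>t. chart_inv c (chart_map c p + t *\<^sub>R a))"
  have "open ?V" "chart_map c p \<in> ?V" using openin_chart_image[OF W(1) c(1)] W c by auto
  moreover have "continuous_on UNIV (\<lambda>t. chart_map c p + t *\<^sub>R a)" by (intro continuous_intros)
  ultimately have "open ((\<lambda>t. chart_map c p + t *\<^sub>R a) -` ?V)" "0 \<in> (\<lambda>t. chart_map c p + t *\<^sub>R a) -` ?V"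
    using continuous_open_preimage[of UNIV] by auto
  then obtain e where e: "e > 0" "ball 0 e \<subseteq> (\<lambda>t. chart_map c p + t *\<^sub>R a) -` ?V" by (meson openE)
  have I: "ball 0 e = {-e<..<e}" by (auto simp: dist_real_def)
  have m: "chart_map c p + t *\<^sub>R a \<in> ?V" if "t \<in> {-e<..<e}" for t using e that unfolding I by auto
  have 1: "\<gamma> t \<in> W \<inter> chart_dom c" "chart_map c (\<gamma> t) = chart_map c p + t *\<^sub>R a" if t: "t \<in> {-e<..<e}" for t
  proof -
    obtain q where "q \<in> W \<inter> chart_dom c" "chart_map c p + t *\<^sub>R a = chart_map c q" using m[OF t] by auto
    then show "\<gamma> t \<in> W \<inter> chart_dom c" "chart_map c (\<gamma> t) = chart_map c p + t *\<^sub>R a"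
      using inv_chart[OF c(1)] by (auto simp: \<gamma>_def)
  qed
  have b: "bounded_linear (\<lambda>t::real. t *\<^sub>R a)" by (rule bounded_linear_scaleR_left)
  have "curve_through A W p (chart_tangent A c p a) \<gamma>"
  proof (rule curve_throughI[OF _ c(1) e(1)])
    show "smooth_on {-e<..<e} (chart_map c \<circ> \<gamma>)"
      by (rule smooth_on_cong[where f = "\<lambda>t. chart_map c p + t *\<^sub>R a"])
        (auto simp: 1 intro!: smooth_on_add smooth_on_const smooth_on_bounded_linear[OF _ b])
    show "((chart_map c \<circ> \<gamma>) has_vector_derivative a) (at 0)"
      by (rule has_vector_derivative_transform_within_open[where f = "\<lambda>t. chart_map c p + t *\<^sub>R a" and S = "{-e<..<e}"])
        (auto simp: 1 e intro!: derivative_eq_intros)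
  qed (use 1 c in \<open>auto simp: \<gamma>_def inv_chart\<close>)
  then show ?thesis unfolding tangent_space_def by blast
qed

lemma tangent_space_openin:
  assumes "openin (atlas_topology A) W" "p \<in> W"
  shows "tangent_space A W p = full_tangent_space A p"
proof -
  obtain c where c: "c \<in> A" "p \<in> chart_dom c"
    using openin_subset_points[OF assms(1)] assms(2) unfolding points_def by blast
  have "tangent_space A W p = range (chart_tangent A c p)" if W: "openin (atlas_topology A) W" "p \<in> W" for W
    using chart_tangent_in_open[OF W c] tangent_space_chart(2)[OF _ c] by blast
  from this[OF assms] this[OF openin_points] show ?thesis
    using in_pointsI[OF c] by simp
qed

lemma chart_tangent_full: "c \<in> A \<Longrightarrow> p \<in> chart_dom c \<Longrightarrow> chart_tangent A c p a \<in> full_tangent_space A p"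
  by (rule chart_tangent_in_open[OF openin_points in_pointsI])

lemma full_tangent_chart: "v \<in> full_tangent_space A p \<Longrightarrow> c \<in> A \<Longrightarrow> p \<in> chart_dom c \<Longrightarrow> chart_tangent A c p (v c) = v"
  using tangent_space_chart(2) by metis

lemma full_tangent_subspace: "p \<in> points A \<Longrightarrow> subspace (full_tangent_space A p)"
proof -
  assume "p \<in> points A"
  then obtain c where c: "c \<in> A" "p \<in> chart_dom c" by (auto simp: points_def)
  have "full_tangent_space A p = range (chart_tangent A c p)"
    using chart_tangent_full[OF c] tangent_space_chart(2)[OF _ c] by blast
  then show ?thesis using linear_subspace_image[OF chart_tangent_linear[OF c] subspace_UNIV] by simp
qed

lemma tangent_eqI:
  assumes "v \<in> tangent_space A S p" "w \<in> tangent_space A T p" "c \<in> A" "p \<in> chart_dom c" "v c = w c"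
  shows "v = w"
  using tangent_space_chart(2)[OF assms(1,3,4)] tangent_space_chart(2)[OF assms(2,3,4)] assms(5) by metis

lemma tangent_space_subset:
  assumes "v \<in> tangent_space A S p" "S \<subseteq> T"
  shows "v \<in> tangent_space A T p"
  using assms unfolding tangent_space_def curve_through_def by blast

lemma tangent_space_points: "v \<in> tangent_space A S p \<Longrightarrow> v \<in> full_tangent_space A p"
  by (metis chart_tangent_full tangent_space_chart(2) tangent_space_ex_chart)

lemma tangent_space_Int_open:
  assumes v: "v \<in> tangent_space A S p" and W: "openin (atlas_topology A) W" "p \<in> W"
  shows "v \<in> tangent_space A (S \<inter> W) p"
proof -
  obtain c where c: "c \<in> A" "p \<in> chart_dom c" using tangent_space_ex_chart[OF v] .
  obtain \<gamma> where \<gamma>: "curve_through A S p v \<gamma>" using v unfolding tangent_space_def by blast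
  obtain \<delta> where \<delta>: "\<delta> > 0" "\<gamma> 0 = p" "\<gamma> ` {-\<delta><..<\<delta>} \<subseteq> S \<inter> chart_dom c"
    "smooth_on {-\<delta><..<\<delta>} (chart_map c \<circ> \<gamma>)" "((chart_map c \<circ> \<gamma>) has_vector_derivative v c) (at 0)"
    "v = chart_tangent A c p (v c)"
    using curve_throughD[OF \<gamma> c] by blast
  let ?V = "chart_map c ` (W \<inter> chart_dom c)"
  have "open ({-\<delta><..<\<delta>} \<inter> (chart_map c \<circ> \<gamma>) -` ?V)"
    using continuous_open_preimage[OF smooth_on_continuous[OF \<delta>(4)] _ openin_chart_image[OF W(1) c(1)]] by simp
  moreover have "0 \<in> {-\<delta><..<\<delta>} \<inter> (chart_map c \<circ> \<gamma>) -` ?V" using \<delta> W c by auto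
  ultimately obtain e where e: "e > 0" "ball 0 e \<subseteq> {-\<delta><..<\<delta>} \<inter> (chart_map c \<circ> \<gamma>) -` ?V"
    by (meson openE)
  have I: "ball 0 e = {-e<..<e}" by (auto simp: dist_real_def)
  have "\<gamma> t \<in> S \<inter> W \<inter> chart_dom c" "t \<in> {-\<delta><..<\<delta>}" if t: "t \<in> {-e<..<e}" for t
  proof -
    show t': "t \<in> {-\<delta><..<\<delta>}" using e(2) t unfolding I by auto
    have g: "\<gamma> t \<in> S \<inter> chart_dom c" using \<delta>(3) t' by auto
    obtain q where "q \<in> W \<inter> chart_dom c" "chart_map c (\<gamma> t) = chart_map c q"
      using e(2) t unfolding I by auto
    then show "\<gamma> t \<in> S \<inter> W \<inter> chart_dom c" using g inj_onD[OF chart_inj[OF c(1)]] by auto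
  qed
  then have "curve_through A (S \<inter> W) p (chart_tangent A c p (v c)) \<gamma>"
    by (intro curve_throughI[OF \<delta>(2) c(1) e(1) _ _ \<delta>(5)] smooth_on_subset[OF \<delta>(4)]) auto
  then show ?thesis using \<delta>(6) unfolding tangent_space_def by auto
qed

section \<open>Smooth functions and vector fields in a prescribed chart\<close>

text \<open>The extension granted by \<open>smooth_fun\<close> lives in an unspecified chart
  \<open>d\<close>; precomposing it with the transition map from \<open>c\<close> to
  \<open>d\<close> moves it to the chart that is wanted.\<close>

lemma smooth_fun_chart:
  assumes f: "smooth_fun A S f" "p \<in> S" and c: "c \<in> A" "p \<in> chart_dom c"
  obtains V F where "open V" "chart_map c p \<in> V" "V \<subseteq> chart_map c ` chart_dom c" "smooth_on V F"
    "\<And>q. q \<in> S \<inter> chart_dom c \<Longrightarrow> chart_map c q \<in> V \<Longrightarrow> f q = F (chart_map c q)"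
proof -
  obtain d V F where d: "d \<in> A" "p \<in> chart_dom d" and V: "open V" "chart_map d p \<in> V" "smooth_on V F"
    "\<And>q. q \<in> S \<inter> chart_dom d \<Longrightarrow> chart_map d q \<in> V \<Longrightarrow> f q = F (chart_map d q)"
    using bspec[OF f(1)[unfolded smooth_fun_def] f(2)] by blast
  let ?T = "chart_map c ` (chart_dom c \<inter> chart_dom d)"
  let ?\<tau> = "chart_map d \<circ> chart_inv c"
  let ?V = "?T \<inter> ?\<tau> -` V"
  have o: "open ?V"
    using continuous_open_preimage[OF smooth_on_continuous[OF transition_smooth[OF c(1) d(1)]]
          overlap_open[OF c(1) d(1)] V(1)] .
  show thesis
  proof (rule that[OF o, of "\<lambda>y. F (?\<tau> y)"])
    show "chart_map c p \<in> ?V" using c d V inv_chart[OF c] by auto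
    show "smooth_on ?V (\<lambda>y. F (?\<tau> y))"
      by (rule smooth_on_compose[OF o V(1) _ smooth_on_subset[OF transition_smooth[OF c(1) d(1)]] V(3)]) auto
    fix q assume q: "q \<in> S \<inter> chart_dom c" "chart_map c q \<in> ?V"
    then obtain q' where q': "q' \<in> chart_dom c \<inter> chart_dom d" "chart_map c q = chart_map c q'" by auto
    then have "q' = q" using q inj_onD[OF chart_inj[OF c(1)]] by auto
    then have "q \<in> S \<inter> chart_dom d" "?\<tau> (chart_map c q) = chart_map d q"
      using q(1) q'(1) inv_chart[OF c(1)] by simp_all
    then show "f q = F (?\<tau> (chart_map c q))" using q(2) V(4)[of q] by simp
  qed auto
qed

lemma smooth_fun_open_chart:
  assumes f: "smooth_fun A W f" and W: "openin (atlas_topology A) W" and c: "c \<in> A"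
  shows "smooth_on (chart_map c ` (W \<inter> chart_dom c)) (\<lambda>y. f (chart_inv c y))"
proof (rule smooth_on_local)
  fix y assume "y \<in> chart_map c ` (W \<inter> chart_dom c)"
  then obtain p where p: "p \<in> W" "p \<in> chart_dom c" "y = chart_map c p" by auto
  obtain V F where V: "open V" "chart_map c p \<in> V" "V \<subseteq> chart_map c ` chart_dom c" "smooth_on V F"
    "\<And>q. q \<in> W \<inter> chart_dom c \<Longrightarrow> chart_map c q \<in> V \<Longrightarrow> f q = F (chart_map c q)"
    using smooth_fun_chart[OF f p(1) c p(2)] by blast
  let ?V = "V \<inter> chart_map c ` (W \<inter> chart_dom c)"
  have o: "open ?V" using V(1) openin_chart_image[OF W c] by auto
  have "smooth_on ?V (\<lambda>y. f (chart_inv c y))"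
    by (rule smooth_on_cong[OF o smooth_on_subset[OF V(4)]]) (use V(5) inv_chart[OF c] in auto)
  then show "\<exists>V. open V \<and> y \<in> V \<and> smooth_on V (\<lambda>y. f (chart_inv c y))"
    using o V(2) p by blast
qed

lemma smooth_fun_openI:
  assumes W: "openin (atlas_topology A) W"
    and s: "\<And>p. p \<in> W \<Longrightarrow> \<exists>c\<in>A. p \<in> chart_dom c \<and> smooth_on (chart_map c ` (W \<inter> chart_dom c)) (\<lambda>y. f (chart_inv c y))"
  shows "smooth_fun A W f"
  unfolding smooth_fun_def
proof
  fix p assume "p \<in> W"
  then obtain c where c: "c \<in> A" "p \<in> chart_dom c"
      "smooth_on (chart_map c ` (W \<inter> chart_dom c)) (\<lambda>y. f (chart_inv c y))" using s by blast
  show "\<exists>c\<in>A. p \<in> chart_dom c \<and> (\<exists>V F. open V \<and> chart_map c p \<in> V \<and> smooth_on V F \<and>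
    (\<forall>q\<in>W \<inter> chart_dom c. chart_map c q \<in> V \<longrightarrow> f q = F (chart_map c q)))"
  proof (intro bexI conjI exI)
    show "smooth_on (chart_map c ` (W \<inter> chart_dom c)) (\<lambda>y. f (chart_inv c y))" by fact
    show "open (chart_map c ` (W \<inter> chart_dom c))" by (rule openin_chart_image[OF W c(1)])
  qed (use c \<open>p \<in> W\<close> inv_chart in auto)
qed

lemma smooth_fun_subset: "smooth_fun A S f \<Longrightarrow> T \<subseteq> S \<Longrightarrow> smooth_fun A T f"
  unfolding smooth_fun_def by (rule ballI) (drule bspec, erule subsetD, assumption, blast)

lemma vector_field_chart:
  assumes X: "vector_field A S X" "p \<in> S" and c: "c \<in> A" "p \<in> chart_dom c"
  shows "X p = chart_tangent A c p (X p c)" "X p \<in> full_tangent_space A p"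
  using X tangent_space_chart(2)[OF _ c] tangent_space_points unfolding vector_field_def by blast+

lemma vector_field_open_smooth:
  assumes X: "vector_field A W X" and W: "openin (atlas_topology A) W" and c: "c \<in> A"
  shows "smooth_on (chart_map c ` (W \<inter> chart_dom c)) (\<lambda>y. X (chart_inv c y) c)"
  using smooth_fun_open_chart[of "W \<inter> chart_dom c" "\<lambda>q. X q c" c] X c openin_Int[OF W openin_chart_dom[OF c]]
  unfolding vector_field_def by (simp add: Int_assoc)

text \<open>\<open>vector_field\<close> demands smooth components in every chart, but one chart
  around each point is enough: the components in another chart are the derivative of the transition
  map applied to the given ones.\<close>

lemma vector_fieldI:
  assumes T: "\<And>p. p \<in> S \<Longrightarrow> X p \<in> tangent_space A S p"
    and s: "\<And>p. p \<in> S \<Longrightarrow> \<exists>c\<in>A. p \<in> chart_dom c \<and> (\<exists>V F. open V \<and> chart_map c p \<in> V \<and> smooth_on V F \<and>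
      (\<forall>q\<in>S \<inter> chart_dom c. chart_map c q \<in> V \<longrightarrow> X q c = F (chart_map c q)))"
  shows "vector_field A S X"
  unfolding vector_field_def smooth_fun_def
proof (intro conjI ballI T)
  fix d p assume d: "d \<in> A" and p: "p \<in> S \<inter> chart_dom d"
  obtain c V F where c: "c \<in> A" "p \<in> chart_dom c" and V: "open V" "chart_map c p \<in> V" "smooth_on V F"
      "\<And>q. q \<in> S \<inter> chart_dom c \<Longrightarrow> chart_map c q \<in> V \<Longrightarrow> X q c = F (chart_map c q)"
    using s[of p] p by (metis IntD1)
  let ?T = "chart_map c ` (chart_dom c \<inter> chart_dom d)"
  let ?\<tau> = "chart_map d \<circ> chart_inv c"
  let ?V = "?T \<inter> V"
  have o: "open ?V" using overlap_open[OF c(1) d] V by auto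
  show "\<exists>c\<in>A. p \<in> chart_dom c \<and> (\<exists>V F. open V \<and> chart_map c p \<in> V \<and> smooth_on V F \<and>
      (\<forall>q\<in>S \<inter> chart_dom d \<inter> chart_dom c. chart_map c q \<in> V \<longrightarrow> X q d = F (chart_map c q)))"
  proof (intro bexI[OF _ c(1)] conjI exI ballI impI)
    show "p \<in> chart_dom c" "open ?V" by fact+
    show "chart_map c p \<in> ?V" using c V p by auto
    show "smooth_on ?V (\<lambda>y. frechet_derivative ?\<tau> (at y) (F y))"
      using smooth_on_subset[OF V(3)]
      by (intro smooth_on_frechet_apply[OF overlap_open[OF c(1) d] o _ transition_smooth[OF c(1) d]]
          smooth_on_id o) auto
    fix q assume q: "q \<in> S \<inter> chart_dom d \<inter> chart_dom c" "chart_map c q \<in> ?V"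
    have "X q = chart_tangent A c q (F (chart_map c q))"
      using tangent_space_chart(2)[OF T c(1), of q] q V(4) by auto
    then have "X q d = chart_tangent A c q (F (chart_map c q)) d" by simp
    then show "X q d = frechet_derivative ?\<tau> (at (chart_map c q)) (F (chart_map c q))"
      using q d by (simp add: chart_tangent_def)
  qed
qed

lemma vector_field_openI:
  assumes W: "openin (atlas_topology A) W" and T: "\<And>p. p \<in> W \<Longrightarrow> X p \<in> full_tangent_space A p"
    and s: "\<And>p. p \<in> W \<Longrightarrow> \<exists>c\<in>A. p \<in> chart_dom c \<and> smooth_on (chart_map c ` (W \<inter> chart_dom c)) (\<lambda>y. X (chart_inv c y) c)"
  shows "vector_field A W X"
proof (rule vector_fieldI)
  show "X p \<in> tangent_space A W p" if "p \<in> W" for p using T tangent_space_openin[OF W] that by auto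
  fix p assume "p \<in> W"
  then obtain c where c: "c \<in> A" "p \<in> chart_dom c"
      "smooth_on (chart_map c ` (W \<inter> chart_dom c)) (\<lambda>y. X (chart_inv c y) c)" using s by blast
  show "\<exists>c\<in>A. p \<in> chart_dom c \<and> (\<exists>V F. open V \<and> chart_map c p \<in> V \<and> smooth_on V F \<and>
      (\<forall>q\<in>W \<inter> chart_dom c. chart_map c q \<in> V \<longrightarrow> X q c = F (chart_map c q)))"
  proof (intro bexI[OF _ c(1)] conjI exI)
    show "smooth_on (chart_map c ` (W \<inter> chart_dom c)) (\<lambda>y. X (chart_inv c y) c)" by fact
    show "open (chart_map c ` (W \<inter> chart_dom c))" by (rule openin_chart_image[OF W c(1)])
  qed (use c \<open>p \<in> W\<close> inv_chart in auto)
qed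

lemma vector_field_chart_tangent:
  assumes c: "c \<in> A" and W: "openin (atlas_topology A) W" "W \<subseteq> chart_dom c"
    and F: "smooth_on (chart_map c ` W) F"
  shows "vector_field A W (\<lambda>q. chart_tangent A c q (F (chart_map c q)))"
proof (rule vector_field_openI[OF W(1)])
  show "chart_tangent A c p (F (chart_map c p)) \<in> full_tangent_space A p" if "p \<in> W" for p
    using chart_tangent_full[OF c] W(2) that by blast
  have W': "W \<inter> chart_dom c = W" using W(2) by auto
  have "smooth_on (chart_map c ` W) (\<lambda>y. chart_tangent A c (chart_inv c y) (F (chart_map c (chart_inv c y))) c)"
  proof (rule smooth_on_cong[OF _ F])
    show "open (chart_map c ` W)" using openin_chart_image[OF W(1) c] W' by simp
    fix y assume "y \<in> chart_map c ` W"
    then obtain q where "q \<in> W" "y = chart_map c q" by auto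
    then show "F y = chart_tangent A c (chart_inv c y) (F (chart_map c (chart_inv c y))) c"
      using W(2) chart_tangent_self[OF c] inv_chart[OF c] by auto
  qed
  then show "\<exists>c'\<in>A. p \<in> chart_dom c' \<and> smooth_on (chart_map c' ` (W \<inter> chart_dom c'))
      (\<lambda>y. chart_tangent A c (chart_inv c' y) (F (chart_map c (chart_inv c' y))) c')" if "p \<in> W" for p
    using c W that W' by (intro bexI[of _ c]) auto
qed

lemma vector_field_cong:
  assumes "vector_field A S X" "\<And>q. q \<in> S \<Longrightarrow> X q = Y q"
  shows "vector_field A S Y"
proof -
  have "smooth_fun A (S \<inter> chart_dom c) (\<lambda>q. Y q c)" if "c \<in> A" for c
  proof -
    have "smooth_fun A (S \<inter> chart_dom c) (\<lambda>q. X q c)" using assms(1) that unfolding vector_field_def by blast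
    then show ?thesis using assms(2) unfolding smooth_fun_def by simp
  qed
  then show ?thesis using assms unfolding vector_field_def by simp
qed

lemma vector_field_open_subset:
  assumes X: "vector_field A W X" and W: "openin (atlas_topology A) W" "openin (atlas_topology A) W'" "W' \<subseteq> W"
  shows "vector_field A W' X"
proof -
  have "X p \<in> tangent_space A W' p" if "p \<in> W'" for p
    using X that W tangent_space_openin[OF W(1), of p] tangent_space_openin[OF W(2), of p]
    unfolding vector_field_def by auto
  moreover have "smooth_fun A (W' \<inter> chart_dom c) (\<lambda>q. X q c)" if "c \<in> A" for c
    by (rule smooth_fun_subset[of "W \<inter> chart_dom c"]) (use X W(3) that in \<open>auto simp: vector_field_def\<close>)
  ultimately show ?thesis unfolding vector_field_def by simp
qed

lemma lie_bracket_chart: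
  assumes W: "openin (atlas_topology A) W" "p \<in> W" and X: "vector_field A W X" and Y: "vector_field A W Y"
    and c: "c \<in> A" "p \<in> chart_dom c"
  shows "lie_bracket A (points A) X Y p c =
    frechet_derivative (\<lambda>y. Y (chart_inv c y) c) (at (chart_map c p)) (X p c) -
    frechet_derivative (\<lambda>y. X (chart_inv c y) c) (at (chart_map c p)) (Y p c)"
proof -
  let ?V = "chart_map c ` (W \<inter> chart_dom c)"
  have V: "open ?V" "chart_map c p \<in> ?V" using openin_chart_image[OF W(1) c(1)] W c by auto
  have *: "dir_deriv A (points A) p v (\<lambda>q. Z q c) = frechet_derivative (\<lambda>y. Z (chart_inv c y) c) (at (chart_map c p)) (v c)"
    if "v \<in> full_tangent_space A p" "vector_field A W Z" for v Z
    by (rule dir_deriv_eq[OF that(1) c V _ smooth_on_has_derivative[OF vector_field_open_smooth[OF that(2) W(1) c(1)] V(2)]])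
      (simp add: inv_chart c)
  show ?thesis
    using *[OF vector_field_chart(2)[OF X W(2) c] Y] *[OF vector_field_chart(2)[OF Y W(2) c] X] c
    by (simp add: lie_bracket_def)
qed

end

text \<open>\<open>\<Phi>\<close> is the coordinate expression of \<open>F\<close> near
  \<open>p\<close>. The image curves of all curves with velocity \<open>v\<close> share one
  velocity, which resolves the definite description in \<open>pushforward\<close>.\<close>

lemma pushforward_eq:
  assumes A: "smooth_atlas A" and B: "smooth_atlas B"
    and v: "v \<in> full_tangent_space A p"
    and c: "c \<in> A" "p \<in> chart_dom c" and d: "d \<in> B" "F p \<in> chart_dom d"
    and V: "open V" "chart_map c p \<in> V"
      "\<And>q. q \<in> chart_dom c \<Longrightarrow> chart_map c q \<in> V \<Longrightarrow> F q \<in> chart_dom d \<and> chart_map d (F q) = \<Phi> (chart_map c q)"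
    and D: "(\<Phi> has_derivative D) (at (chart_map c p))"
  shows "pushforward A B F p v = chart_tangent B d (F p) (D (v c))"
proof -
  interpret A: smooth_atlas A by fact
  interpret B: smooth_atlas B by fact
  have *: "velocity B (F \<circ> \<gamma>) = chart_tangent B d (F p) (D (v c))" if \<gamma>: "curve_through A (points A) p v \<gamma>" for \<gamma>
  proof -
    obtain \<delta> where \<delta>: "\<delta> > 0" "\<gamma> 0 = p" "\<gamma> ` {-\<delta><..<\<delta>} \<subseteq> points A \<inter> chart_dom c"
      "smooth_on {-\<delta><..<\<delta>} (chart_map c \<circ> \<gamma>)"
      using A.curve_throughD[OF \<gamma> c] by blast
    have o: "open ({-\<delta><..<\<delta>} \<inter> (chart_map c \<circ> \<gamma>) -` V)"
      using continuous_open_preimage[OF smooth_on_continuous[OF \<delta>(4)] _ V(1)] by simp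
    have ev: "eventually (\<lambda>t. t \<in> {-\<delta><..<\<delta>} \<inter> (chart_map c \<circ> \<gamma>) -` V) (at 0)"
      by (rule eventually_at_in_open'[OF o]) (use \<delta> V(2) in simp)
    have "((chart_map d \<circ> F \<circ> \<gamma>) has_vector_derivative D (v c)) (at 0)"
      using A.curve_has_derivative[OF \<gamma> c V(1,2) _ D, of "chart_map d \<circ> F"] V(3) by (simp add: o_def)
    moreover have "eventually (\<lambda>t. (F \<circ> \<gamma>) t \<in> chart_dom d) (at 0)"
      using ev
    proof eventually_elim
      case (elim t)
      then have "\<gamma> t \<in> chart_dom c" "chart_map c (\<gamma> t) \<in> V" using subsetD[OF \<delta>(3) imageI, of t] by simp_all
      then show ?case using V(3) by simp
    qed
    ultimately show ?thesis using B.velocity_eq[of d "F \<circ> \<gamma>" "D (v c)"] d \<delta>(2) by (simp add: o_assoc)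
  qed
  show ?thesis unfolding pushforward_def
  proof (rule the_equality)
    show "\<exists>\<gamma>. curve_through A (points A) p v \<gamma> \<and> chart_tangent B d (F p) (D (v c)) = velocity B (F \<circ> \<gamma>)"
      using v * unfolding tangent_space_def by auto
  qed (use * in auto)
qed

section \<open>Metric coefficients and Christoffel symbols\<close>

definition metric_coeff ::
    "('a \<Rightarrow> ('a, 'e::euclidean_space) tangent \<Rightarrow> ('a, 'e) tangent \<Rightarrow> real) \<Rightarrow> ('a, 'e) chart set \<Rightarrow>
     ('a, 'e) chart \<Rightarrow> 'e \<Rightarrow> 'e \<Rightarrow> 'e \<Rightarrow> real"
  where "metric_coeff g A c y a b =
    g (chart_inv c y) (chart_tangent A c (chart_inv c y) a) (chart_tangent A c (chart_inv c y) b)"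

text \<open>The Christoffel symbols taken as a bilinear map instead of coefficients with three
  indices, so that formulas need no choice of basis.\<close>

definition christoffel ::
    "('a \<Rightarrow> ('a, 'e::euclidean_space) tangent \<Rightarrow> ('a \<Rightarrow> ('a, 'e) tangent) \<Rightarrow> ('a, 'e) tangent) \<Rightarrow>
     ('a, 'e) chart set \<Rightarrow> ('a, 'e) chart \<Rightarrow> 'e \<Rightarrow> 'e \<Rightarrow> 'e \<Rightarrow> 'e"
  where "christoffel nabla A c y a b =
    nabla (chart_inv c y) (chart_tangent A c (chart_inv c y) a) (\<lambda>q. chart_tangent A c q b) c"

text \<open>The Riemann tensor \<open>R(a,b)z\<close> evaluated on coordinate fields. These commute,
  so the bracket term of the invariant definition leaves no trace.\<close>

definition curvature_of :: "('e::euclidean_space \<Rightarrow> 'e \<Rightarrow> 'e \<Rightarrow> 'e) \<Rightarrow> 'e \<Rightarrow> 'e \<Rightarrow> 'e \<Rightarrow> 'e \<Rightarrow> 'e"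
  where "curvature_of \<Gamma> y a b z = bilin_deriv \<Gamma> y a b z - bilin_deriv \<Gamma> y b a z
    + \<Gamma> y a (\<Gamma> y b z) - \<Gamma> y b (\<Gamma> y a z)"

text \<open>The product rule for a derivative applied to a moving direction. It provides the
  second-order terms in iterated covariant derivatives and in brackets, where they have to be
  cancelled by symmetry.\<close>

lemma frechet_apply_has_derivative:
  fixes f :: "'x::euclidean_space \<Rightarrow> 'y::real_normed_vector"
  assumes U: "open U" "x \<in> U" and f: "smooth_on U f" and h: "(h has_derivative h') (at x)"
  shows "((\<lambda>y. frechet_derivative f (at y) (h y)) has_derivative
    (\<lambda>v. frechet_derivative (\<lambda>y. frechet_derivative f (at y) (h x)) (at x) v
       + frechet_derivative f (at x) (h' v))) (at x)"
proof -
  have L: "frechet_derivative f (at y) w = (\<Sum>b\<in>Basis. (w \<bullet> b) *\<^sub>R frechet_derivative f (at y) b)"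
    if "y \<in> U" for y w
    using linear_euclidean_sum[OF has_derivative_linear[OF smooth_on_has_derivative[OF f that]]] .
  define D2 where "D2 v b = frechet_derivative (\<lambda>y. frechet_derivative f (at y) b) (at x) v" for v b
  have D2: "((\<lambda>y. frechet_derivative f (at y) b) has_derivative (\<lambda>v. D2 v b)) (at x)" for b
    unfolding D2_def using smooth_on_has_derivative[OF smooth_on_frechet[OF f] U(2)] .
  have "((\<lambda>y. \<Sum>b\<in>Basis. (w \<bullet> b) *\<^sub>R frechet_derivative f (at y) b) has_derivative
      (\<lambda>v. \<Sum>b\<in>Basis. (w \<bullet> b) *\<^sub>R D2 v b)) (at x)" for w
    by (intro has_derivative_sum has_derivative_scaleR_right D2)
  then have "((\<lambda>y. frechet_derivative f (at y) w) has_derivative (\<lambda>v. \<Sum>b\<in>Basis. (w \<bullet> b) *\<^sub>R D2 v b)) (at x)" for w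
    by (rule has_derivative_transform_within_open[OF _ U]) (simp add: L[of _ w])
  from has_derivative_unique[OF this D2] have D2s: "(\<Sum>b\<in>Basis. (w \<bullet> b) *\<^sub>R D2 v b) = D2 v w" for v w
    by metis
  have "((\<lambda>y. \<Sum>b\<in>Basis. (h y \<bullet> b) *\<^sub>R frechet_derivative f (at y) b) has_derivative
      (\<lambda>v. \<Sum>b\<in>Basis. (h x \<bullet> b) *\<^sub>R D2 v b + (h' v \<bullet> b) *\<^sub>R frechet_derivative f (at x) b)) (at x)"
    by (intro has_derivative_sum has_derivative_scaleR D2 has_derivative_inner_left h)
  then have "((\<lambda>y. \<Sum>b\<in>Basis. (h y \<bullet> b) *\<^sub>R frechet_derivative f (at y) b) has_derivative
      (\<lambda>v. D2 v (h x) + frechet_derivative f (at x) (h' v))) (at x)"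
    by (simp add: sum.distrib D2s L[OF U(2), of "h' _", symmetric])
  then show ?thesis unfolding D2_def
    by (rule has_derivative_transform_within_open[OF _ U]) (simp add: L[of _ "h _", symmetric])
qed

lemma bilin_deriv_cong:
  assumes "open U" "y \<in> U" "\<And>y. y \<in> U \<Longrightarrow> h y a b = k y a' b'"
  shows "bilin_deriv h y v a b = bilin_deriv k y v a' b'"
  unfolding bilin_deriv_def
  using frechet_derivative_cong_open[OF assms(1,2), of "\<lambda>y. h y a b" "\<lambda>y. k y a' b'"] assms(3) by simp

locale levi_civita_manifold =
  fixes A :: "('a, 'e::euclidean_space) chart set"
    and g :: "'a \<Rightarrow> ('a, 'e) tangent \<Rightarrow> ('a, 'e) tangent \<Rightarrow> real"
    and nabla :: "'a \<Rightarrow> ('a, 'e) tangent \<Rightarrow> ('a \<Rightarrow> ('a, 'e) tangent) \<Rightarrow> ('a, 'e) tangent"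
  assumes prm: "pseudo_riemannian_manifold A g" and lc: "levi_civita A g nabla"

sublocale levi_civita_manifold \<subseteq> smooth_atlas A
  using prm by (simp add: pseudo_riemannian_manifold_def smooth_manifold_atlas)

context levi_civita_manifold
begin

abbreviation gc where "gc \<equiv> metric_coeff g A"
abbreviation \<Gamma> where "\<Gamma> \<equiv> christoffel nabla A"
abbreviation Rc where "Rc c \<equiv> curvature_of (\<Gamma> c)"
abbreviation cimage where "cimage c \<equiv> chart_map c ` chart_dom c"

lemmas metric_at = prm[unfolded pseudo_riemannian_manifold_def, THEN conjunct2, THEN conjunct1, THEN bspec]

lemma metric_linear:
  assumes "p \<in> points A" "u \<in> full_tangent_space A p" "v \<in> full_tangent_space A p" "w \<in> full_tangent_space A p"
  shows "g p (a *\<^sub>R u + v) w = a * g p u w + g p v w" "g p u v = g p v u"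
  using metric_at[OF assms(1), THEN conjunct1] metric_at[OF assms(1), THEN conjunct2, THEN conjunct1] assms(2-)
  by blast+

lemma metric_nondegenerate:
  assumes "p \<in> points A" "u \<in> full_tangent_space A p" "\<And>v. v \<in> full_tangent_space A p \<Longrightarrow> g p u v = 0"
  shows "u = 0"
  using metric_at[OF assms(1), THEN conjunct2, THEN conjunct2] assms(2,3) by blast

lemma metric_smooth:
  assumes "openin (atlas_topology A) W" "vector_field A W X" "vector_field A W Y"
  shows "smooth_fun A W (\<lambda>q. g q (X q) (Y q))"
  using prm[unfolded pseudo_riemannian_manifold_def, THEN conjunct2, THEN conjunct2, THEN conjunct1] assms by blast

lemma metric_coeff_eq:
  assumes "c \<in> A" "p \<in> chart_dom c"
  shows "gc c (chart_map c p) a b = g p (chart_tangent A c p a) (chart_tangent A c p b)"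
  using assms by (simp add: metric_coeff_def inv_chart)

lemma metric_chart:
  assumes "c \<in> A" "p \<in> chart_dom c" "u \<in> full_tangent_space A p" "v \<in> full_tangent_space A p"
  shows "g p u v = gc c (chart_map c p) (u c) (v c)"
  using assms by (simp add: metric_coeff_eq full_tangent_chart)

lemma christoffel_eq:
  assumes "c \<in> A" "p \<in> chart_dom c"
  shows "\<Gamma> c (chart_map c p) a b = nabla p (chart_tangent A c p a) (\<lambda>q. chart_tangent A c q b) c"
  using assms by (simp add: christoffel_def inv_chart)

lemma coordinate_field: "c \<in> A \<Longrightarrow> vector_field A (chart_dom c) (\<lambda>q. chart_tangent A c q a)"
  by (rule vector_field_chart_tangent[of c "chart_dom c" "\<lambda>_. a"])
    (auto intro: openin_chart_dom smooth_on_const chart_open)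

lemma bilin_field_metric:
  assumes c: "c \<in> A"
  shows "bilin_field (cimage c) (gc c)"
  unfolding bilin_field_def
proof (intro conjI ballI allI)
  show "open (cimage c)" by (rule chart_open[OF c])
  fix a b
  have "smooth_on (chart_map c ` (chart_dom c \<inter> chart_dom c))
      (\<lambda>y. g (chart_inv c y) (chart_tangent A c (chart_inv c y) a) (chart_tangent A c (chart_inv c y) b))"
    by (rule smooth_fun_open_chart[OF metric_smooth[OF openin_chart_dom[OF c] coordinate_field[OF c] coordinate_field[OF c]]
          openin_chart_dom[OF c] c])
  then show "smooth_on (cimage c) (\<lambda>y. gc c y a b)" by (simp add: metric_coeff_def)
next
  fix y assume "y \<in> cimage c"
  then obtain p where p: "p \<in> chart_dom c" "y = chart_map c p" by auto
  note T = chart_tangent_full[OF c p(1)]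
  note P = in_pointsI[OF c p(1)]
  have l: "linear (\<lambda>a. gc c y a b)" for b
  proof (rule linearI)
    show "gc c y (a + a') b = gc c y a b + gc c y a' b" for a a'
      using metric_linear(1)[OF P T T T, of 1 a a' b]
      by (simp add: p metric_coeff_eq[OF c] chart_tangent_add[OF c p(1)])
    \<comment> \<open>Linearity of the metric is given only for combinations of the form
      \<open>a *\<^sub>R u + v\<close>. The instance with both vectors zero shows that pairing with
      0 gives 0, and then \<open>v = 0\<close> yields homogeneity.\<close>
    show "gc c y (r *\<^sub>R a) b = r *\<^sub>R gc c y a b" for r a
      using metric_linear(1)[OF P T T T, of r a 0 b] metric_linear(1)[OF P T T T, of 1 0 0 b]
      by (simp add: p metric_coeff_eq[OF c] chart_tangent_scale[OF c p(1)] linear_0[OF chart_tangent_linear[OF c p(1)]])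
  qed
  have "gc c y a b = gc c y b a" for a b
    by (simp add: p metric_coeff_eq[OF c] metric_linear(2)[OF P T T T])
  then show "bilinear (gc c y)" using l unfolding bilinear_def by simp
qed

lemma metric_coeff_sym:
  assumes "c \<in> A" "y \<in> cimage c"
  shows "gc c y a b = gc c y b a"
proof -
  obtain p where p: "p \<in> chart_dom c" "y = chart_map c p" using assms by auto
  note T = chart_tangent_full[OF assms(1) p(1)]
  show ?thesis by (simp add: p metric_coeff_eq[OF assms(1)] metric_linear(2)[OF in_pointsI[OF assms(1) p(1)] T T T])
qed

lemma metric_coeff_nondegenerate:
  assumes c: "c \<in> A" and y: "y \<in> cimage c" and a: "\<And>b. gc c y a b = 0"
  shows "a = 0"
proof -
  obtain p where p: "p \<in> chart_dom c" "y = chart_map c p" using y by auto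
  have "chart_tangent A c p a = 0"
  proof (rule metric_nondegenerate[OF in_pointsI[OF c p(1)] chart_tangent_full[OF c p(1)]])
    fix v assume "v \<in> full_tangent_space A p"
    then show "g p (chart_tangent A c p a) v = 0"
      using a[of "v c"] metric_coeff_eq[OF c p(1)] full_tangent_chart[OF _ c p(1)] p(2) by simp
  qed
  then have "chart_tangent A c p a c = 0" by simp
  then show ?thesis using chart_tangent_self[OF c p(1)] by simp
qed

section \<open>The axioms of the connection and their form in a chart\<close>

lemma connection: "affine_connection A nabla"
  using lc unfolding levi_civita_def by blast

lemmas connection_on = connection[unfolded affine_connection_def, THEN spec, THEN mp]

lemma nabla_linear:
  assumes "openin (atlas_topology A) W" "vector_field A W Y" "p \<in> W"
    "v \<in> full_tangent_space A p" "w \<in> full_tangent_space A p"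
  shows "nabla p (a *\<^sub>R v + w) Y = a *\<^sub>R nabla p v Y + nabla p w Y"
  using connection_on[OF assms(1), THEN conjunct1] assms(2-) by blast

lemma nabla_add:
  assumes "openin (atlas_topology A) W" "vector_field A W Y" "vector_field A W Z" "p \<in> W"
    "v \<in> full_tangent_space A p"
  shows "nabla p v (\<lambda>q. Y q + Z q) = nabla p v Y + nabla p v Z"
  using connection_on[OF assms(1), THEN conjunct2, THEN conjunct1] assms(2-) by blast

lemma nabla_product:
  fixes f :: "'a \<Rightarrow> real"
  assumes "openin (atlas_topology A) W" "smooth_fun A W f" "vector_field A W Y" "p \<in> W"
    "v \<in> full_tangent_space A p"
  shows "nabla p v (\<lambda>q. f q *\<^sub>R Y q) = dir_deriv A (points A) p v f *\<^sub>R Y p + f p *\<^sub>R nabla p v Y"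
  using connection_on[OF assms(1), THEN conjunct2, THEN conjunct2, THEN conjunct1] assms(2-) by blast

lemma nabla_cong:
  assumes "openin (atlas_topology A) W" "vector_field A W Y" "p \<in> W"
    "v \<in> full_tangent_space A p" "\<And>q. q \<in> W \<Longrightarrow> Y q = Z q"
  shows "nabla p v Y = nabla p v Z"
  using connection_on[OF assms(1), THEN conjunct2, THEN conjunct2, THEN conjunct2, THEN conjunct1] assms(2-) vector_field_cong[OF assms(2,5)] by blast

lemma nabla_vector_field:
  assumes "openin (atlas_topology A) W" "vector_field A W X" "vector_field A W Y"
  shows "vector_field A W (\<lambda>q. nabla q (X q) Y)"
  using connection_on[OF assms(1), THEN conjunct2, THEN conjunct2, THEN conjunct2, THEN conjunct2] assms(2-) by blast

lemma nabla_torsion_free: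
  assumes "openin (atlas_topology A) W" "vector_field A W X" "vector_field A W Y" "p \<in> W"
  shows "nabla p (X p) Y - nabla p (Y p) X = lie_bracket A (points A) X Y p"
  using lc[unfolded levi_civita_def, THEN conjunct2, THEN conjunct1, rule_format, OF assms] .

lemma nabla_metric:
  assumes "openin (atlas_topology A) W" "vector_field A W X" "vector_field A W Y" "vector_field A W Z" "p \<in> W"
  shows "dir_deriv A (points A) p (X p) (\<lambda>q. g q (Y q) (Z q)) =
    g p (nabla p (X p) Y) (Z p) + g p (Y p) (nabla p (X p) Z)"
  using lc[unfolded levi_civita_def, THEN conjunct2, THEN conjunct2, rule_format, OF assms] .

text \<open>The axioms speak of \<open>\<lambda>q. nabla q (X q) Y\<close> being a field for a field
  \<open>X\<close>, not of a single direction. The vector \<open>v\<close> is therefore extended by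
  the coordinate field with constant components \<open>v c\<close>.\<close>

lemma nabla_in_tangent:
  assumes W: "openin (atlas_topology A) W" "vector_field A W Y" "p \<in> W" "v \<in> full_tangent_space A p"
  shows "nabla p v Y \<in> full_tangent_space A p"
proof -
  obtain c where c: "c \<in> A" "p \<in> chart_dom c"
    using openin_subset_points[OF W(1)] W(3) unfolding points_def by blast
  let ?W = "W \<inter> chart_dom c"
  have o: "openin (atlas_topology A) ?W" using W(1) openin_chart_dom[OF c(1)] by auto
  have "vector_field A ?W (\<lambda>q. nabla q (chart_tangent A c q (v c)) Y)"
    by (rule nabla_vector_field[OF o vector_field_open_subset[OF coordinate_field[OF c(1)] openin_chart_dom[OF c(1)] o]
          vector_field_open_subset[OF W(2,1) o]]) auto
  from vector_field_chart(2)[OF this _ c] show ?thesis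
    using W(3) c full_tangent_chart[OF W(4) c] by simp
qed

lemma smooth_fun_chart_compose:
  assumes c: "c \<in> A" and W: "openin (atlas_topology A) W" "W \<subseteq> chart_dom c"
    and F: "smooth_on (chart_map c ` W) F"
  shows "smooth_fun A W (\<lambda>q. F (chart_map c q))"
proof (rule smooth_fun_openI[OF W(1)])
  fix p assume p: "p \<in> W"
  have W': "W \<inter> chart_dom c = W" using W(2) by auto
  have "smooth_on (chart_map c ` W) (\<lambda>y. F (chart_map c (chart_inv c y)))"
  proof (rule smooth_on_cong[OF _ F])
    show "open (chart_map c ` W)" using openin_chart_image[OF W(1) c] W' by simp
    fix y assume "y \<in> chart_map c ` W"
    then have "y \<in> cimage c" using W(2) by auto
    then show "F y = F (chart_map c (chart_inv c y))" by (simp add: f_inv_into_f)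
  qed
  then show "\<exists>c'\<in>A. p \<in> chart_dom c' \<and> smooth_on (chart_map c' ` (W \<inter> chart_dom c')) (\<lambda>y. F (chart_map c (chart_inv c' y)))"
    using p c W(2) W' by (intro bexI[OF _ c]) auto
qed

lemma dir_deriv_chart_compose:
  assumes c: "c \<in> A" "p \<in> chart_dom c" and v: "v \<in> full_tangent_space A p"
    and U: "open U" "chart_map c p \<in> U" and F: "smooth_on U F"
    and f: "\<And>q. q \<in> chart_dom c \<Longrightarrow> chart_map c q \<in> U \<Longrightarrow> f q = F (chart_map c q)"
  shows "dir_deriv A (points A) p v f = frechet_derivative F (at (chart_map c p)) (v c)"
  by (rule dir_deriv_eq[OF v c U _ smooth_on_has_derivative[OF F U(2)]]) (use f in auto)

lemma christoffel_linear_left: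
  assumes c: "c \<in> A" and p: "p \<in> chart_dom c"
  shows "linear (\<lambda>a. \<Gamma> c (chart_map c p) a b)"
proof (rule linearI)
  note L = nabla_linear[OF openin_chart_dom[OF c] coordinate_field[OF c] p chart_tangent_full[OF c p] chart_tangent_full[OF c p]]
  show "\<Gamma> c (chart_map c p) (a + a') b = \<Gamma> c (chart_map c p) a b + \<Gamma> c (chart_map c p) a' b" for a a'
    using L[of 1 a a' b] by (simp add: christoffel_eq[OF c p] chart_tangent_add[OF c p])
  show "\<Gamma> c (chart_map c p) (r *\<^sub>R a) b = r *\<^sub>R \<Gamma> c (chart_map c p) a b" for r a
    using L[of r a 0 b] L[of 1 0 0 b]
    by (simp add: christoffel_eq[OF c p] chart_tangent_scale[OF c p] linear_0[OF chart_tangent_linear[OF c p]])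
qed

lemma christoffel_linear_right:
  assumes c: "c \<in> A" and p: "p \<in> chart_dom c"
  shows "linear (\<lambda>b. \<Gamma> c (chart_map c p) a b)"
proof (rule linearI)
  note o = openin_chart_dom[OF c] and T = chart_tangent_full[OF c p]
  show "\<Gamma> c (chart_map c p) a (b + b') = \<Gamma> c (chart_map c p) a b + \<Gamma> c (chart_map c p) a b'" for b b'
  proof -
    have "nabla p (chart_tangent A c p a) (\<lambda>q. chart_tangent A c q (b + b')) =
      nabla p (chart_tangent A c p a) (\<lambda>q. chart_tangent A c q b + chart_tangent A c q b')"
      by (rule nabla_cong[OF o coordinate_field[OF c] p T]) (rule chart_tangent_add[OF c])
    then show ?thesis
      using nabla_add[OF o coordinate_field[OF c] coordinate_field[OF c] p T] by (simp add: christoffel_eq[OF c p])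
  qed
  show "\<Gamma> c (chart_map c p) a (r *\<^sub>R b) = r *\<^sub>R \<Gamma> c (chart_map c p) a b" for r b
  proof -
    have "nabla p (chart_tangent A c p a) (\<lambda>q. chart_tangent A c q (r *\<^sub>R b)) =
      nabla p (chart_tangent A c p a) (\<lambda>q. r *\<^sub>R chart_tangent A c q b)"
      by (rule nabla_cong[OF o coordinate_field[OF c] p T]) (rule chart_tangent_scale[OF c])
    moreover have "smooth_fun A (chart_dom c) (\<lambda>q. r)"
      by (rule smooth_fun_chart_compose[OF c o, of "\<lambda>_. r"]) (auto intro: smooth_on_const chart_open c)
    moreover have "dir_deriv A (points A) p (chart_tangent A c p a) (\<lambda>q. r) = 0"
      by (rule dir_deriv_eq[OF T c p open_UNIV, of _ "\<lambda>_. r" "\<lambda>_. 0"]) auto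
    ultimately show ?thesis
      using nabla_product[OF o _ coordinate_field[OF c, of b] p T[of a], of "\<lambda>q. r"] by (simp add: christoffel_eq[OF c p])
  qed
qed

lemma bilin_field_christoffel:
  assumes c: "c \<in> A"
  shows "bilin_field (cimage c) (\<Gamma> c)"
  unfolding bilin_field_def
proof (intro conjI ballI allI)
  show "open (cimage c)" by (rule chart_open[OF c])
  fix a b
  have "smooth_on (chart_map c ` (chart_dom c \<inter> chart_dom c))
      (\<lambda>y. nabla (chart_inv c y) (chart_tangent A c (chart_inv c y) a) (\<lambda>q. chart_tangent A c q b) c)"
    by (rule vector_field_open_smooth[OF nabla_vector_field[OF openin_chart_dom[OF c] coordinate_field[OF c] coordinate_field[OF c]]
          openin_chart_dom[OF c] c])
  then show "smooth_on (cimage c) (\<lambda>y. \<Gamma> c y a b)" by (simp add: christoffel_def)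
next
  fix y assume "y \<in> cimage c"
  then obtain p where p: "p \<in> chart_dom c" "y = chart_map c p" by auto
  show "bilinear (\<Gamma> c y)"
    unfolding bilinear_def p(2) using christoffel_linear_left[OF c p(1)] christoffel_linear_right[OF c p(1)] by simp
qed

text \<open>The Leibniz rule is applied to one component at a time. As additivity is available for
  two summands only, the proof is an induction over sets of basis vectors, with \<open>HB B\<close>
  the truncation of \<open>H\<close> to the components in \<open>B\<close>; the set
  \<open>Basis\<close> gives \<open>H\<close> itself.\<close>

lemma nabla_chart_field:
  assumes c: "c \<in> A" and W: "openin (atlas_topology A) W" "W \<subseteq> chart_dom c" "p \<in> W"
    and H: "smooth_on (chart_map c ` W) H" and v: "v \<in> full_tangent_space A p"
  shows "nabla p v (\<lambda>q. chart_tangent A c q (H (chart_map c q))) c =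
    frechet_derivative H (at (chart_map c p)) (v c) + \<Gamma> c (chart_map c p) (v c) (H (chart_map c p))"
proof -
  let ?y = "chart_map c p"
  have p: "p \<in> chart_dom c" using W by auto
  have y: "?y \<in> cimage c" "?y \<in> chart_map c ` W" using p W by auto
  have oV: "open (chart_map c ` W)" using openin_chart_image[OF W(1) c] W(2) by (simp add: Int_absorb2)
  define HB where "HB B y = (\<Sum>b\<in>B. (H y \<bullet> b) *\<^sub>R b)" for B y
  have sHB: "smooth_on (chart_map c ` W) (HB B)" for B
    unfolding HB_def by (intro smooth_on_sum smooth_on_scaleR smooth_on_inner smooth_on_const H oV)
  note bl = bilin_field_add_scale[OF bilin_field_christoffel[OF c] y(1)]
  have "nabla p v (\<lambda>q. chart_tangent A c q (HB B (chart_map c q))) c =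
      (\<Sum>b\<in>B. (frechet_derivative H (at ?y) (v c) \<bullet> b) *\<^sub>R b) + \<Gamma> c ?y (v c) (HB B ?y)" if "finite B" for B
    using that
  proof (induction B rule: finite_induct)
    case empty
    have "nabla p v (\<lambda>q. chart_tangent A c q (HB {} (chart_map c q))) = nabla p v (\<lambda>q. chart_tangent A c q 0)"
      by (simp add: HB_def)
    moreover have "nabla p v (\<lambda>q. chart_tangent A c q 0) c = \<Gamma> c ?y (v c) 0"
      by (simp add: christoffel_eq[OF c p] full_tangent_chart[OF v c p])
    ultimately show ?case by (simp add: HB_def)
  next
    case (insert b B)
    have vB: "vector_field A W (\<lambda>q. chart_tangent A c q (HB B (chart_map c q)))" for B
      by (rule vector_field_chart_tangent[OF c W(1,2) sHB])
    have vb: "vector_field A W (\<lambda>q. chart_tangent A c q b)"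
      by (rule vector_field_open_subset[OF coordinate_field[OF c] openin_chart_dom[OF c] W(1,2)])
    have sb: "smooth_on (chart_map c ` W) (\<lambda>y. H y \<bullet> b)"
      by (intro smooth_on_inner smooth_on_const H oV)
    have fb: "smooth_fun A W (\<lambda>q. H (chart_map c q) \<bullet> b)"
      by (rule smooth_fun_chart_compose[OF c W(1,2) sb])
    have "vector_field A W (\<lambda>q. chart_tangent A c q ((H (chart_map c q) \<bullet> b) *\<^sub>R b))"
      by (rule vector_field_chart_tangent[OF c W(1,2), of "\<lambda>y. (H y \<bullet> b) *\<^sub>R b"])
        (intro smooth_on_scaleR sb smooth_on_const oV)
    then have vp: "vector_field A W (\<lambda>q. (H (chart_map c q) \<bullet> b) *\<^sub>R chart_tangent A c q b)"
      by (rule vector_field_cong) (use W(2) chart_tangent_scale[OF c] in auto)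
    have "nabla p v (\<lambda>q. chart_tangent A c q (HB (insert b B) (chart_map c q))) =
        nabla p v (\<lambda>q. (H (chart_map c q) \<bullet> b) *\<^sub>R chart_tangent A c q b + chart_tangent A c q (HB B (chart_map c q)))"
      using insert.hyps W(2)
      by (intro nabla_cong[OF W(1) vB W(3) v])
        (simp add: HB_def subsetD chart_tangent_add[OF c] chart_tangent_scale[OF c])
    also have "\<dots> = nabla p v (\<lambda>q. (H (chart_map c q) \<bullet> b) *\<^sub>R chart_tangent A c q b)
        + nabla p v (\<lambda>q. chart_tangent A c q (HB B (chart_map c q)))"
      by (rule nabla_add[OF W(1) vp vB W(3) v])
    also have "nabla p v (\<lambda>q. (H (chart_map c q) \<bullet> b) *\<^sub>R chart_tangent A c q b) =
        dir_deriv A (points A) p v (\<lambda>q. H (chart_map c q) \<bullet> b) *\<^sub>R chart_tangent A c p b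
        + (H ?y \<bullet> b) *\<^sub>R nabla p v (\<lambda>q. chart_tangent A c q b)"
      by (rule nabla_product[OF W(1) fb vb W(3) v])
    also have "dir_deriv A (points A) p v (\<lambda>q. H (chart_map c q) \<bullet> b) = frechet_derivative (\<lambda>y. H y \<bullet> b) (at ?y) (v c)"
      by (rule dir_deriv_chart_compose[OF c p v oV y(2) sb]) simp
    also have "\<dots> = frechet_derivative H (at ?y) (v c) \<bullet> b"
      by (rule frechet_derivative_inner) (use smooth_on_has_derivative[OF H y(2)] differentiable_def in blast)
    finally have "nabla p v (\<lambda>q. chart_tangent A c q (HB (insert b B) (chart_map c q))) c =
        (frechet_derivative H (at ?y) (v c) \<bullet> b) *\<^sub>R b + (H ?y \<bullet> b) *\<^sub>R \<Gamma> c ?y (v c) b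
        + ((\<Sum>b\<in>B. (frechet_derivative H (at ?y) (v c) \<bullet> b) *\<^sub>R b) + \<Gamma> c ?y (v c) (HB B ?y))"
      by (simp add: insert.IH chart_tangent_self[OF c p] christoffel_eq[OF c p] full_tangent_chart[OF v c p])
    moreover have "HB (insert b B) ?y = (H ?y \<bullet> b) *\<^sub>R b + HB B ?y"
      using insert.hyps by (simp add: HB_def)
    ultimately show ?case using insert.hyps by (simp add: bl)
  qed
  from this[of Basis] show ?thesis by (simp add: HB_def euclidean_representation)
qed

text \<open>Near \<open>p\<close> every field is the coordinate field built from its own components,
  and the connection depends only on the field near \<open>p\<close>; this reduces the claim to the
  previous lemma.\<close>

lemma nabla_chart:
  assumes W: "openin (atlas_topology A) W" "vector_field A W Y" "p \<in> W"
    and v: "v \<in> full_tangent_space A p" and c: "c \<in> A" "p \<in> chart_dom c"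
  shows "nabla p v Y c = frechet_derivative (\<lambda>y. Y (chart_inv c y) c) (at (chart_map c p)) (v c)
    + \<Gamma> c (chart_map c p) (v c) (Y p c)"
proof -
  let ?W = "W \<inter> chart_dom c"
  have o: "openin (atlas_topology A) ?W" using W(1) openin_chart_dom[OF c(1)] by auto
  have e: "nabla p v Y = nabla p v (\<lambda>q. chart_tangent A c q ((\<lambda>y. Y (chart_inv c y) c) (chart_map c q)))"
  proof (rule nabla_cong[OF o vector_field_open_subset[OF W(2,1) o] _ v])
    fix q assume "q \<in> ?W"
    then show "Y q = chart_tangent A c q ((\<lambda>y. Y (chart_inv c y) c) (chart_map c q))"
      using vector_field_chart(1)[OF W(2) _ c(1), of q] inv_chart[OF c(1), of q] by simp
  qed (use W c in auto)
  have "nabla p v Y c = frechet_derivative (\<lambda>y. Y (chart_inv c y) c) (at (chart_map c p)) (v c)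
    + \<Gamma> c (chart_map c p) (v c) ((\<lambda>y. Y (chart_inv c y) c) (chart_map c p))"
    unfolding e
    by (rule nabla_chart_field[OF c(1) o _ _ vector_field_open_smooth[OF W(2,1) c(1)] v]) (use W c in auto)
  then show ?thesis using inv_chart[OF c] by simp
qed

lemma coordinate_field_const_derivative:
  assumes c: "c \<in> A" "p \<in> chart_dom c"
  shows "frechet_derivative (\<lambda>y. chart_tangent A c (chart_inv c y) b c) (at (chart_map c p)) v = 0"
proof -
  have "chart_tangent A c (chart_inv c y) b c = b" if "y \<in> cimage c" for y
    using chart_tangent_self[OF c(1) chart_inv_mem(1)[OF that]] .
  then have "frechet_derivative (\<lambda>y. chart_tangent A c (chart_inv c y) b c) (at (chart_map c p)) =
      frechet_derivative (\<lambda>y. b) (at (chart_map c p))"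
    using c by (intro frechet_derivative_cong_open[OF chart_open[OF c(1)]]) auto
  then show ?thesis by simp
qed

text \<open>Fields with constant components have vanishing bracket, so torsion-freeness says exactly
  this.\<close>

lemma christoffel_sym:
  assumes c: "c \<in> A" and y: "y \<in> cimage c"
  shows "\<Gamma> c y a b = \<Gamma> c y b a"
proof -
  obtain p where p: "p \<in> chart_dom c" "y = chart_map c p" using y by auto
  have "nabla p (chart_tangent A c p a) (\<lambda>q. chart_tangent A c q b) - nabla p (chart_tangent A c p b) (\<lambda>q. chart_tangent A c q a)
      = lie_bracket A (points A) (\<lambda>q. chart_tangent A c q a) (\<lambda>q. chart_tangent A c q b) p"
    by (rule nabla_torsion_free[OF openin_chart_dom[OF c] coordinate_field[OF c] coordinate_field[OF c] p(1)])
  moreover have "lie_bracket A (points A) (\<lambda>q. chart_tangent A c q a) (\<lambda>q. chart_tangent A c q b) p c = 0"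
    by (simp add: lie_bracket_chart[OF openin_chart_dom[OF c] p(1) coordinate_field[OF c] coordinate_field[OF c] c p(1)]
       coordinate_field_const_derivative[OF c p(1)])
  ultimately have "(nabla p (chart_tangent A c p a) (\<lambda>q. chart_tangent A c q b) -
     nabla p (chart_tangent A c p b) (\<lambda>q. chart_tangent A c q a)) c = 0" by simp
  then show ?thesis by (simp add: p(2) christoffel_eq[OF c p(1)])
qed

text \<open>Compatibility of the connection, tested on coordinate fields. From here on derivatives
  of metric coefficients can be traded for Christoffel symbols, so that no first derivatives of the
  metric survive in later identities.\<close>

lemma metric_compatible:
  assumes c: "c \<in> A" and y: "y \<in> cimage c"
  shows "bilin_deriv (gc c) y v a b = gc c y (\<Gamma> c y v a) b + gc c y a (\<Gamma> c y v b)"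
proof -
  obtain p where p: "p \<in> chart_dom c" "y = chart_map c p" using y by auto
  note T = chart_tangent_full[OF c p(1)] and o = openin_chart_dom[OF c]
  have "dir_deriv A (points A) p (chart_tangent A c p v) (\<lambda>q. g q (chart_tangent A c q a) (chart_tangent A c q b)) =
      g p (nabla p (chart_tangent A c p v) (\<lambda>q. chart_tangent A c q a)) (chart_tangent A c p b) +
      g p (chart_tangent A c p a) (nabla p (chart_tangent A c p v) (\<lambda>q. chart_tangent A c q b))"
    by (rule nabla_metric[OF o coordinate_field[OF c] coordinate_field[OF c] coordinate_field[OF c] p(1)])
  also have "\<dots> = gc c y (\<Gamma> c y v a) b + gc c y a (\<Gamma> c y v b)"
    using metric_chart[OF c p(1)] nabla_in_tangent[OF o coordinate_field[OF c] p(1) T] T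
    by (simp add: p(2) christoffel_eq[OF c p(1)] chart_tangent_self[OF c p(1)])
  also have "dir_deriv A (points A) p (chart_tangent A c p v) (\<lambda>q. g q (chart_tangent A c q a) (chart_tangent A c q b)) =
      frechet_derivative (\<lambda>y. gc c y a b) (at (chart_map c p)) (chart_tangent A c p v c)"
    by (rule dir_deriv_chart_compose[OF c p(1) T chart_open[OF c]])
      (use p(1) bilin_field_metric[OF c] metric_coeff_eq[OF c] in \<open>auto simp: bilin_field_def\<close>)
  finally show ?thesis by (simp add: bilin_deriv_def p(2) chart_tangent_self[OF c p(1)])
qed

section \<open>Curvature in a chart\<close>

lemma curvature_antisym: "Rc c y a b z = - Rc c y b a z"
  by (simp add: curvature_of_def)

text \<open>Symmetry of the Christoffel symbols passes to their derivatives, and the cyclic sum then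
  cancels in pairs.\<close>

lemma curvature_bianchi:
  assumes c: "c \<in> A" and y: "y \<in> cimage c"
  shows "Rc c y a b z + Rc c y b z a + Rc c y z a b = 0"
proof -
  have d: "bilin_deriv (\<Gamma> c) y v a b = bilin_deriv (\<Gamma> c) y v b a" for v a b
    by (rule bilin_deriv_cong[OF chart_open[OF c] y]) (rule christoffel_sym[OF c])
  show ?thesis
    by (simp add: curvature_of_def d[of a z b] d[of b a z] d[of z b a] christoffel_sym[OF c y, of z b]
        christoffel_sym[OF c y, of a z] christoffel_sym[OF c y, of b a])
qed

text \<open>Differentiate the function \<open>g(z,z)\<close> twice, for a constant coordinate vector
  \<open>z\<close>. By metric compatibility the commutator of its second derivatives in the
  directions \<open>a\<close> and \<open>b\<close> is twice \<open>g(R(a,b)z, z)\<close>, and it is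
  zero by symmetry of second derivatives.\<close>

lemma curvature_skew:
  assumes c: "c \<in> A" and y: "y \<in> cimage c"
  shows "gc c y (Rc c y a b z) z = 0"
proof -
  note o = chart_open[OF c] and G = bilin_field_metric[OF c] and H = bilin_field_christoffel[OF c]
  let ?f = "\<lambda>y. gc c y z z"
  have f: "smooth_on (cimage c) ?f" using G by (simp add: bilin_field_def)
  have 1: "frechet_derivative ?f (at x) w = 2 * gc c x (\<Gamma> c x w z) z" if "x \<in> cimage c" for x w
    using metric_compatible[OF c that, of w z z] metric_coeff_sym[OF c that] by (simp add: bilin_deriv_def)
  have 2: "frechet_derivative (\<lambda>y. frechet_derivative ?f (at y) w) (at y) v =
      2 * (gc c y (\<Gamma> c y v (\<Gamma> c y w z)) z + gc c y (\<Gamma> c y w z) (\<Gamma> c y v z) + gc c y (bilin_deriv (\<Gamma> c) y v w z) z)" for v w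
  proof -
    have "((\<lambda>y. 2 * gc c y (\<Gamma> c y w z) z) has_derivative
       (\<lambda>v. 2 * (bilin_deriv (gc c) y v (\<Gamma> c y w z) z + gc c y (bilin_deriv (\<Gamma> c) y v w z) z + gc c y (\<Gamma> c y w z) 0))) (at y)"
      by (intro has_derivative_mult_right bilin_field_has_derivative[OF G y has_derivative_ident _ has_derivative_const]
         bilin_field_has_derivative_const[OF H y])
    then have "((\<lambda>y. frechet_derivative ?f (at y) w) has_derivative
       (\<lambda>v. 2 * (bilin_deriv (gc c) y v (\<Gamma> c y w z) z + gc c y (bilin_deriv (\<Gamma> c) y v w z) z + gc c y (\<Gamma> c y w z) 0))) (at y)"
      by (rule has_derivative_transform_within_open[OF _ o y]) (simp add: 1)
    from fun_cong[OF frechet_derivative_eq[OF this], of v] show ?thesis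
      by (simp add: metric_compatible[OF c y] bilin_field_add_scale[OF G y])
  qed
  have "frechet_derivative (\<lambda>y. frechet_derivative ?f (at y) b) (at y) a =
      frechet_derivative (\<lambda>y. frechet_derivative ?f (at y) a) (at y) b"
    by (rule second_derivative_symmetric_real[OF o y f])
  then have "gc c y (\<Gamma> c y a (\<Gamma> c y b z)) z + gc c y (bilin_deriv (\<Gamma> c) y a b z) z =
     gc c y (\<Gamma> c y b (\<Gamma> c y a z)) z + gc c y (bilin_deriv (\<Gamma> c) y b a z) z"
    unfolding 2 using metric_coeff_sym[OF c y, of "\<Gamma> c y a z" "\<Gamma> c y b z"] by simp
  then show ?thesis unfolding curvature_of_def by (simp add: bilin_field_add_scale[OF G y])
qed

text \<open>The bracket is defined chart by chart, so its tangency is not immediate.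
  Torsion-freeness exhibits it as a difference of two covariant derivatives, which are tangent
  vectors.\<close>

lemma lie_bracket_in_tangent:
  assumes W: "openin (atlas_topology A) W" "p \<in> W" and X: "vector_field A W X" and Y: "vector_field A W Y"
  shows "lie_bracket A (points A) X Y p \<in> full_tangent_space A p"
proof -
  have P: "p \<in> points A" using W openin_subset_points by blast
  have "nabla p (X p) Y - nabla p (Y p) X = lie_bracket A (points A) X Y p"
    by (rule nabla_torsion_free[OF W(1) X Y W(2)])
  moreover have "X p \<in> full_tangent_space A p" "Y p \<in> full_tangent_space A p"
    using X Y W(2) tangent_space_points unfolding vector_field_def by blast+
  ultimately show ?thesis
    using nabla_in_tangent[OF W(1) _ W(2)] X Y subspace_diff[OF full_tangent_subspace[OF P]] by metis
qed

text \<open>This is tensoriality of the curvature: second derivatives of \<open>Z\<close> cancel by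
  symmetry, and first derivatives of \<open>X\<close> and \<open>Y\<close> cancel against the
  bracket term, leaving only the values of the three fields at \<open>p\<close>.\<close>

lemma curvature_chart:
  assumes W: "openin (atlas_topology A) W" "p \<in> W" and X: "vector_field A W X" and Y: "vector_field A W Y"
    and Z: "vector_field A W Z" and c: "c \<in> A" "p \<in> chart_dom c"
  shows "curvature A nabla X Y Z p c = Rc c (chart_map c p) (X p c) (Y p c) (Z p c)"
proof -
  let ?V = "chart_map c ` (W \<inter> chart_dom c)" and ?y = "chart_map c p"
  note H = bilin_field_christoffel[OF c(1)]
  have V: "open ?V" "?y \<in> ?V" using openin_chart_image[OF W(1) c(1)] W c by auto
  have y: "?y \<in> cimage c" using c by auto
  define fX fY fZ where "fX = (\<lambda>y. X (chart_inv c y) c)" "fY = (\<lambda>y. Y (chart_inv c y) c)" "fZ = (\<lambda>y. Z (chart_inv c y) c)"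
  have s: "smooth_on ?V fX" "smooth_on ?V fY" "smooth_on ?V fZ"
    unfolding fX_fY_fZ_def using vector_field_open_smooth[OF _ W(1) c(1)] X Y Z by auto
  have at: "fX ?y = X p c" "fY ?y = Y p c" "fZ ?y = Z p c" unfolding fX_fY_fZ_def by (simp_all add: inv_chart c)
  have P: "p \<in> points A" using in_pointsI[OF c] .
  \<comment> \<open>Stated for generic fields \<open>U\<close> and \<open>U'\<close>, since both
    orders of \<open>X\<close> and \<open>Y\<close> are needed.\<close>
  have *: "nabla p (U p) (\<lambda>q. nabla q (U' q) Z) c =
      frechet_derivative (\<lambda>y. frechet_derivative fZ (at y) (fU' ?y)) (at ?y) (U p c)
      + frechet_derivative fZ (at ?y) (frechet_derivative fU' (at ?y) (U p c))
      + (bilin_deriv (\<Gamma> c) ?y (U p c) (U' p c) (Z p c) + \<Gamma> c ?y (frechet_derivative fU' (at ?y) (U p c)) (Z p c)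
         + \<Gamma> c ?y (U' p c) (frechet_derivative fZ (at ?y) (U p c)))
      + \<Gamma> c ?y (U p c) (frechet_derivative fZ (at ?y) (U' p c) + \<Gamma> c ?y (U' p c) (Z p c))"
    if U: "vector_field A W U" and U': "vector_field A W U'" and fU': "fU' = (\<lambda>y. U' (chart_inv c y) c)" for U U' fU'
  proof -
    let ?N = "\<lambda>q. nabla q (U' q) Z"
    have atU: "fU' ?y = U' p c" unfolding fU' by (simp add: inv_chart c)
    have N: "?N q c = frechet_derivative fZ (at (chart_map c q)) (fU' (chart_map c q))
        + \<Gamma> c (chart_map c q) (fU' (chart_map c q)) (fZ (chart_map c q))" if q: "q \<in> W \<inter> chart_dom c" for q
      unfolding fX_fY_fZ_def fU'
      using nabla_chart[OF W(1) Z _ vector_field_chart(2)[OF U' _ c(1)] c(1), of q] q by (simp add: inv_chart c)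
    have s': "smooth_on ?V fU'" unfolding fU' using vector_field_open_smooth[OF U' W(1) c(1)] .
    have "((\<lambda>y. frechet_derivative fZ (at y) (fU' y) + \<Gamma> c y (fU' y) (fZ y)) has_derivative
       (\<lambda>v. (frechet_derivative (\<lambda>y. frechet_derivative fZ (at y) (fU' ?y)) (at ?y) v
            + frechet_derivative fZ (at ?y) (frechet_derivative fU' (at ?y) v))
         + (bilin_deriv (\<Gamma> c) ?y v (fU' ?y) (fZ ?y) + \<Gamma> c ?y (frechet_derivative fU' (at ?y) v) (fZ ?y)
           + \<Gamma> c ?y (fU' ?y) (frechet_derivative fZ (at ?y) v)))) (at ?y)"
      by (intro has_derivative_add frechet_apply_has_derivative[OF V s(3)]
          bilin_field_has_derivative[OF H y has_derivative_ident] smooth_on_has_derivative[OF s' V(2)]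
          smooth_on_has_derivative[OF s(3) V(2)])
    then have "((\<lambda>y. ?N (chart_inv c y) c) has_derivative
       (\<lambda>v. (frechet_derivative (\<lambda>y. frechet_derivative fZ (at y) (fU' ?y)) (at ?y) v
            + frechet_derivative fZ (at ?y) (frechet_derivative fU' (at ?y) v))
         + (bilin_deriv (\<Gamma> c) ?y v (fU' ?y) (fZ ?y) + \<Gamma> c ?y (frechet_derivative fU' (at ?y) v) (fZ ?y)
           + \<Gamma> c ?y (fU' ?y) (frechet_derivative fZ (at ?y) v)))) (at ?y)"
    proof (rule has_derivative_transform_within_open[OF _ V])
      fix y assume "y \<in> ?V"
      then obtain q where "q \<in> W \<inter> chart_dom c" "y = chart_map c q" by auto
      then show "frechet_derivative fZ (at y) (fU' y) + \<Gamma> c y (fU' y) (fZ y) = ?N (chart_inv c y) c"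
        using N[of q] inv_chart[OF c(1), of q] by simp
    qed
    from fun_cong[OF frechet_derivative_eq[OF this], of "U p c"]
    show ?thesis
      using nabla_chart[OF W(1) nabla_vector_field[OF W(1) U' Z] W(2) vector_field_chart(2)[OF U W(2) c] c]
        N[of p] W(2) c by (simp add: atU at)
  qed
  have sym: "frechet_derivative (\<lambda>y. frechet_derivative fZ (at y) (fY ?y)) (at ?y) (X p c) =
      frechet_derivative (\<lambda>y. frechet_derivative fZ (at y) (fX ?y)) (at ?y) (Y p c)"
    using second_derivative_symmetric[OF V s(3)] by (simp add: at)
  have br: "nabla p (lie_bracket A (points A) X Y p) Z c =
     frechet_derivative fZ (at ?y) (frechet_derivative fY (at ?y) (X p c) - frechet_derivative fX (at ?y) (Y p c))
     + \<Gamma> c ?y (frechet_derivative fY (at ?y) (X p c) - frechet_derivative fX (at ?y) (Y p c)) (Z p c)"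
    using nabla_chart[OF W(1) Z W(2) lie_bracket_in_tangent[OF W X Y] c]
      lie_bracket_chart[OF W X Y c] by (simp add: fX_fY_fZ_def)
  note lin = linear_diff[OF has_derivative_linear[OF smooth_on_has_derivative[OF s(3) V(2)]]]
  show ?thesis
    unfolding curvature_def fun_diff_def
    by (simp add: *[OF X Y, of fY] *[OF Y X, of fX] br sym lin bilin_field_add_scale[OF H y] curvature_of_def fX_fY_fZ_def(1,2)[symmetric])
qed

lemma curvature_in_tangent:
  assumes W: "openin (atlas_topology A) W" "p \<in> W" and X: "vector_field A W X" and Y: "vector_field A W Y"
    and Z: "vector_field A W Z"
  shows "curvature A nabla X Y Z p \<in> full_tangent_space A p"
proof -
  have P: "p \<in> points A" using W openin_subset_points by blast
  have T: "X p \<in> full_tangent_space A p" "Y p \<in> full_tangent_space A p"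
    using X Y W(2) tangent_space_points unfolding vector_field_def by blast+
  show ?thesis unfolding curvature_def
    by (intro subspace_diff[OF full_tangent_subspace[OF P]] nabla_in_tangent[OF W(1) _ W(2)]
        nabla_vector_field[OF W(1)] lie_bracket_in_tangent[OF W] X Y Z T)
qed

text \<open>By tensoriality, quantifying over fields is the same as quantifying over coordinate
  vectors; coordinate fields extend any given vector. In the converse direction both sides are
  tangent vectors, so comparing them in one chart suffices.\<close>

lemma constant_curvature_chart:
  "constant_sectional_curvature A g nabla \<kappa> \<longleftrightarrow>
    (\<forall>c\<in>A. \<forall>y\<in>cimage c. \<forall>a b z. Rc c y a b z = \<kappa> *\<^sub>R (gc c y b z *\<^sub>R a - gc c y a z *\<^sub>R b))"
proof
  assume C: "constant_sectional_curvature A g nabla \<kappa>"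
  show "\<forall>c\<in>A. \<forall>y\<in>cimage c. \<forall>a b z. Rc c y a b z = \<kappa> *\<^sub>R (gc c y b z *\<^sub>R a - gc c y a z *\<^sub>R b)"
  proof (intro ballI allI)
    fix c y a b z assume c: "c \<in> A" and "y \<in> cimage c"
    then obtain p where p: "p \<in> chart_dom c" "y = chart_map c p" by auto
    note E = coordinate_field[OF c] and o = openin_chart_dom[OF c]
    have "curvature A nabla (\<lambda>q. chart_tangent A c q a) (\<lambda>q. chart_tangent A c q b) (\<lambda>q. chart_tangent A c q z) p =
       \<kappa> *\<^sub>R (g p (chart_tangent A c p b) (chart_tangent A c p z) *\<^sub>R chart_tangent A c p a
         - g p (chart_tangent A c p a) (chart_tangent A c p z) *\<^sub>R chart_tangent A c p b)"
      using C o E p(1) unfolding constant_sectional_curvature_def by blast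
    then have "curvature A nabla (\<lambda>q. chart_tangent A c q a) (\<lambda>q. chart_tangent A c q b) (\<lambda>q. chart_tangent A c q z) p c =
       (\<kappa> *\<^sub>R (g p (chart_tangent A c p b) (chart_tangent A c p z) *\<^sub>R chart_tangent A c p a
         - g p (chart_tangent A c p a) (chart_tangent A c p z) *\<^sub>R chart_tangent A c p b)) c" by simp
    then show "Rc c y a b z = \<kappa> *\<^sub>R (gc c y b z *\<^sub>R a - gc c y a z *\<^sub>R b)"
      unfolding curvature_chart[OF o p(1) E E E c p(1)]
      by (simp add: p(2) chart_tangent_self[OF c p(1)] metric_coeff_eq[OF c p(1)])
  qed
next
  assume R: "\<forall>c\<in>A. \<forall>y\<in>cimage c. \<forall>a b z. Rc c y a b z = \<kappa> *\<^sub>R (gc c y b z *\<^sub>R a - gc c y a z *\<^sub>R b)"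
  show "constant_sectional_curvature A g nabla \<kappa>"
    unfolding constant_sectional_curvature_def
  proof (intro allI impI ballI)
    fix W X Y Z p
    assume W: "openin (atlas_topology A) W" and X: "vector_field A W X" and Y: "vector_field A W Y"
      and Z: "vector_field A W Z" and p: "p \<in> W"
    obtain c where c: "c \<in> A" "p \<in> chart_dom c"
      using openin_subset_points[OF W] p unfolding points_def by blast
    have P: "p \<in> points A" using in_pointsI[OF c] .
    have T: "X p \<in> full_tangent_space A p" "Y p \<in> full_tangent_space A p" "Z p \<in> full_tangent_space A p"
      using vector_field_chart(2)[OF _ p c] X Y Z by auto
    show "curvature A nabla X Y Z p = \<kappa> *\<^sub>R (g p (Y p) (Z p) *\<^sub>R X p - g p (X p) (Z p) *\<^sub>R Y p)"
    proof (rule tangent_eqI[OF curvature_in_tangent[OF W p X Y Z] _ c])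
      show "\<kappa> *\<^sub>R (g p (Y p) (Z p) *\<^sub>R X p - g p (X p) (Z p) *\<^sub>R Y p) \<in> full_tangent_space A p"
        by (intro subspace_scale subspace_diff full_tangent_subspace[OF P] T)
      show "curvature A nabla X Y Z p c = (\<kappa> *\<^sub>R (g p (Y p) (Z p) *\<^sub>R X p - g p (X p) (Z p) *\<^sub>R Y p)) c"
        unfolding curvature_chart[OF W p X Y Z c] using R c T
        by (simp add: metric_chart[OF c])
    qed
  qed
qed

end

section \<open>The tangent bundle in a chart\<close>

context smooth_atlas
begin

lemma bundle_dom_iff:
  assumes "c \<in> A"
  shows "p \<in> chart_dom (bundle_chart A c) \<longleftrightarrow> fst p \<in> chart_dom c \<and> snd p \<in> full_tangent_space A (fst p)"
  using in_pointsI[OF assms] by (cases p) (auto simp: bundle_chart_def tangent_bundle_def)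

lemma bundle_map: "chart_map (bundle_chart A c) p = (chart_map c (fst p), snd p c)"
  by (simp add: bundle_chart_def case_prod_beta)

lemma bundle_chart_in: "c \<in> A \<Longrightarrow> bundle_chart A c \<in> bundle_atlas A"
  by (simp add: bundle_atlas_def)

lemma bundle_chart_cases:
  assumes "C \<in> bundle_atlas A"
  obtains c where "c \<in> A" "C = bundle_chart A c"
  using assms unfolding bundle_atlas_def by blast

lemma bundle_inj:
  assumes c: "c \<in> A"
  shows "inj_on (chart_map (bundle_chart A c)) (chart_dom (bundle_chart A c))"
proof (rule inj_onI)
  fix p q assume p: "p \<in> chart_dom (bundle_chart A c)" and q: "q \<in> chart_dom (bundle_chart A c)"
    and e: "chart_map (bundle_chart A c) p = chart_map (bundle_chart A c) q"
  note p' = p[unfolded bundle_dom_iff[OF c]] and q' = q[unfolded bundle_dom_iff[OF c]]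
  have f: "fst p = fst q" using e p' q' inj_onD[OF chart_inj[OF c], of "fst p" "fst q"] by (simp add: bundle_map)
  moreover have "snd p = snd q"
    by (rule tangent_eqI[OF conjunct2[OF p'], of _ "points A", OF _ c]) (use p' q' e f in \<open>simp_all add: bundle_map\<close>)
  ultimately show "p = q" by (simp add: prod_eq_iff)
qed

lemma bundle_image:
  assumes c: "c \<in> A" and T: "T \<subseteq> chart_dom c"
  shows "chart_map (bundle_chart A c) ` {p. fst p \<in> T \<and> snd p \<in> full_tangent_space A (fst p)} = (chart_map c ` T) \<times> (UNIV :: 'e set)"
proof (intro subset_antisym subsetI)
  fix z assume "z \<in> (chart_map c ` T) \<times> (UNIV :: 'e set)"
  then obtain x a where x: "x \<in> T" "z = (chart_map c x, a)" by auto
  then have "z = chart_map (bundle_chart A c) (x, chart_tangent A c x a)"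
    using T by (simp add: bundle_map chart_tangent_self[OF c] subsetD)
  moreover have "chart_tangent A c x a \<in> full_tangent_space A x"
    using chart_tangent_full[OF c] x(1) T by blast
  ultimately show "z \<in> chart_map (bundle_chart A c) ` {p. fst p \<in> T \<and> snd p \<in> full_tangent_space A (fst p)}"
    using x(1) by (intro image_eqI[of _ _ "(x, chart_tangent A c x a)"]) auto
qed (auto simp: bundle_map)

lemma bundle_chart_image:
  assumes c: "c \<in> A"
  shows "chart_map (bundle_chart A c) ` chart_dom (bundle_chart A c) = (chart_map c ` chart_dom c) \<times> UNIV"
proof -
  have "chart_dom (bundle_chart A c) = {p. fst p \<in> chart_dom c \<and> snd p \<in> full_tangent_space A (fst p)}"
    using bundle_dom_iff[OF c] by blast
  then show ?thesis using bundle_image[OF c subset_refl] by simp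
qed

lemma bundle_overlap_image:
  assumes c: "c \<in> A" and d: "d \<in> A"
  shows "chart_map (bundle_chart A c) ` (chart_dom (bundle_chart A c) \<inter> chart_dom (bundle_chart A d)) =
    (chart_map c ` (chart_dom c \<inter> chart_dom d)) \<times> UNIV"
proof -
  have "chart_dom (bundle_chart A c) \<inter> chart_dom (bundle_chart A d) =
      {p. fst p \<in> chart_dom c \<inter> chart_dom d \<and> snd p \<in> full_tangent_space A (fst p)}"
    using bundle_dom_iff[OF c] bundle_dom_iff[OF d] by blast
  then show ?thesis using bundle_image[OF c Int_lower1] by simp
qed

lemma bundle_inv:
  assumes c: "c \<in> A" and y: "y \<in> chart_map c ` chart_dom c"
  shows "chart_inv (bundle_chart A c) (y, a) = (chart_inv c y, chart_tangent A c (chart_inv c y) a)"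
proof (rule inv_into_f_eq[OF bundle_inj[OF c]])
  note m = chart_inv_mem[OF y]
  show "(chart_inv c y, chart_tangent A c (chart_inv c y) a) \<in> chart_dom (bundle_chart A c)"
    by (simp add: bundle_dom_iff[OF c] m chart_tangent_full[OF c m(1)])
  show "chart_map (bundle_chart A c) (chart_inv c y, chart_tangent A c (chart_inv c y) a) = (y, a)"
    by (simp add: bundle_map m chart_tangent_self[OF c m(1)])
qed

text \<open>In coordinates a change of bundle charts is the base transition map paired with its
  derivative, applied to the fibre coordinate.\<close>

lemma bundle_transition_smooth:
  assumes c: "c \<in> A" and d: "d \<in> A"
  shows "smooth_on (chart_map (bundle_chart A c) ` (chart_dom (bundle_chart A c) \<inter> chart_dom (bundle_chart A d)))
    (chart_map (bundle_chart A d) \<circ> chart_inv (bundle_chart A c))"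
proof -
  let ?T = "chart_map c ` (chart_dom c \<inter> chart_dom d)" and ?\<tau> = "chart_map d \<circ> chart_inv c"
  have o: "open (?T \<times> (UNIV :: 'e set))" using overlap_open[OF c d] by (intro open_Times) auto
  note sf = smooth_on_fst[OF o smooth_on_id[OF o]] smooth_on_snd[OF o smooth_on_id[OF o]]
  have "smooth_on (?T \<times> UNIV) (\<lambda>z. (?\<tau> (fst z), frechet_derivative ?\<tau> (at (fst z)) (snd z)))"
    by (intro smooth_on_Pair[OF o] smooth_on_compose[OF o overlap_open[OF c d] _ sf(1) transition_smooth[OF c d]]
        smooth_on_frechet_apply[OF overlap_open[OF c d] o _ transition_smooth[OF c d] sf]) auto
  then have "smooth_on (?T \<times> UNIV) (chart_map (bundle_chart A d) \<circ> chart_inv (bundle_chart A c))"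
  proof (rule smooth_on_cong[OF o])
    fix z assume "z \<in> ?T \<times> (UNIV :: 'e set)"
    then obtain x a where x: "x \<in> chart_dom c" "x \<in> chart_dom d" "z = (chart_map c x, a)" by auto
    have y: "chart_map c x \<in> chart_map c ` chart_dom c" using x(1) by blast
    show "(?\<tau> (fst z), frechet_derivative ?\<tau> (at (fst z)) (snd z)) =
        (chart_map (bundle_chart A d) \<circ> chart_inv (bundle_chart A c)) z"
      using x d by (simp add: bundle_inv[OF c y] bundle_map inv_chart[OF c x(1)] chart_tangent_def)
  qed
  then show ?thesis by (simp add: bundle_overlap_image[OF c d])
qed

lemma bundle_smooth_atlas: "smooth_atlas (bundle_atlas A)"
proof
  fix C assume "C \<in> bundle_atlas A"
  then obtain c where c: "c \<in> A" "C = bundle_chart A c" by (rule bundle_chart_cases)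
  show "inj_on (chart_map C) (chart_dom C)" using bundle_inj c by simp
  show "open (chart_map C ` chart_dom C)"
    using chart_open[OF c(1)] by (simp add: c(2) bundle_chart_image[OF c(1)] open_Times)
  fix D assume "D \<in> bundle_atlas A"
  then obtain d where d: "d \<in> A" "D = bundle_chart A d" by (rule bundle_chart_cases)
  show "open (chart_map C ` (chart_dom C \<inter> chart_dom D))"
    using overlap_open[OF c(1) d(1)] by (simp add: c(2) d(2) bundle_overlap_image[OF c(1) d(1)] open_Times)
  show "smooth_on (chart_map C ` (chart_dom C \<inter> chart_dom D)) (chart_map D \<circ> chart_inv C)"
    using bundle_transition_smooth[OF c(1) d(1)] c d by simp
qed

text \<open>The terms with second derivatives of the transition map cancel by symmetry, so the bracket,
  which is defined chart by chart, transforms like a tangent vector.\<close>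

lemma lie_bracket_eq_chart_tangent:
  assumes p: "X p \<in> tangent_space A S p" "Y p \<in> tangent_space A S p" and c: "c \<in> A" "p \<in> chart_dom c"
    and V: "open V" "chart_map c p \<in> V" and F: "smooth_on V FX" "smooth_on V FY"
    and XY: "\<And>q. q \<in> S \<inter> chart_dom c \<Longrightarrow> chart_map c q \<in> V \<Longrightarrow>
      X q = chart_tangent A c q (FX (chart_map c q)) \<and> Y q = chart_tangent A c q (FY (chart_map c q))"
  shows "lie_bracket A S X Y p = chart_tangent A c p
    (frechet_derivative FY (at (chart_map c p)) (FX (chart_map c p)) -
     frechet_derivative FX (at (chart_map c p)) (FY (chart_map c p)))"
proof
  fix d :: "('a, 'e) chart"
  let ?z = "chart_map c p"
  let ?\<tau> = "chart_map d \<circ> chart_inv c"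
  show "lie_bracket A S X Y p d = chart_tangent A c p
    (frechet_derivative FY (at ?z) (FX ?z) - frechet_derivative FX (at ?z) (FY ?z)) d"
  proof (cases "d \<in> A \<and> p \<in> chart_dom d")
    case True
    let ?T = "chart_map c ` (chart_dom c \<inter> chart_dom d)"
    have o: "open ?T" "?z \<in> ?T" and \<tau>: "smooth_on ?T ?\<tau>"
      using overlap_open[OF c(1)] transition_smooth[OF c(1)] c True by auto
    have oV: "open (V \<inter> ?T)" "?z \<in> V \<inter> ?T" using V o by auto
    have pS: "p \<in> S" using tangent_space_chart(1)[OF p(1) c] .
    have at: "X p c = FX ?z" "Y p c = FY ?z"
      using XY[of p] pS c V(2) chart_tangent_self[OF c] by auto
    \<comment> \<open>The component of \<open>Z\<close> in the chart \<open>d\<close> is the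
      transition derivative at a moving point applied to a moving vector. Its first summand below
      carries the second derivative that must cancel in the bracket.\<close>
    have D: "dir_deriv A S p v (\<lambda>q. Z q d) =
        frechet_derivative (\<lambda>y. frechet_derivative ?\<tau> (at y) (FZ ?z)) (at ?z) (v c)
          + frechet_derivative ?\<tau> (at ?z) (frechet_derivative FZ (at ?z) (v c))"
      if v: "v \<in> tangent_space A S p" and FZ: "smooth_on V FZ" and
        Z: "\<And>q. q \<in> S \<inter> chart_dom c \<Longrightarrow> chart_map c q \<in> V \<Longrightarrow> Z q = chart_tangent A c q (FZ (chart_map c q))" for v Z FZ
    proof (rule dir_deriv_eq[OF v c oV _ frechet_apply_has_derivative[OF o \<tau> smooth_on_has_derivative[OF FZ V(2)]]])
      fix q assume q: "q \<in> S \<inter> chart_dom c" "chart_map c q \<in> V \<inter> ?T"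
      then obtain q' where q': "q' \<in> chart_dom c" "q' \<in> chart_dom d" "chart_map c q = chart_map c q'" by auto
      have "q = q'" using inj_onD[OF chart_inj[OF c(1)] q'(3)] q(1) q'(1) by simp
      then have "q \<in> chart_dom d" using q' by simp
      then show "Z q d = frechet_derivative ?\<tau> (at (chart_map c q)) (FZ (chart_map c q))"
        using Z[OF q(1)] q(2) True by (simp add: chart_tangent_def)
    qed
    have "lie_bracket A S X Y p d =
       frechet_derivative ?\<tau> (at ?z) (frechet_derivative FY (at ?z) (FX ?z))
       - frechet_derivative ?\<tau> (at ?z) (frechet_derivative FX (at ?z) (FY ?z))"
      using True D[OF p(1) F(2), of Y] D[OF p(2) F(1), of X] XY
        second_derivative_symmetric[OF o \<tau>, of "FY ?z" "FX ?z"]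
      by (simp add: lie_bracket_def at)
    then show ?thesis
      using True linear_diff[OF has_derivative_linear[OF smooth_on_has_derivative[OF \<tau> o(2)]]]
      by (simp add: chart_tangent_def)
  qed (auto simp: lie_bracket_def chart_tangent_def)
qed

end

sublocale levi_civita_manifold \<subseteq> TM: smooth_atlas "bundle_atlas A"
  by (rule bundle_smooth_atlas)

context levi_civita_manifold
begin

section \<open>Lifts and the Sasaki metric in bundle coordinates\<close>

abbreviation bt where "bt c \<equiv> chart_tangent (bundle_atlas A) (bundle_chart A c)"

lemma vertical_lift_chart:
  assumes c: "c \<in> A" and p: "p \<in> chart_dom (bundle_chart A c)" and X: "X \<in> full_tangent_space A (fst p)"
  shows "vertical_lift A p X = bt c p (0, X c)"
proof -
  note p' = p[unfolded bundle_dom_iff[OF c]]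
  let ?\<gamma> = "\<lambda>t::real. (fst p, snd p + t *\<^sub>R X)"
  have d: "?\<gamma> t \<in> chart_dom (bundle_chart A c)" for t
    using p' X subspace_add[OF full_tangent_subspace] subspace_scale[OF full_tangent_subspace] in_pointsI[OF c, of "fst p"]
    by (simp add: bundle_dom_iff[OF c])
  have "((chart_map (bundle_chart A c) \<circ> ?\<gamma>) has_vector_derivative (0, X c)) (at 0)"
    unfolding o_def bundle_map by (auto intro!: derivative_eq_intros has_vector_derivative_Pair)
  from TM.velocity_eq[OF bundle_chart_in[OF c] d this] show ?thesis
    by (simp add: vertical_lift_def d)
qed

text \<open>The fibre component of the differential of a section is the ordinary derivative of its
  components; writing it as covariant derivative minus Christoffel term makes visible what being
  parallel at \<open>x\<close> means.\<close>

lemma section_pushforward: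
  assumes W: "openin (atlas_topology A) W" "vector_field A W Y" "x \<in> W"
    and v: "v \<in> full_tangent_space A x" and c: "c \<in> A" "x \<in> chart_dom c"
  shows "pushforward A (bundle_atlas A) (\<lambda>q. (q, Y q)) x v =
    bt c (x, Y x) (v c, nabla x v Y c - \<Gamma> c (chart_map c x) (v c) (Y x c))"
proof -
  let ?V = "chart_map c ` (W \<inter> chart_dom c)" and ?f = "\<lambda>y. Y (chart_inv c y) c"
  have V: "open ?V" "chart_map c x \<in> ?V" using openin_chart_image[OF W(1) c(1)] W c by auto
  have D: "((\<lambda>y. (y, ?f y)) has_derivative (\<lambda>h. (h, frechet_derivative ?f (at (chart_map c x)) h))) (at (chart_map c x))"
    by (intro has_derivative_Pair has_derivative_ident smooth_on_has_derivative[OF vector_field_open_smooth[OF W(2,1) c(1)] V(2)])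
  have Yx: "(x, Y x) \<in> chart_dom (bundle_chart A c)"
    using vector_field_chart(2)[OF W(2,3) c] c by (simp add: bundle_dom_iff)
  have "pushforward A (bundle_atlas A) (\<lambda>q. (q, Y q)) x v =
     bt c (x, Y x) (v c, frechet_derivative ?f (at (chart_map c x)) (v c))"
  proof (rule pushforward_eq[where F = "\<lambda>q. (q, Y q)", OF smooth_atlas_axioms TM.smooth_atlas_axioms v c bundle_chart_in[OF c(1)] Yx V _ D])
    fix q assume q: "q \<in> chart_dom c" "chart_map c q \<in> ?V"
    then obtain q' where "q' \<in> W" "q' \<in> chart_dom c" "chart_map c q = chart_map c q'" by auto
    then have "q \<in> W" using inj_onD[OF chart_inj[OF c(1)]] q(1) by metis
    then show "(q, Y q) \<in> chart_dom (bundle_chart A c) \<and>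
        chart_map (bundle_chart A c) (q, Y q) = (chart_map c q, ?f (chart_map c q))"
      using vector_field_chart(2)[OF W(2) _ c(1) q(1)] q(1) by (simp add: bundle_dom_iff c bundle_map inv_chart)
  qed
  then show ?thesis by (simp add: nabla_chart[OF W v c])
qed

lemma zero_tangentI: "v \<in> full_tangent_space A x \<Longrightarrow> c \<in> A \<Longrightarrow> x \<in> chart_dom c \<Longrightarrow> v c = 0 \<Longrightarrow> v = 0"
  using full_tangent_chart linear_0[OF chart_tangent_linear] by metis

lemma horizontal_space_chart:
  assumes c: "c \<in> A" and p: "p \<in> chart_dom (bundle_chart A c)"
  shows "horizontal_space A nabla p =
    range (\<lambda>a. bt c p (a, - \<Gamma> c (chart_map c (fst p)) a (snd p c)))"
proof (intro subset_antisym subsetI)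
  obtain x u where xu: "p = (x, u)" by (cases p)
  have x: "x \<in> chart_dom c" and u: "u \<in> full_tangent_space A x" using p by (auto simp: bundle_dom_iff[OF c] xu)
  {
    fix w assume "w \<in> horizontal_space A nabla p"
    then obtain Y v W where W: "openin (atlas_topology A) W" "x \<in> W" "vector_field A W Y" "Y x = u"
      "v \<in> full_tangent_space A x" "nabla x v Y = 0"
      "w = pushforward A (bundle_atlas A) (\<lambda>q. (q, Y q)) x v"
      unfolding horizontal_space_def xu by auto
    show "w \<in> range (\<lambda>a. bt c p (a, - \<Gamma> c (chart_map c (fst p)) a (snd p c)))"
      using section_pushforward[OF W(1,3,2,5) c x] W by (auto simp: xu)
  next
    fix w assume "w \<in> range (\<lambda>a. bt c p (a, - \<Gamma> c (chart_map c (fst p)) a (snd p c)))"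
    then obtain a where w: "w = bt c p (a, - \<Gamma> c (chart_map c x) a (u c))" by (auto simp: xu)
    let ?y = "chart_map c x"
    \<comment> \<open>A section through \<open>u\<close> that is parallel at \<open>x\<close> is
      needed. The affine function \<open>H\<close> has value \<open>u c\<close> and derivative
      \<open>L\<close> at the coordinates of \<open>x\<close>, and \<open>L\<close> is chosen to
      cancel the Christoffel term of the covariant derivative.\<close>
    define L where "L h = - \<Gamma> c ?y h (u c)" for h
    define H where "H y = (u c - L ?y) + L y" for y
    have "linear L" unfolding L_def using christoffel_linear_left[OF c x] by (simp add: linear_compose_neg)
    then have L: "bounded_linear L" by (simp add: linear_conv_bounded_linear)
    note o = openin_chart_dom[OF c]
    have sH: "smooth_on (cimage c) H"
      unfolding H_def by (intro smooth_on_add smooth_on_const chart_open c smooth_on_bounded_linear L)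
    have dH: "frechet_derivative H (at ?y) = L"
      by (rule frechet_derivative_eq)
        (auto simp: H_def[abs_def] intro!: derivative_eq_intros bounded_linear_imp_has_derivative L)
    define Y where "Y = (\<lambda>q. chart_tangent A c q (H (chart_map c q)))"
    have Y: "vector_field A (chart_dom c) Y"
      unfolding Y_def by (rule vector_field_chart_tangent[OF c o subset_refl sH])
    have Yx: "Y x = u" using full_tangent_chart[OF u c x] by (simp add: Y_def H_def)
    let ?v = "chart_tangent A c x a"
    note v = chart_tangent_full[OF c x, of a]
    have "nabla x ?v Y c = L a + \<Gamma> c ?y a (u c)"
      using nabla_chart_field[OF c o subset_refl x sH v] chart_tangent_self[OF c x]
      unfolding Y_def[symmetric] by (simp add: dH H_def)
    then have n: "nabla x ?v Y = 0"
      by (intro zero_tangentI[OF nabla_in_tangent[OF o Y x v] c x]) (simp add: L_def)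
    have "w = pushforward A (bundle_atlas A) (\<lambda>q. (q, Y q)) x ?v"
      using section_pushforward[OF o Y x v c x] by (simp add: n Yx w xu chart_tangent_self[OF c x])
    then show "w \<in> horizontal_space A nabla p"
      unfolding horizontal_space_def xu using o x Y Yx v n by auto
  }
qed

lemma pushforward_fst_chart:
  assumes c: "c \<in> A" and p: "p \<in> chart_dom (bundle_chart A c)"
  shows "pushforward (bundle_atlas A) A fst p (bt c p z) = chart_tangent A c (fst p) (fst z)"
proof -
  note p' = p[unfolded bundle_dom_iff[OF c]]
  have "pushforward (bundle_atlas A) A fst p (bt c p z) = chart_tangent A c (fst p) (fst (bt c p z (bundle_chart A c)))"
    by (rule pushforward_eq[OF TM.smooth_atlas_axioms smooth_atlas_axioms
          TM.chart_tangent_full[OF bundle_chart_in[OF c] p] bundle_chart_in[OF c] p c _ open_UNIV, of _ fst])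
      (use p' in \<open>auto simp: bundle_dom_iff[OF c] bundle_map intro: has_derivative_fst has_derivative_ident\<close>)
  then show ?thesis by (simp add: TM.chart_tangent_self[OF bundle_chart_in[OF c] p])
qed

text \<open>The projection fixes the base component, and horizontality then fixes the fibre
  component; this is the uniqueness required by the definite description.\<close>

lemma horizontal_lift_chart:
  assumes c: "c \<in> A" and p: "p \<in> chart_dom (bundle_chart A c)" and X: "X \<in> full_tangent_space A (fst p)"
  shows "horizontal_lift A nabla p X = bt c p (X c, - \<Gamma> c (chart_map c (fst p)) (X c) (snd p c))"
  unfolding horizontal_lift_def
proof (rule the_equality)
  note p' = p[unfolded bundle_dom_iff[OF c]]
  show "bt c p (X c, - \<Gamma> c (chart_map c (fst p)) (X c) (snd p c)) \<in> horizontal_space A nabla p \<and>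
      pushforward (bundle_atlas A) A fst p (bt c p (X c, - \<Gamma> c (chart_map c (fst p)) (X c) (snd p c))) = X"
    using p' X by (auto simp: horizontal_space_chart[OF c p] pushforward_fst_chart[OF c p] full_tangent_chart[OF X c])
  fix w assume w: "w \<in> horizontal_space A nabla p \<and> pushforward (bundle_atlas A) A fst p w = X"
  then obtain a where a: "w = bt c p (a, - \<Gamma> c (chart_map c (fst p)) a (snd p c))"
    by (auto simp: horizontal_space_chart[OF c p])
  then have "chart_tangent A c (fst p) a = X" using w by (simp add: pushforward_fst_chart[OF c p])
  then have "X c = a" using chart_tangent_self[OF c] p' by blast
  then show "w = bt c p (X c, - \<Gamma> c (chart_map c (fst p)) (X c) (snd p c))" using a by simp
qed

text \<open>The connection map, called \<open>K\<close> in the overview, at the point with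
  coordinates \<open>z\<close>. It vanishes on horizontal lifts and returns the coordinate vector of
  \<open>X\<close> on the vertical lift of \<open>X\<close>.\<close>

definition vpart :: "('a, 'e) chart \<Rightarrow> 'e \<times> 'e \<Rightarrow> 'e \<times> 'e \<Rightarrow> 'e"
  where "vpart c z w = snd w + \<Gamma> c (fst z) (fst w) (snd z)"

definition sasaki_coeff :: "('a, 'e) chart \<Rightarrow> 'e \<times> 'e \<Rightarrow> 'e \<times> 'e \<Rightarrow> 'e \<times> 'e \<Rightarrow> real"
  where "sasaki_coeff c z w w' = gc c (fst z) (fst w) (fst w') + gc c (fst z) (vpart c z w) (vpart c z w')"

lemma sasaki_chart:
  assumes c: "c \<in> A" and p: "p \<in> chart_dom (bundle_chart A c)"
  shows "sasaki_metric A g nabla p (bt c p w) (bt c p w') =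
    sasaki_coeff c (chart_map (bundle_chart A c) p) w w'"
proof -
  note p' = p[unfolded bundle_dom_iff[OF c]]
  obtain x u where xu: "p = (x, u)" by (cases p)
  have x: "x \<in> chart_dom c" and u: "u \<in> full_tangent_space A x" using p' by (auto simp: xu)
  let ?y = "chart_map c x"
  let ?z = "chart_map (bundle_chart A c) p"
  have z: "?z = (?y, u c)" by (simp add: xu bundle_map)
  note lin = TM.chart_tangent_add[OF bundle_chart_in[OF c] p, symmetric]
  have split: "horizontal_lift A nabla p X + vertical_lift A p Y = bt c p (X c, Y c - \<Gamma> c ?y (X c) (u c))"
    if "X \<in> full_tangent_space A x" "Y \<in> full_tangent_space A x" for X Y
    using that by (simp add: horizontal_lift_chart[OF c p[unfolded xu]] vertical_lift_chart[OF c p[unfolded xu]] xu lin[unfolded xu])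
  have inj: "bt c p a = bt c p b \<longleftrightarrow> a = b" for a b
    using TM.chart_tangent_self[OF bundle_chart_in[OF c] p] by metis
  \<comment> \<open>The base component of \<open>a\<close> forces \<open>X\<close>, and what remains
    of the fibre component forces \<open>Y\<close>. The equivalence gives existence and uniqueness
    of the decomposition at once.\<close>
  have dec: "bt c p a = horizontal_lift A nabla p X + vertical_lift A p Y \<longleftrightarrow> X c = fst a \<and> Y c = vpart c ?z a"
    if "X \<in> full_tangent_space A x" "Y \<in> full_tangent_space A x" for X Y a
    unfolding split[OF that] inj by (cases a) (auto simp: vpart_def z algebra_simps)
  let ?T = "\<lambda>a. chart_tangent A c x a"
  note T = chart_tangent_full[OF c x] and self = chart_tangent_self[OF c x]
  show ?thesis
    unfolding sasaki_metric_def
  proof (rule the_equality)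
    show "\<exists>X\<in>full_tangent_space A (fst p). \<exists>Y\<in>full_tangent_space A (fst p). \<exists>X'\<in>full_tangent_space A (fst p).
      \<exists>Y'\<in>full_tangent_space A (fst p). bt c p w = horizontal_lift A nabla p X + vertical_lift A p Y \<and>
       bt c p w' = horizontal_lift A nabla p X' + vertical_lift A p Y' \<and>
       sasaki_coeff c ?z w w' = g (fst p) X X' + g (fst p) Y Y'"
      by (rule bexI[of _ "?T (fst w)"], rule bexI[of _ "?T (vpart c ?z w)"], rule bexI[of _ "?T (fst w')"],
          rule bexI[of _ "?T (vpart c ?z w')"])
        (simp_all add: xu[symmetric] dec T self, simp_all add: xu T sasaki_coeff_def bundle_map metric_coeff_eq[OF c x])
    fix r
    assume "\<exists>X\<in>full_tangent_space A (fst p). \<exists>Y\<in>full_tangent_space A (fst p). \<exists>X'\<in>full_tangent_space A (fst p).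
      \<exists>Y'\<in>full_tangent_space A (fst p). bt c p w = horizontal_lift A nabla p X + vertical_lift A p Y \<and>
       bt c p w' = horizontal_lift A nabla p X' + vertical_lift A p Y' \<and>
       r = g (fst p) X X' + g (fst p) Y Y'"
    then obtain X Y X' Y' where XY: "X \<in> full_tangent_space A x" "Y \<in> full_tangent_space A x"
      "X' \<in> full_tangent_space A x" "Y' \<in> full_tangent_space A x"
      and e: "bt c p w = horizontal_lift A nabla p X + vertical_lift A p Y"
       "bt c p w' = horizontal_lift A nabla p X' + vertical_lift A p Y'"
       and r: "r = g x X X' + g x Y Y'" by (auto simp: xu)
    show "r = sasaki_coeff c ?z w w'"
      using dec[OF XY(1,2)] dec[OF XY(3,4)] e XY
      unfolding r sasaki_coeff_def by (simp add: metric_chart[OF c x] z)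
  qed
qed

end

section \<open>The unit tangent bundle in a chart\<close>

lemma Collect_open_affine:
  fixes y a :: "'e::real_normed_vector"
  assumes "open U"
  shows "open {t::real. y + t *\<^sub>R a \<in> U}"
proof -
  have "continuous_on UNIV (\<lambda>t::real. y + t *\<^sub>R a)" by (intro continuous_intros)
  from continuous_open_preimage[OF this open_UNIV assms] show ?thesis by (simp add: vimage_def)
qed

locale unit_tangent_bundle = levi_civita_manifold A g nabla
  for A :: "('a, 'e::euclidean_space) chart set" and g nabla +
  fixes \<epsilon> :: real
  assumes sign: "\<epsilon> \<in> {1, -1}"
begin

lemma sign_square: "\<epsilon> * \<epsilon> = 1" using sign by auto

abbreviation S where "S \<equiv> unit_bundle A g \<epsilon>"
abbreviation B where "B \<equiv> bundle_atlas A"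
abbreviation bc where "bc \<equiv> bundle_chart A"
abbreviation \<xi> where "\<xi> \<equiv> cm_xi (standard_structure A g nabla \<epsilon>)"
abbreviation G where "G \<equiv> cm_metric (standard_structure A g nabla \<epsilon>)"

lemma bundle_chart_fst: "c \<in> A \<Longrightarrow> p \<in> chart_dom (bc c) \<Longrightarrow> fst (chart_map (bc c) p) \<in> cimage c"
  by (simp add: bundle_dom_iff bundle_map)

lemma unit_bundle_iff:
  assumes c: "c \<in> A" and p: "p \<in> chart_dom (bc c)"
  shows "p \<in> S \<longleftrightarrow> gc c (fst (chart_map (bc c) p)) (snd (chart_map (bc c) p)) (snd (chart_map (bc c) p)) = \<epsilon>"
proof -
  note p' = p[unfolded bundle_dom_iff[OF c]]
  have "p \<in> S \<longleftrightarrow> g (fst p) (snd p) (snd p) = \<epsilon>"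
    using p' in_pointsI[OF c, of "fst p"] by (cases p) (simp add: unit_bundle_def tangent_bundle_def)
  then show ?thesis using metric_chart[OF c, of "fst p" "snd p" "snd p"] p' by (simp add: bundle_map)
qed

lemma unit_bundle_chart:
  assumes "p \<in> S"
  obtains c where "c \<in> A" "p \<in> chart_dom (bc c)"
proof -
  have "fst p \<in> points A" "snd p \<in> full_tangent_space A (fst p)"
    using assms by (auto simp: unit_bundle_def tangent_bundle_def)
  then obtain c where "c \<in> A" "fst p \<in> chart_dom c" unfolding points_def by blast
  then show thesis using that[of c] \<open>snd p \<in> _\<close> by (simp add: bundle_dom_iff)
qed

section \<open>Tangent spaces of the unit bundle\<close>

text \<open>Along a curve in \<open>S\<close> the function \<open>g u u\<close> is constant, so its
  derivative vanishes; metric compatibility identifies that derivative as twice the pairing of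
  \<open>u\<close> with the vertical part.\<close>

lemma tangent_unit_bundleD:
  assumes w: "w \<in> tangent_space B S p" and c: "c \<in> A" and p: "p \<in> chart_dom (bc c)"
  shows "gc c (fst (chart_map (bc c) p)) (snd (chart_map (bc c) p)) (vpart c (chart_map (bc c) p) (w (bc c))) = 0"
proof -
  obtain \<gamma> where \<gamma>: "curve_through B S p w \<gamma>" using w unfolding tangent_space_def by blast
  let ?z = "chart_map (bc c) p" and ?w = "w (bc c)"
  define f where "f q = gc c (fst (chart_map (bc c) q)) (snd (chart_map (bc c) q)) (snd (chart_map (bc c) q))" for q
  note y = bundle_chart_fst[OF c p] and bcA = bundle_chart_in[OF c]
  have "((\<lambda>z. gc c (fst z) (snd z) (snd z)) has_derivative
     (\<lambda>h. bilin_deriv (gc c) (fst ?z) (fst h) (snd ?z) (snd ?z) + gc c (fst ?z) (snd h) (snd ?z) + gc c (fst ?z) (snd ?z) (snd h))) (at ?z)"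
    by (intro bilin_field_has_derivative[where F = fst, OF bilin_field_metric[OF c] y] has_derivative_fst has_derivative_snd has_derivative_ident)
  then have "((f \<circ> \<gamma>) has_vector_derivative (bilin_deriv (gc c) (fst ?z) (fst ?w) (snd ?z) (snd ?z)
      + gc c (fst ?z) (snd ?w) (snd ?z) + gc c (fst ?z) (snd ?z) (snd ?w))) (at 0)"
    by (rule TM.curve_has_derivative[OF \<gamma> bcA p open_UNIV UNIV_I, rotated]) (simp add: f_def)
  moreover have "((f \<circ> \<gamma>) has_vector_derivative 0) (at 0)"
    by (rule TM.curve_has_derivative[OF \<gamma> bcA p open_UNIV UNIV_I _ has_derivative_const[of \<epsilon>]])
      (use unit_bundle_iff[OF c] in \<open>auto simp: f_def\<close>)
  ultimately have "bilin_deriv (gc c) (fst ?z) (fst ?w) (snd ?z) (snd ?z)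
      + gc c (fst ?z) (snd ?w) (snd ?z) + gc c (fst ?z) (snd ?z) (snd ?w) = 0"
    using vector_derivative_unique_at by blast
  then show ?thesis
    using metric_coeff_sym[OF c y, of _ "snd ?z"]
    by (simp add: metric_compatible[OF c y] vpart_def bilin_field_add_scale[OF bilin_field_metric[OF c] y])
qed

text \<open>A curve in the tangent bundle with the given velocity is rescaled fibrewise into the unit
  bundle; as \<open>g u u\<close> is stationary along it at time 0, this does not change the velocity.\<close>

lemma tangent_unit_bundleI:
  assumes pS: "p \<in> S" and c: "c \<in> A" and p: "p \<in> chart_dom (bc c)"
    and w: "gc c (fst (chart_map (bc c) p)) (snd (chart_map (bc c) p)) (vpart c (chart_map (bc c) p) w) = 0"
  shows "bt c p w \<in> tangent_space B S p"
proof -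
  obtain y u where z: "chart_map (bc c) p = (y, u)" by fastforce
  obtain a b where ab: "w = (a, b)" by (cases w)
  have y: "y \<in> cimage c" using bundle_chart_fst[OF c p] z by simp
  have uu: "gc c y u u = \<epsilon>" using unit_bundle_iff[OF c p] pS z by simp
  have w0: "gc c y u (b + \<Gamma> c y a u) = 0" using w by (simp add: vpart_def z ab)
  note Gf = bilin_field_metric[OF c] and bcA = bundle_chart_in[OF c]
  note bl = bilin_field_add_scale[OF Gf]
  \<comment> \<open>The factor \<epsilon> gives \<open>\<phi> 0 = 1\<close> for either sign, so
    \<phi> is positive near 0 and its real powers are smooth there.\<close>
  define \<phi> where "\<phi> t = \<epsilon> * gc c (y + t *\<^sub>R a) (u + t *\<^sub>R b) (u + t *\<^sub>R b)" for t
  define J0 where "J0 = {t. y + t *\<^sub>R a \<in> cimage c}"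
  have J0: "open J0" unfolding J0_def by (rule Collect_open_affine[OF chart_open[OF c]])
  have lin: "smooth_on J0 (\<lambda>t. x + t *\<^sub>R x')" for x x' :: 'e
    by (intro smooth_on_add smooth_on_const smooth_on_bounded_linear bounded_linear_scaleR_left J0)
  have s\<phi>: "smooth_on J0 \<phi>"
    unfolding \<phi>_def by (intro smooth_on_mult[OF J0] smooth_on_const J0 bilin_field_smooth[OF Gf J0] lin)
      (auto simp: J0_def)
  define J where "J = J0 \<inter> \<phi> -` {0<..}"
  have J: "open J" unfolding J_def by (rule continuous_open_preimage[OF smooth_on_continuous[OF s\<phi>] J0]) simp
  have \<phi>0: "\<phi> 0 = 1" by (simp add: \<phi>_def uu sign_square)
  have J_0: "0 \<in> J" using y \<phi>0 by (simp add: J_def J0_def)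
  obtain e where e: "e > 0" "ball 0 e \<subseteq> J" using openE[OF J J_0] by blast
  have I: "{-e<..<e} \<subseteq> J" using e(2) by (auto simp: dist_real_def subset_iff)
  \<comment> \<open>The exponent is chosen so that \<open>s t * s t * \<phi> t = 1\<close>. Because
    \<phi> is stationary at 0, so is \<open>s\<close>, and rescaling by \<open>s\<close> leaves the
    velocity unchanged.\<close>
  define s where "s t = \<phi> t powr (-1/2)" for t
  have s0: "s 0 = 1" by (simp add: s_def \<phi>0)
  define \<psi> where "\<psi> t = (y + t *\<^sub>R a, s t *\<^sub>R (u + t *\<^sub>R b))" for t
  have ss: "smooth_on J s"
    unfolding s_def by (rule smooth_on_compose[OF J _ _ smooth_on_subset[OF s\<phi>] smooth_on_powr]) (auto simp: J_def)
  have linJ: "smooth_on J (\<lambda>t. x + t *\<^sub>R x')" for x x' :: 'e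
    by (rule smooth_on_subset[OF lin]) (simp add: J_def)
  have s\<psi>: "smooth_on J \<psi>"
    unfolding \<psi>_def by (intro smooth_on_Pair J linJ smooth_on_scaleR ss)
  define \<gamma> where "\<gamma> t = chart_inv (bc c) (\<psi> t)" for t
  have m: "\<psi> t \<in> chart_map (bc c) ` chart_dom (bc c)" if "t \<in> J" for t
    using that by (simp add: bundle_chart_image[OF c] \<psi>_def J_def J0_def)
  have \<gamma>: "\<gamma> t \<in> chart_dom (bc c)" "chart_map (bc c) (\<gamma> t) = \<psi> t" if "t \<in> J" for t
    unfolding \<gamma>_def using chart_inv_mem[OF m[OF that]] by simp_all
  have \<gamma>S: "\<gamma> t \<in> S" if t: "t \<in> J" for t
  proof -
    have yt: "y + t *\<^sub>R a \<in> cimage c" and pos: "\<phi> t > 0" using t by (simp_all add: J_def J0_def)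
    have "s t * s t = \<phi> t powr (-1)" by (simp add: s_def powr_add[symmetric])
    then have "s t * s t * \<phi> t = 1" using pos by (simp add: powr_minus)
    moreover have "gc c (y + t *\<^sub>R a) (s t *\<^sub>R (u + t *\<^sub>R b)) (s t *\<^sub>R (u + t *\<^sub>R b)) =
        s t * s t * gc c (y + t *\<^sub>R a) (u + t *\<^sub>R b) (u + t *\<^sub>R b)"
      by (simp only: bl(3,4)[OF yt]) simp
    moreover have "gc c (y + t *\<^sub>R a) (u + t *\<^sub>R b) (u + t *\<^sub>R b) = \<epsilon> * \<phi> t"
      using sign_square by (simp add: \<phi>_def mult.assoc[symmetric])
    ultimately have "gc c (y + t *\<^sub>R a) (s t *\<^sub>R (u + t *\<^sub>R b)) (s t *\<^sub>R (u + t *\<^sub>R b)) = \<epsilon>"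
      by (metis mult.assoc mult.commute mult.right_neutral)
    then show ?thesis using unit_bundle_iff[OF c \<gamma>(1)[OF t]] \<gamma>(2)[OF t] by (simp add: \<psi>_def)
  qed
  have lind: "((\<lambda>t::real. x + t *\<^sub>R x') has_derivative (\<lambda>h. h *\<^sub>R x')) (at 0)" for x x' :: 'e
    by (auto intro!: derivative_eq_intros)
  have y0: "y + 0 *\<^sub>R a \<in> cimage c" using y by simp
  have "(\<phi> has_derivative (\<lambda>h. \<epsilon> * (bilin_deriv (gc c) (y + 0 *\<^sub>R a) (h *\<^sub>R a) (u + 0 *\<^sub>R b) (u + 0 *\<^sub>R b)
      + gc c (y + 0 *\<^sub>R a) (h *\<^sub>R b) (u + 0 *\<^sub>R b) + gc c (y + 0 *\<^sub>R a) (u + 0 *\<^sub>R b) (h *\<^sub>R b)))) (at 0)"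
    unfolding \<phi>_def[abs_def]
    by (intro has_derivative_mult_right
        bilin_field_has_derivative[where F = "\<lambda>t. y + t *\<^sub>R a", OF Gf y0] lind)
  moreover have "bilin_deriv (gc c) y (h *\<^sub>R a) u u + gc c y (h *\<^sub>R b) u + gc c y u (h *\<^sub>R b) = 0" for h
  proof -
    have "gc c y u (h *\<^sub>R (b + \<Gamma> c y a u)) = 0" using w0 by (simp only: bl(4)[OF y]) simp
    then show ?thesis
      using metric_coeff_sym[OF c y, of _ u]
      by (simp add: metric_compatible[OF c y] bl[OF y] bilin_field_add_scale[OF bilin_field_christoffel[OF c] y] algebra_simps)
  qed
  ultimately have d\<phi>: "(\<phi> has_derivative (\<lambda>h. 0)) (at 0)" by simp
  have "((\<lambda>r::real. r powr (-1/2)) has_derivative (*) (-1/2 * 1 powr (-1/2 - 1))) (at (\<phi> 0))"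
    using has_real_derivative_powr[of 1 "-1/2"] unfolding \<phi>0 has_field_derivative_def by simp
  from has_derivative_compose[OF d\<phi> this] have ds: "(s has_derivative (\<lambda>h. 0)) (at 0)"
    by (simp add: s_def[abs_def])
  have "(\<psi> has_derivative (\<lambda>h. (h *\<^sub>R a, s 0 *\<^sub>R (h *\<^sub>R b) + 0 *\<^sub>R (u + 0 *\<^sub>R b)))) (at 0)"
    unfolding \<psi>_def[abs_def] by (intro has_derivative_Pair lind has_derivative_scaleR ds)
  then have d\<psi>: "(\<psi> has_vector_derivative w) (at 0)"
    by (simp add: has_vector_derivative_def s0 ab)
  have "curve_through B S p (bt c p w) \<gamma>"
  proof (rule TM.curve_throughI[OF _ bcA e(1)])
    have "\<psi> 0 = chart_map (bc c) p" by (simp add: \<psi>_def s0 z)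
    then show "\<gamma> 0 = p" using TM.inv_chart[OF bcA p] by (simp add: \<gamma>_def)
    show "\<gamma> ` {-e<..<e} \<subseteq> S \<inter> chart_dom (bc c)" using I \<gamma>S \<gamma>(1) by blast
    show "smooth_on {-e<..<e} (chart_map (bc c) \<circ> \<gamma>)"
      by (rule smooth_on_cong[OF _ smooth_on_subset[OF s\<psi> I]]) (use I \<gamma>(2) in auto)
    show "((chart_map (bc c) \<circ> \<gamma>) has_vector_derivative w) (at 0)"
      by (rule has_vector_derivative_transform_within_open[OF d\<psi> J J_0]) (simp add: \<gamma>(2))
  qed
  then show ?thesis unfolding tangent_space_def by blast
qed

section \<open>The field \<xi> and the Lie derivative of the contact metric\<close>

text \<open>Twice the geodesic spray; the factor 2 is that of \<xi> = 2 u^h.\<close>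

definition xi_coeff :: "('a, 'e) chart \<Rightarrow> 'e \<times> 'e \<Rightarrow> 'e \<times> 'e"
  where "xi_coeff c z = 2 *\<^sub>R (snd z, - \<Gamma> c (fst z) (snd z) (snd z))"

lemma xi_chart:
  assumes c: "c \<in> A" and p: "p \<in> chart_dom (bc c)"
  shows "\<xi> p = bt c p (xi_coeff c (chart_map (bc c) p))"
  using horizontal_lift_chart[OF c p, of "snd p"] p[unfolded bundle_dom_iff[OF c]]
  by (simp add: standard_structure_def xi_coeff_def bundle_map
      TM.chart_tangent_scale[OF bundle_chart_in[OF c] p, symmetric])

lemma cm_metric_chart:
  assumes c: "c \<in> A" and p: "p \<in> chart_dom (bc c)"
  shows "G p (bt c p w) (bt c p w') = 1/4 * sasaki_coeff c (chart_map (bc c) p) w w'"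
  by (simp add: standard_structure_def sasaki_chart[OF c p])

lemma open_bundle_image: "c \<in> A \<Longrightarrow> open (cimage c \<times> (UNIV :: 'e set))"
  by (intro open_Times chart_open) auto

lemma xi_coeff_smooth:
  assumes c: "c \<in> A"
  shows "smooth_on (cimage c \<times> UNIV) (xi_coeff c)"
proof -
  note o = open_bundle_image[OF c]
  show ?thesis
    unfolding xi_coeff_def[abs_def]
    by (intro smooth_on_scaleR smooth_on_const smooth_on_Pair smooth_on_uminus
        bilin_field_smooth[OF bilin_field_christoffel[OF c]] smooth_on_fst smooth_on_snd smooth_on_id o) auto
qed

text \<open>\<xi> is horizontal, so its vertical part is zero and the orthogonality condition for
  tangency is trivial.\<close>

lemma xi_tangent:
  assumes pS: "p \<in> S"
  shows "\<xi> p \<in> tangent_space B S p"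
proof -
  obtain c where c: "c \<in> A" and p: "p \<in> chart_dom (bc c)" using unit_bundle_chart[OF pS] .
  note y = bundle_chart_fst[OF c p]
  show ?thesis unfolding xi_chart[OF c p]
    by (rule tangent_unit_bundleI[OF pS c p])
      (simp add: vpart_def xi_coeff_def bilin_field_add_scale[OF bilin_field_christoffel[OF c] y]
        bilin_field_add_scale[OF bilin_field_metric[OF c] y])
qed

lemma xi_vector_field: "vector_field B S \<xi>"
proof (rule TM.vector_fieldI[OF xi_tangent])
  fix p assume "p \<in> S"
  then obtain c where c: "c \<in> A" and p: "p \<in> chart_dom (bc c)" using unit_bundle_chart by blast
  show "\<exists>C\<in>B. p \<in> chart_dom C \<and> (\<exists>V F. open V \<and> chart_map C p \<in> V \<and> smooth_on V F \<and>
      (\<forall>q\<in>S \<inter> chart_dom C. chart_map C q \<in> V \<longrightarrow> \<xi> q C = F (chart_map C q)))"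
  proof (intro bexI[of _ "bc c"] conjI exI)
    show "open (cimage c \<times> (UNIV :: 'e set))" by (rule open_bundle_image[OF c])
    show "smooth_on (cimage c \<times> UNIV) (xi_coeff c)" by (rule xi_coeff_smooth[OF c])
    show "chart_map (bc c) p \<in> cimage c \<times> UNIV" using bundle_chart_fst[OF c p] by (simp add: mem_Times_iff)
    show "\<forall>q\<in>S \<inter> chart_dom (bc c). chart_map (bc c) q \<in> cimage c \<times> UNIV \<longrightarrow>
        \<xi> q (bc c) = xi_coeff c (chart_map (bc c) q)"
      using xi_chart[OF c] TM.chart_tangent_self[OF bundle_chart_in[OF c]] by simp
  qed (use c p bundle_chart_in in auto)
qed

lemma xi_coeff_has_derivative:
  assumes c: "c \<in> A" and y: "fst z \<in> cimage c"
  shows "(xi_coeff c has_derivative (\<lambda>h. 2 *\<^sub>R (snd h, - (bilin_deriv (\<Gamma> c) (fst z) (fst h) (snd z) (snd z)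
      + \<Gamma> c (fst z) (snd h) (snd z) + \<Gamma> c (fst z) (snd z) (snd h))))) (at z)"
  unfolding xi_coeff_def[abs_def]
  by (intro has_derivative_scaleR_right has_derivative_Pair has_derivative_minus
      bilin_field_has_derivative[where F = fst, OF bilin_field_christoffel[OF c] y] has_derivative_fst has_derivative_snd has_derivative_ident)

lemma vpart_has_derivative:
  assumes c: "c \<in> A" and y: "fst z \<in> cimage c" and F: "(F has_derivative F') (at z)"
  shows "((\<lambda>z. vpart c z (F z)) has_derivative (\<lambda>h. snd (F' h) + (bilin_deriv (\<Gamma> c) (fst z) (fst h) (fst (F z)) (snd z)
      + \<Gamma> c (fst z) (fst (F' h)) (snd z) + \<Gamma> c (fst z) (fst (F z)) (snd h)))) (at z)"
  unfolding vpart_def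
  by (intro has_derivative_add bilin_field_has_derivative[where F = fst, OF bilin_field_christoffel[OF c] y]
      has_derivative_fst has_derivative_snd has_derivative_ident F)

lemma sasaki_coeff_has_derivative:
  assumes c: "c \<in> A" and y: "fst z \<in> cimage c" and F: "(F has_derivative F') (at z)" and H: "(H has_derivative H') (at z)"
  shows "((\<lambda>z. sasaki_coeff c z (F z) (H z)) has_derivative (\<lambda>h.
      (bilin_deriv (gc c) (fst z) (fst h) (fst (F z)) (fst (H z)) + gc c (fst z) (fst (F' h)) (fst (H z))
        + gc c (fst z) (fst (F z)) (fst (H' h))) +
      (bilin_deriv (gc c) (fst z) (fst h) (vpart c z (F z)) (vpart c z (H z))
        + gc c (fst z) (snd (F' h) + (bilin_deriv (\<Gamma> c) (fst z) (fst h) (fst (F z)) (snd z)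
      + \<Gamma> c (fst z) (fst (F' h)) (snd z) + \<Gamma> c (fst z) (fst (F z)) (snd h))) (vpart c z (H z))
        + gc c (fst z) (vpart c z (F z)) (snd (H' h) + (bilin_deriv (\<Gamma> c) (fst z) (fst h) (fst (H z)) (snd z)
      + \<Gamma> c (fst z) (fst (H' h)) (snd z) + \<Gamma> c (fst z) (fst (H z)) (snd h)))))) (at z)"
  unfolding sasaki_coeff_def
  by (intro has_derivative_add bilin_field_has_derivative[where F = fst, OF bilin_field_metric[OF c] y]
      vpart_has_derivative[OF c y] has_derivative_fst has_derivative_ident F H)

text \<open>A field on \<open>S \<inter> W\<close> has no derivatives transverse to
  \<open>S\<close>. The function \<open>F\<close> extends its components to an open set of
  coordinates, where total derivatives exist; intersecting with the image of \<open>W\<close> lets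
  the conclusion speak of \<open>S\<close> alone.\<close>

lemma vector_field_unit_bundle_local:
  assumes W: "openin (atlas_topology B) W" and Y: "vector_field B (S \<inter> W) Y" and p: "p \<in> S \<inter> W"
    and c: "c \<in> A" "p \<in> chart_dom (bc c)"
  obtains V F where "open V" "chart_map (bc c) p \<in> V" "smooth_on V F"
    "\<And>q. q \<in> S \<inter> chart_dom (bc c) \<Longrightarrow> chart_map (bc c) q \<in> V \<Longrightarrow> Y q = bt c q (F (chart_map (bc c) q))"
proof -
  note bcA = bundle_chart_in[OF c(1)]
  have "smooth_fun B (S \<inter> W \<inter> chart_dom (bc c)) (\<lambda>q. Y q (bc c))"
    using Y bcA unfolding vector_field_def by blast
  then obtain V F where V: "open V" "chart_map (bc c) p \<in> V" "smooth_on V F"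
    "\<And>q. q \<in> S \<inter> W \<inter> chart_dom (bc c) \<inter> chart_dom (bc c) \<Longrightarrow> chart_map (bc c) q \<in> V \<Longrightarrow> Y q (bc c) = F (chart_map (bc c) q)"
    by (rule TM.smooth_fun_chart[OF _ _ bcA c(2)]) (use p c in auto)
  let ?W = "chart_map (bc c) ` (W \<inter> chart_dom (bc c))"
  show thesis
  proof (rule that[of "V \<inter> ?W" F])
    show "open (V \<inter> ?W)" using V(1) TM.openin_chart_image[OF W bcA] by auto
    show "chart_map (bc c) p \<in> V \<inter> ?W" using V(2) p c by auto
    show "smooth_on (V \<inter> ?W) F" by (rule smooth_on_subset[OF V(3)]) auto
    fix q assume q: "q \<in> S \<inter> chart_dom (bc c)" "chart_map (bc c) q \<in> V \<inter> ?W"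
    then obtain q' where q': "q' \<in> W" "q' \<in> chart_dom (bc c)" "chart_map (bc c) q = chart_map (bc c) q'" by auto
    have "q = q'" using inj_onD[OF TM.chart_inj[OF bcA] q'(3)] q(1) q'(2) by simp
    then have "q \<in> S \<inter> W" using q(1) q'(1) by simp
    then show "Y q = bt c q (F (chart_map (bc c) q))"
      using TM.vector_field_chart(1)[OF Y _ bcA, of q] V(4)[of q] q by simp
  qed
qed

text \<open>Tensoriality removes the derivatives of \<open>Y\<close> and \<open>Z\<close>, and
  metric compatibility removes those of the metric. Only derivatives of the Christoffel symbols are
  left, from the vertical parts and from the coefficients of \<xi>, and they combine with the
  quadratic Christoffel terms into curvature. The factor 1/2 is the 1/4 of the contact metric times
  the 2 of \<xi>.\<close>

lemma lie_derivative_chart: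
  assumes W: "openin (atlas_topology B) W" and Y: "vector_field B (S \<inter> W) Y" and Z: "vector_field B (S \<inter> W) Z"
    and p: "p \<in> S \<inter> W" and c: "c \<in> A" "p \<in> chart_dom (bc c)"
    and z: "chart_map (bc c) p = (y, u)" and Yp: "Y p (bc c) = (a, b)" and Zp: "Z p (bc c) = (a', b')"
  shows "lie_derivative B S \<xi> G Y Z p =
    1/2 * (gc c y (a - Rc c y a u u) (b' + \<Gamma> c y a' u) + gc c y (b + \<Gamma> c y a u) (a' - Rc c y a' u u))"
proof -
  note bcA = bundle_chart_in[OF c(1)]
  let ?z = "chart_map (bc c) p"
  have yc: "fst ?z \<in> cimage c" using bundle_chart_fst[OF c] .
  obtain VY FY where VY: "open VY" "?z \<in> VY" "smooth_on VY FY"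
    "\<And>q. q \<in> S \<inter> chart_dom (bc c) \<Longrightarrow> chart_map (bc c) q \<in> VY \<Longrightarrow> Y q = bt c q (FY (chart_map (bc c) q))"
    using vector_field_unit_bundle_local[OF W Y p c] by blast
  obtain VZ FZ where VZ: "open VZ" "?z \<in> VZ" "smooth_on VZ FZ"
    "\<And>q. q \<in> S \<inter> chart_dom (bc c) \<Longrightarrow> chart_map (bc c) q \<in> VZ \<Longrightarrow> Z q = bt c q (FZ (chart_map (bc c) q))"
    using vector_field_unit_bundle_local[OF W Z p c] by blast
  define V where "V = VY \<inter> VZ \<inter> (cimage c \<times> UNIV)"
  have V: "open V" "?z \<in> V"
    using VY(1,2) VZ(1,2) open_bundle_image[OF c(1)] yc by (auto simp: V_def mem_Times_iff)
  have sY: "smooth_on V FY" and sZ: "smooth_on V FZ" and sX: "smooth_on V (xi_coeff c)"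
    by (rule smooth_on_subset[OF VY(3)] smooth_on_subset[OF VZ(3)] smooth_on_subset[OF xi_coeff_smooth[OF c(1)]],
        auto simp: V_def)+
  have eY: "Y q = bt c q (FY (chart_map (bc c) q))" and eZ: "Z q = bt c q (FZ (chart_map (bc c) q))"
    if "q \<in> S \<inter> chart_dom (bc c)" "chart_map (bc c) q \<in> V" for q
    using VY(4)[OF that(1)] VZ(4)[OF that(1)] that(2) by (simp_all add: V_def)
  have pp: "p \<in> S \<inter> chart_dom (bc c)" using p c by simp
  note self = TM.chart_tangent_self[OF bcA c(2)]
  have FY: "FY ?z = (a, b)" and FZ: "FZ ?z = (a', b')"
    using eY[OF pp V(2)] eZ[OF pp V(2)] Yp Zp self by metis+
  have T: "Y p \<in> tangent_space B S p" "Z p \<in> tangent_space B S p"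
    using Y Z p TM.tangent_space_subset[of _ "S \<inter> W" p S] unfolding vector_field_def by blast+
  have \<xi>T: "\<xi> p \<in> tangent_space B S p" using xi_tangent p by simp
  let ?Y' = "frechet_derivative FY (at ?z)" and ?Z' = "frechet_derivative FZ (at ?z)"
  let ?X' = "frechet_derivative (xi_coeff c) (at ?z)" and ?\<xi> = "xi_coeff c ?z"
  have brY: "lie_bracket B S \<xi> Y p = bt c p (?Y' ?\<xi> - ?X' (FY ?z))"
    by (rule TM.lie_bracket_eq_chart_tangent[where X = \<xi> and Y = Y, OF \<xi>T T(1) bcA c(2) V sX sY]) (use xi_chart[OF c(1)] eY in auto)
  have brZ: "lie_bracket B S \<xi> Z p = bt c p (?Z' ?\<xi> - ?X' (FZ ?z))"
    by (rule TM.lie_bracket_eq_chart_tangent[where X = \<xi> and Y = Z, OF \<xi>T T(2) bcA c(2) V sX sZ]) (use xi_chart[OF c(1)] eZ in auto)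
  note D = sasaki_coeff_has_derivative[OF c(1) yc smooth_on_has_derivative[OF sY V(2)] smooth_on_has_derivative[OF sZ V(2)]]
  have dG: "dir_deriv B S p (\<xi> p) (\<lambda>q. G q (Y q) (Z q)) =
      1/4 * frechet_derivative (\<lambda>z. sasaki_coeff c z (FY z) (FZ z)) (at ?z) (\<xi> p (bc c))"
    unfolding frechet_derivative_eq[OF D]
    by (rule TM.dir_deriv_eq[OF \<xi>T bcA c(2) V _ has_derivative_mult_right[OF D, of "1/4"]])
      (use eY eZ cm_metric_chart[OF c(1)] in simp)
  have \<xi>p: "\<xi> p (bc c) = (2 *\<^sub>R u, - 2 *\<^sub>R \<Gamma> c y u u)"
    using xi_chart[OF c] self by (simp add: xi_coeff_def z)
  have \<xi>z: "?\<xi> = (2 *\<^sub>R u, - 2 *\<^sub>R \<Gamma> c y u u)" by (simp add: xi_coeff_def z)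
  have y: "y \<in> cimage c" using yc z by simp
  note bg = bilin_field_add_scale[OF bilin_field_metric[OF c(1)] y]
    and b\<Gamma> = bilin_field_add_scale[OF bilin_field_christoffel[OF c(1)] y]
    and s\<Gamma> = christoffel_sym[OF c(1) y]
    and lD = linear_scale[OF bilin_deriv_linear[OF bilin_field_christoffel[OF c(1)] y]]
  have lie: "lie_derivative B S \<xi> G Y Z p =
      1/4 * frechet_derivative (\<lambda>z. sasaki_coeff c z (FY z) (FZ z)) (at ?z) (\<xi> p (bc c))
      - 1/4 * sasaki_coeff c ?z (?Y' ?\<xi> - ?X' (FY ?z)) (FZ ?z)
      - 1/4 * sasaki_coeff c ?z (FY ?z) (?Z' ?\<xi> - ?X' (FZ ?z))"
    unfolding lie_derivative_def dG brY brZ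
    by (simp add: eY[OF pp V(2)] eZ[OF pp V(2)] cm_metric_chart[OF c])
  \<comment> \<open>The derivatives of the extensions along \<xi> occur both in the differentiated
    metric and in the brackets. Naming their components as opaque pairs allows plain algebra to
    cancel them.\<close>
  obtain p1 p2 where P: "?Y' (2 *\<^sub>R u, - 2 *\<^sub>R \<Gamma> c y u u) = (p1, p2)" by fastforce
  obtain q1 q2 where Q: "?Z' (2 *\<^sub>R u, - 2 *\<^sub>R \<Gamma> c y u u) = (q1, q2)" by fastforce
  show ?thesis
    unfolding lie
    unfolding frechet_derivative_eq[OF D] frechet_derivative_eq[OF xi_coeff_has_derivative[OF c(1) yc]]
    unfolding \<xi>p \<xi>z P Q FY FZ
    unfolding sasaki_coeff_def vpart_def z
    unfolding fst_conv snd_conv metric_compatible[OF c(1) y] curvature_of_def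
    by (simp add: bg b\<Gamma> lD s\<Gamma> algebra_simps)
qed

end

section \<open>The Killing equation\<close>

context unit_tangent_bundle
begin

text \<open>The field is the horizontal lift of the constant coordinate vector \<open>a\<close> plus
  the tangential lift of the constant \<open>k\<close>; subtracting the component of
  \<open>k\<close> along the fibre coordinate keeps it tangent at every point. At \<open>p\<close>
  nothing is subtracted, since \<open>k\<close> is orthogonal to \<open>u\<close> there.\<close>

lemma tangent_extension:
  assumes pS: "p \<in> S" and c: "c \<in> A" and p: "p \<in> chart_dom (bc c)" and z: "chart_map (bc c) p = (y, u)"
    and k: "gc c y u k = 0"
  obtains Y where "vector_field B (S \<inter> chart_dom (bc c)) Y" "Y p (bc c) = (a, k - \<Gamma> c y a u)"
proof -
  note bcA = bundle_chart_in[OF c]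
  define F where "F z = (a, (k + (- (\<epsilon> * gc c (fst z) k (snd z))) *\<^sub>R snd z) + - \<Gamma> c (fst z) a (snd z))" for z
  define Y where "Y q = bt c q (F (chart_map (bc c) q))" for q
  note o = open_bundle_image[OF c]
  have sF: "smooth_on (cimage c \<times> UNIV) F"
    unfolding F_def[abs_def] mult_minus_right[symmetric]
    by (intro smooth_on_scaleR smooth_on_const smooth_on_Pair smooth_on_add smooth_on_uminus smooth_on_mult
        bilin_field_smooth[OF bilin_field_christoffel[OF c]] bilin_field_smooth[OF bilin_field_metric[OF c]]
        smooth_on_fst smooth_on_snd smooth_on_id o) auto
  have "vector_field B (S \<inter> chart_dom (bc c)) Y"
  proof (rule TM.vector_fieldI)
    fix q assume q: "q \<in> S \<inter> chart_dom (bc c)"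
    have y': "fst (chart_map (bc c) q) \<in> cimage c" using bundle_chart_fst[OF c] q by simp
    have uu: "gc c (fst (chart_map (bc c) q)) (snd (chart_map (bc c) q)) (snd (chart_map (bc c) q)) = \<epsilon>"
      using unit_bundle_iff[OF c] q by blast
    show "Y q \<in> tangent_space B (S \<inter> chart_dom (bc c)) q"
      unfolding Y_def
      using q sign_square metric_coeff_sym[OF c y', of k]
      by (intro TM.tangent_space_Int_open[OF tangent_unit_bundleI[OF _ c] TM.openin_chart_dom[OF bcA]])
        (auto simp: vpart_def F_def bilin_field_add_scale[OF bilin_field_metric[OF c] y'] uu mult.assoc
          mult.left_commute[of _ \<epsilon>])
    show "\<exists>C\<in>B. q \<in> chart_dom C \<and> (\<exists>V F. open V \<and> chart_map C q \<in> V \<and> smooth_on V F \<and>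
        (\<forall>q'\<in>S \<inter> chart_dom (bc c) \<inter> chart_dom C. chart_map C q' \<in> V \<longrightarrow> Y q' C = F (chart_map C q')))"
    proof (intro bexI[OF _ bcA] conjI exI)
      show "\<forall>q'\<in>S \<inter> chart_dom (bc c) \<inter> chart_dom (bc c). chart_map (bc c) q' \<in> cimage c \<times> UNIV \<longrightarrow>
          Y q' (bc c) = F (chart_map (bc c) q')"
        using TM.chart_tangent_self[OF bcA] by (simp add: Y_def)
    qed (use q y' o sF in \<open>auto simp: mem_Times_iff\<close>)
  qed
  moreover have "Y p (bc c) = (a, k - \<Gamma> c y a u)"
    using k metric_coeff_sym[OF c, of y k u] bundle_chart_fst[OF c p] z
    by (simp add: Y_def TM.chart_tangent_self[OF bcA p] F_def)
  ultimately show thesis by (rule that)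
qed

lemma K_contact_chart:
  "K_contact B S (standard_structure A g nabla \<epsilon>) \<longleftrightarrow>
    (\<forall>c\<in>A. \<forall>y\<in>cimage c. \<forall>u a. gc c y u u = \<epsilon> \<longrightarrow> Rc c y a u u = a - (\<epsilon> * gc c y a u) *\<^sub>R u)"
proof
  assume K: "K_contact B S (standard_structure A g nabla \<epsilon>)"
  show "\<forall>c\<in>A. \<forall>y\<in>cimage c. \<forall>u a. gc c y u u = \<epsilon> \<longrightarrow> Rc c y a u u = a - (\<epsilon> * gc c y a u) *\<^sub>R u"
  proof (intro ballI allI impI)
    fix c y u a assume c: "c \<in> A" and y: "y \<in> cimage c" and uu: "gc c y u u = \<epsilon>"
    note bl = bilin_field_add_scale[OF bilin_field_metric[OF c] y] and bcA = bundle_chart_in[OF c]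
    have "(y, u) \<in> chart_map (bc c) ` chart_dom (bc c)" using y by (simp add: bundle_chart_image[OF c])
    then obtain p where p: "p \<in> chart_dom (bc c)" and z: "chart_map (bc c) p = (y, u)" by auto
    have pS: "p \<in> S" using unit_bundle_iff[OF c p] z uu by simp
    let ?d = "a - Rc c y a u u"
    have orth: "gc c y ?d k = 0" if k: "gc c y u k = 0" for k
    proof -
      \<comment> \<open>\<open>Y\<close> is horizontal at \<open>p\<close> with base part
        \<open>a\<close>, and \<open>Z\<close> below is vertical at \<open>p\<close> with fibre part
        \<open>k\<close>. In the formula for the Lie derivative only the term pairing
        \<open>?d\<close> with \<open>k\<close> survives.\<close>
      obtain Y where Y: "vector_field B (S \<inter> chart_dom (bc c)) Y" "Y p (bc c) = (a, 0 - \<Gamma> c y a u)"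
        using tangent_extension[OF pS c p z, of 0 a] bl(10) by blast
      obtain Z where Z: "vector_field B (S \<inter> chart_dom (bc c)) Z" "Z p (bc c) = (0, k - \<Gamma> c y 0 u)"
        using tangent_extension[OF pS c p z k, of 0] by blast
      have "lie_derivative B S \<xi> G Y Z p = 0"
        using K Y(1) Z(1) TM.openin_chart_dom[OF bcA] pS p unfolding K_contact_def killing_field_def by blast
      then show ?thesis
        using lie_derivative_chart[OF TM.openin_chart_dom[OF bcA] Y(1) Z(1) _ c p z Y(2) Z(2)] pS p
        by (simp add: bl)
    qed
    have u: "gc c y ?d u = gc c y a u"
      using curvature_skew[OF c y, of a u u] by (simp add: bl)
    have "?d - (\<epsilon> * gc c y a u) *\<^sub>R u = 0"
    proof (rule metric_coeff_nondegenerate[OF c y])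
      fix k
      \<comment> \<open>The projection of an arbitrary \<open>k\<close> onto the orthogonal
        complement of \<open>u\<close>; it uses that \<epsilon> is its own inverse. The component
        along \<open>u\<close> is covered by \<open>u\<close>, that is, by skewness of the
        curvature.\<close>
      have "gc c y u (k - (\<epsilon> * gc c y u k) *\<^sub>R u) = 0" using sign_square by (simp add: bl uu)
      from orth[OF this] have "gc c y ?d k = \<epsilon> * gc c y u k * gc c y ?d u" by (simp only: bl(4,8)) simp
      then show "gc c y (?d - (\<epsilon> * gc c y a u) *\<^sub>R u) k = 0"
        unfolding u by (simp only: bl(3,7)) simp
    qed
    then show "Rc c y a u u = a - (\<epsilon> * gc c y a u) *\<^sub>R u" by (simp add: algebra_simps)
  qed
next
  assume R: "\<forall>c\<in>A. \<forall>y\<in>cimage c. \<forall>u a. gc c y u u = \<epsilon> \<longrightarrow> Rc c y a u u = a - (\<epsilon> * gc c y a u) *\<^sub>R u"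
  have "lie_derivative B S \<xi> G Y Z p = 0"
    if W: "openin (atlas_topology B) W" and Y: "vector_field B (S \<inter> W) Y" and Z: "vector_field B (S \<inter> W) Z"
      and p: "p \<in> S \<inter> W" for W Y Z p
  proof -
    obtain c where c: "c \<in> A" and pd: "p \<in> chart_dom (bc c)" using unit_bundle_chart p by blast
    obtain y u where z: "chart_map (bc c) p = (y, u)" by fastforce
    obtain a b where Yp: "Y p (bc c) = (a, b)" by fastforce
    obtain a' b' where Zp: "Z p (bc c) = (a', b')" by fastforce
    have y: "y \<in> cimage c" using bundle_chart_fst[OF c pd] z by simp
    have uu: "gc c y u u = \<epsilon>" using unit_bundle_iff[OF c pd] p z by simp
    have T: "Y p \<in> tangent_space B S p" "Z p \<in> tangent_space B S p"
      using Y Z p TM.tangent_space_subset[of _ "S \<inter> W" p S] unfolding vector_field_def by blast+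
    have kY: "gc c y u (b + \<Gamma> c y a u) = 0" and kZ: "gc c y u (b' + \<Gamma> c y a' u) = 0"
      using tangent_unit_bundleD[OF T(1) c pd] tangent_unit_bundleD[OF T(2) c pd] by (simp_all add: z Yp Zp vpart_def)
    have "Rc c y x u u = x - (\<epsilon> * gc c y x u) *\<^sub>R u" for x using R c y uu by blast
    \<comment> \<open>Both curvature factors of the Lie derivative are multiples of
      \<open>u\<close>, and vertical parts of vectors tangent to \<open>S\<close> are orthogonal to
      \<open>u\<close>; both summands vanish.\<close>
    then have "a - Rc c y a u u = (\<epsilon> * gc c y a u) *\<^sub>R u" "a' - Rc c y a' u u = (\<epsilon> * gc c y a' u) *\<^sub>R u"
      by simp_all
    then show ?thesis
      using lie_derivative_chart[OF W Y Z p c pd z Yp Zp] kY kZ metric_coeff_sym[OF c y, of "b + \<Gamma> c y a u" u]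
      by (simp add: bilin_field_add_scale(3,4)[OF bilin_field_metric[OF c] y])
  qed
  then show "K_contact B S (standard_structure A g nabla \<epsilon>)"
    unfolding K_contact_def killing_field_def using xi_vector_field by blast
qed

end

section \<open>Index of the metric\<close>

text \<open>Tangent vectors are elements of a function space that may be infinite dimensional.
  Dimensions of their subspaces are controlled by carrying them injectively into the Euclidean model
  space.\<close>

lemma dim_image_inj_on:
  fixes f :: "'x::real_vector \<Rightarrow> 'y::real_vector"
  assumes f: "linear f" and V: "subspace V" and inj: "inj_on f V"
  shows "dim (f ` V) = dim V"
proof -
  obtain C where C: "C \<subseteq> V" "independent C" "V \<subseteq> span C" "card C = dim V" using basis_exists .
  have sC: "span C = V" using C(1,3) span_minimal[OF C(1) V] by auto
  have "independent (f ` C)"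
    by (rule linear_independent_injective_image[OF f C(2)]) (simp add: inj sC)
  moreover have "span (f ` C) = f ` V" using linear_span_image[OF f] sC by simp
  moreover have "card (f ` C) = card C" using card_image inj_on_subset[OF inj C(1)] by blast
  ultimately show ?thesis
    using dim_eq_card[of "f ` C" "f ` V"] C(4) by (metis span_span)
qed

context levi_civita_manifold
begin

abbreviation negative_subspace where
  "negative_subspace p V \<equiv> subspace V \<and> V \<subseteq> full_tangent_space A p \<and> (\<forall>v\<in>V. v \<noteq> 0 \<longrightarrow> g p v v < 0)"

lemma coordinate_inj:
  assumes c: "c \<in> A" "p \<in> chart_dom c" and V: "V \<subseteq> full_tangent_space A p"
  shows "inj_on (\<lambda>v. v c) V"
  by (rule inj_onI) (use tangent_eqI[OF _ _ c] V in blast)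

lemma linear_coordinate: "linear (\<lambda>v :: ('a, 'e) tangent. v c)"
  by (rule linearI) auto

lemma dim_coordinates:
  assumes c: "c \<in> A" "p \<in> chart_dom c" and V: "subspace V" "V \<subseteq> full_tangent_space A p"
  shows "dim ((\<lambda>v. v c) ` V) = dim V"
  by (rule dim_image_inj_on[OF linear_coordinate V(1) coordinate_inj[OF c V(2)]])

text \<open>The maximum in \<open>metric_index\<close> is meaningful because the dimensions are
  bounded by that of the model space, and because the zero subspace always qualifies.\<close>

lemma metric_index_Max:
  assumes p: "p \<in> points A"
  shows "negative_subspace p V \<Longrightarrow> dim V \<le> metric_index A g p"
    and "\<exists>V. negative_subspace p V \<and> dim V = metric_index A g p"
proof -
  obtain c where c: "c \<in> A" "p \<in> chart_dom c" using p unfolding points_def by blast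
  define N where "N = {V. negative_subspace p V}"
  have "dim ` N \<subseteq> {..DIM('e)}"
  proof (rule image_subsetI)
    fix V assume "V \<in> N"
    then have "subspace V" "V \<subseteq> full_tangent_space A p" by (simp_all add: N_def)
    from dim_coordinates[OF c this] show "dim V \<in> {..DIM('e)}"
      using dim_subset_UNIV[of "(\<lambda>v. v c) ` V"] by simp
  qed
  then have fin: "finite (dim ` N)" by (rule finite_subset) simp
  have "{0} \<in> N" using subspace_0[OF full_tangent_subspace[OF p]] by (simp add: N_def subspace_single_0)
  then have ne: "dim ` N \<noteq> {}" by blast
  have M: "metric_index A g p = Max (dim ` N)" unfolding metric_index_def N_def setcompr_eq_image ..
  show "dim V \<le> metric_index A g p" if "negative_subspace p V"
    unfolding M by (rule Max_ge[OF fin imageI]) (use that in \<open>simp add: N_def\<close>)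
  obtain V where "V \<in> N" "Max (dim ` N) = dim V" using Max_in[OF fin ne] by (rule imageE) simp
  then show "\<exists>V. negative_subspace p V \<and> dim V = metric_index A g p"
    unfolding M N_def by (intro exI[of _ V]) simp
qed

lemma metric_index_const:
  assumes "p \<in> points A" "q \<in> points A"
  shows "metric_index A g p = metric_index A g q"
  using prm[unfolded pseudo_riemannian_manifold_def, THEN conjunct2, THEN conjunct2, THEN conjunct2] assms by metis

text \<open>A null vector of a semidefinite form lies in the radical, which nondegeneracy makes
  trivial. The proof perturbs the null vector \<open>u\<close> by a small multiple of a vector
  \<open>v\<close> with nonzero pairing.\<close>

lemma negative_semidefinite_imp_definite:
  assumes c: "c \<in> A" and y: "y \<in> cimage c" and neg: "\<And>v. gc c y v v \<le> 0" and u: "u \<noteq> 0"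
  shows "gc c y u u < 0"
proof (rule ccontr)
  note bl = bilin_field_add_scale[OF bilin_field_metric[OF c] y]
  assume "\<not> gc c y u u < 0"
  then have uu: "gc c y u u = 0" using neg[of u] by simp
  have "gc c y u v = 0" for v
  proof (rule ccontr)
    define q where "q = - gc c y v v"
    have q: "q \<ge> 0" using neg[of v] by (simp add: q_def)
    \<comment> \<open>With this \<open>t\<close> the form takes the value
      \<open>t * t * (q + 2)\<close> at \<open>u + t *\<^sub>R v\<close>, which would be positive.
      The summand 1 guards against division by zero when \<open>q\<close> is zero.\<close>
    define t where "t = gc c y u v / (q + 1)"
    assume "gc c y u v \<noteq> 0"
    then have t: "t * t > 0" using q by (auto simp: t_def zero_less_mult_iff linorder_neq_iff zero_less_divide_iff divide_less_0_iff)
    have m: "gc c y u v = t * (q + 1)" using q by (simp add: t_def)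
    have "gc c y (u + t *\<^sub>R v) (u + t *\<^sub>R v) = 2 * t * gc c y u v - t * t * q"
      using metric_coeff_sym[OF c y, of v u] by (simp add: bl uu q_def algebra_simps)
    then have "t * t * (2 * (q + 1)) \<le> t * t * q"
      using neg[of "u + t *\<^sub>R v"] unfolding m by (simp add: algebra_simps)
    then have "2 * (q + 1) \<le> q" using t by (simp only: mult_le_cancel_left_pos)
    then show False using q by simp
  qed
  then show False using metric_coeff_nondegenerate[OF c y] u by blast
qed

end

text \<open>The unit vector \<open>u0\<close> lies over a point \<open>x0\<close> that may be in
  another component than \<open>x\<close>; only the index links the two. For \<epsilon> = 1, a
  metric at \<open>x\<close> without positive vectors would be negative definite, so the index would
  be the full dimension, also at \<open>x0\<close>, and \<open>u0\<close> would lie in a negative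
  definite subspace. For \<epsilon> = -1, the line through \<open>u0\<close> makes the index at
  least 1, which gives a negative vector at \<open>x\<close>.\<close>

lemma (in unit_tangent_bundle) ex_sign_vector:
  assumes S: "S \<noteq> {}" and c: "c \<in> A" and y: "y \<in> cimage c"
  shows "\<exists>u. \<epsilon> * gc c y u u > 0"
proof -
  obtain x where x: "x \<in> chart_dom c" "y = chart_map c x" using y by auto
  have xP: "x \<in> points A" using in_pointsI[OF c x(1)] .
  obtain p where p: "p \<in> S" using S by blast
  define x0 u0 where "x0 = fst p" and "u0 = snd p"
  have x0: "x0 \<in> points A" "u0 \<in> full_tangent_space A x0" and u0: "g x0 u0 u0 = \<epsilon>"
    using p by (auto simp: unit_bundle_def tangent_bundle_def x0_def u0_def)
  obtain c0 where c0: "c0 \<in> A" "x0 \<in> chart_dom c0" using x0(1) unfolding points_def by blast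
  note y0 = imageI[OF c0(2), of "chart_map c0"]
  have u0nz: "u0 \<noteq> 0"
  proof
    assume "u0 = 0"
    then have "g x0 u0 u0 = 0"
      using metric_chart[OF c0 x0(2,2)] bilin_field_add_scale(9)[OF bilin_field_metric[OF c0(1)] y0] by simp
    then show False using u0 sign by auto
  qed
  consider "\<epsilon> = 1" | "\<epsilon> = -1" using sign by auto
  then show ?thesis
  proof cases
    case 1
    show ?thesis
    proof (rule ccontr)
      assume "\<not> ?thesis"
      then have neg: "gc c y v v \<le> 0" for v using 1 by (simp add: not_less)
      have "g x v v < 0" if v: "v \<in> full_tangent_space A x" "v \<noteq> 0" for v
      proof -
        have "v c \<noteq> 0" using zero_tangentI[OF v(1) c x(1)] v(2) by blast
        then show ?thesis
          using negative_semidefinite_imp_definite[OF c y neg] metric_chart[OF c x(1) v(1,1)] x(2) by simp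
      qed
      then have "negative_subspace x (full_tangent_space A x)" using full_tangent_subspace[OF xP] by blast
      then have "dim (full_tangent_space A x) \<le> metric_index A g x" by (rule metric_index_Max(1)[OF xP])
      moreover have "(\<lambda>v. v c) ` full_tangent_space A x = UNIV"
        using chart_tangent_full[OF c x(1)] chart_tangent_self[OF c x(1)] by (metis UNIV_eq_I image_eqI)
      then have "dim (full_tangent_space A x) = DIM('e)"
        using dim_coordinates[OF c x(1) full_tangent_subspace[OF xP] subset_refl] by simp
      ultimately have "DIM('e) \<le> metric_index A g x0" using metric_index_const[OF xP x0(1)] by simp
      then obtain V where V: "negative_subspace x0 V" "DIM('e) \<le> dim V"
        using metric_index_Max(2)[OF x0(1)] by metis
      let ?V = "(\<lambda>v. v c0) ` V"
      have "dim ?V = DIM('e)"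
        using dim_coordinates[OF c0, of V] V dim_subset_UNIV[of ?V] by simp
      then have "span ?V = UNIV" by (simp add: dim_eq_full)
      then have "?V = UNIV" using linear_subspace_image[OF linear_coordinate] V(1) by (metis span_eq_iff)
      then obtain v where v: "v \<in> V" "u0 c0 = v c0" by (metis UNIV_I imageE)
      have "u0 = v" using tangent_eqI[where w = v and T = "points A", OF x0(2) _ c0 v(2)] V(1) v(1) by blast
      then show False using V(1) v(1) u0 u0nz 1 by force
    qed
  next
    case 2
    have "g x0 v v < 0" if vs: "v \<in> span {u0}" "v \<noteq> 0" for v
    proof -
      obtain r where r: "v = r *\<^sub>R u0" using vs(1) unfolding span_singleton by blast
      then have "r \<noteq> 0" using vs(2) by auto
      have "v \<in> full_tangent_space A x0" using r subspace_scale[OF full_tangent_subspace] x0 by simp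
      then have "g x0 v v = r * r * g x0 u0 u0"
        using metric_chart[OF c0] x0(2) r bilin_field_add_scale(3,4)[OF bilin_field_metric[OF c0(1)] y0] by simp
      then show ?thesis using \<open>r \<noteq> 0\<close> u0 2 by (auto simp: zero_less_mult_iff linorder_neq_iff)
    qed
    moreover have "span {u0} \<subseteq> full_tangent_space A x0"
      using span_minimal[OF _ full_tangent_subspace[OF x0(1)]] x0(2) by simp
    ultimately have "dim (span {u0}) \<le> metric_index A g x0"
      by (intro metric_index_Max(1)[OF x0(1)]) (simp add: subspace_span)
    moreover have "dim (span {u0}) = 1"
      using dim_span_eq_card_independent[of "{u0}"] u0nz by simp
    ultimately have i: "metric_index A g x \<ge> 1" using metric_index_const[OF xP x0(1)] by simp
    obtain V where VV: "negative_subspace x V \<and> dim V = metric_index A g x"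
      using metric_index_Max(2)[OF xP] by (rule exE)
    note V = VV[THEN conjunct1] VV[THEN conjunct2]
    have "\<not> V \<subseteq> {0}"
    proof
      assume "V \<subseteq> {0}"
      then have "dim V \<le> card ({} :: ('a, 'e) tangent set)" by (intro dim_le_card) auto
      then show False using i V(2) by simp
    qed
    then obtain v where v: "v \<in> V" "v \<noteq> 0" by blast
    have vT: "v \<in> full_tangent_space A x" using V(1) v(1) by blast
    have "g x v v < 0" using V(1) v by blast
    then have "gc c y (v c) (v c) < 0" using metric_chart[OF c x(1) vT vT] x(2) by simp
    then show ?thesis using 2 by (intro exI[of _ "v c"]) simp
  qed
qed

section \<open>Polarization\<close>

text \<open>For fixed \<open>a\<close> and \<open>v\<close>, the value of \<open>T a\<close> on the
  diagonal at \<open>u0 + t *\<^sub>R v\<close> is a quadratic polynomial in \<open>t\<close>. The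
  cone condition is open, so this polynomial vanishes near \<open>t = 0\<close> and its leading
  coefficient \<open>T a v v\<close> is zero.\<close>

lemma trilinear_polarization:
  fixes T :: "'v::real_vector \<Rightarrow> 'v \<Rightarrow> 'v \<Rightarrow> 'w::real_vector" and h :: "'v \<Rightarrow> 'v \<Rightarrow> real"
  assumes h: "\<And>z. linear (\<lambda>u. h u z)" "\<And>u. linear (h u)"
    and T: "\<And>a z. linear (\<lambda>b. T a b z)" "\<And>a b. linear (T a b)"
    and anti: "\<And>a b z. T a b z = - T b a z"
    and bianchi: "\<And>a b z. T a b z + T b z a + T z a b = 0"
    and u0: "h u0 u0 > 0" and cone: "\<And>a u. h u u > 0 \<Longrightarrow> T a u u = 0"
  shows "T a b z = 0"
proof -
  note hl = linear_add[OF h(1)] linear_add[OF h(2)] linear_scale[OF h(1)] linear_scale[OF h(2)]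
  note Tl = linear_add[OF T(1)] linear_add[OF T(2)] linear_scale[OF T(1)] linear_scale[OF T(2)]
  have diag: "T a v v = 0" for a v
  proof -
    define f where "f t = h u0 u0 + t * (h u0 v + h v u0) + t * t * h v v" for t
    have f: "h (u0 + t *\<^sub>R v) (u0 + t *\<^sub>R v) = f t" for t
      by (simp add: hl f_def algebra_simps)
    have "continuous_on UNIV f" unfolding f_def by (intro continuous_intros)
    then have "open (f -` {0<..})" using continuous_open_preimage[of UNIV f "{0<..}"] by simp
    moreover have "0 \<in> f -` {0<..}" using u0 by (simp add: f_def)
    ultimately obtain e where e: "e > 0" "ball 0 e \<subseteq> f -` {0<..}" by (meson openE)
    \<comment> \<open>Adding the values at \<open>t\<close> and \<open>- t\<close> eliminates the
      linear coefficient; the constant one vanishes because \<open>u0\<close> is in the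
      cone.\<close>
    define t where "t = e / 2"
    have t: "t > 0" "t \<in> ball 0 e" "- t \<in> ball 0 e" using e(1) by (auto simp: t_def)
    have z: "T a (u0 + s *\<^sub>R v) (u0 + s *\<^sub>R v) = 0" if "s \<in> ball 0 e" for s
      using e(2) that f[of s] by (intro cone) auto
    have x: "T a (u0 + s *\<^sub>R v) (u0 + s *\<^sub>R v) = T a u0 u0 + s *\<^sub>R (T a u0 v + T a v u0) + (s * s) *\<^sub>R T a v v" for s
      by (simp add: Tl algebra_simps)
    have "(t * t) *\<^sub>R T a v v + (t * t) *\<^sub>R T a v v = 0"
      using z[OF t(2)] z[OF t(3)] cone[OF u0] unfolding x by (simp add: algebra_simps)
    then show ?thesis using t(1) by (simp add: scaleR_2[symmetric])
  qed
  have skew: "T a b z = - T a z b" for a b z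
  proof -
    have "T a (b + z) (b + z) = (T a b b + T a z z) + (T a b z + T a z b)" by (simp add: Tl algebra_simps)
    then have "T a b z + T a z b = 0" unfolding diag by simp
    then show ?thesis by (rule eq_neg_iff_add_eq_0[THEN iffD2])
  qed
  \<comment> \<open>A cyclic permutation is a product of two transpositions, so the signs cancel and
    the Bianchi sum is three times one term.\<close>
  have "T b z a = T a b z" using skew[of b z a] anti[of b a z] by simp
  moreover have "T z a b = T a b z" using anti[of z a b] skew[of a z b] by simp
  ultimately have "T a b z + T a b z + T a b z = 0" using bianchi[of a b z] by simp
  then have "3 *\<^sub>R T a b z = 0" by (simp add: scaleR_add_left[of 2 1, simplified] scaleR_2)
  then show ?thesis by simp
qed

section \<open>From unit vectors to the full curvature tensor\<close>

lemma (in levi_civita_manifold) curvature_linear: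
  assumes c: "c \<in> A" and y: "y \<in> cimage c"
  shows "linear (\<lambda>b. Rc c y a b z)" "linear (Rc c y a b)"
proof -
  note H = bilin_field_christoffel[OF c]
  note bl = bilin_field_add_scale[OF H y]
    linear_add[OF bilin_deriv_linear[OF H y]] linear_scale[OF bilin_deriv_linear[OF H y]]
    bilinear_ladd[OF bilin_deriv_bilinear[OF H y]] bilinear_radd[OF bilin_deriv_bilinear[OF H y]]
    bilinear_lmul[OF bilin_deriv_bilinear[OF H y]] bilinear_rmul[OF bilin_deriv_bilinear[OF H y]]
  show "linear (\<lambda>b. Rc c y a b z)" "linear (Rc c y a b)"
    by (rule linearI; simp add: curvature_of_def bl algebra_simps)+
qed

text \<open>\<open>T\<close> is the difference between the curvature and its model of constant
  curvature \<epsilon>; the model has the same symmetries, so \<open>T\<close> inherits antisymmetry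
  and the Bianchi identity. The form \<epsilon> g puts both signs of \<epsilon> under one cone
  condition. The converse is the special case of equal second and third arguments.\<close>

lemma (in unit_tangent_bundle) K_contact_iff_constant_curvature:
  assumes S: "S \<noteq> {}"
  shows "K_contact B S (standard_structure A g nabla \<epsilon>) \<longleftrightarrow> constant_sectional_curvature A g nabla \<epsilon>"
  unfolding K_contact_chart constant_curvature_chart
proof (intro iffI ballI allI impI)
  fix c y a b z
  assume R: "\<forall>c\<in>A. \<forall>y\<in>cimage c. \<forall>u a. gc c y u u = \<epsilon> \<longrightarrow> Rc c y a u u = a - (\<epsilon> * gc c y a u) *\<^sub>R u"
    and c: "c \<in> A" and y: "y \<in> cimage c"
  note bl = bilin_field_add_scale[OF bilin_field_metric[OF c] y]
    and Rl = curvature_linear[OF c y]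
  define T where "T a b z = Rc c y a b z - \<epsilon> *\<^sub>R (gc c y b z *\<^sub>R a - gc c y a z *\<^sub>R b)" for a b z
  obtain u0 where u0: "\<epsilon> * gc c y u0 u0 > 0" using ex_sign_vector[OF S c y] by blast
  have "T a b z = 0"
  proof (rule trilinear_polarization[where T = T and h = "\<lambda>u v. \<epsilon> * gc c y u v", OF _ _ _ _ _ _ u0])
    show "linear (\<lambda>u. \<epsilon> * gc c y u z)" for z by (rule linearI; simp add: bl algebra_simps)
    show "linear (\<lambda>z. \<epsilon> * gc c y u z)" for u by (rule linearI; simp add: bl algebra_simps)
    show "linear (\<lambda>b. T a b z)" for a z
      by (rule linearI; simp add: T_def bl linear_add[OF Rl(1)] linear_scale[OF Rl(1)] algebra_simps)
    show "linear (T a b)" for a b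
      by (rule linearI; simp add: T_def bl linear_add[OF Rl(2)] linear_scale[OF Rl(2)] algebra_simps)
    show "T a b z = - T b a z" for a b z
      using curvature_antisym[of c y a b z] by (simp add: T_def algebra_simps)
    show "T a b z + T b z a + T z a b = 0" for a b z
    proof -
      have "T a b z + T b z a + T z a b = Rc c y a b z + Rc c y b z a + Rc c y z a b"
        by (simp add: T_def metric_coeff_sym[OF c y, of z a] metric_coeff_sym[OF c y, of z b]
            metric_coeff_sym[OF c y, of b a] algebra_simps)
      then show ?thesis using curvature_bianchi[OF c y] by simp
    qed
    fix a u assume pos: "\<epsilon> * gc c y u u > 0"
    \<comment> \<open>The hypothesis concerns vectors with \<open>g u u\<close> equal to \<epsilon>,
      whereas the cone contains all lengths. Dividing by \<open>r\<close> normalises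
      \<open>u\<close>, and \<open>T a u u\<close> scales quadratically.\<close>
    define r where "r = sqrt (\<epsilon> * gc c y u u)"
    have r: "r > 0" "r * r = \<epsilon> * gc c y u u" using pos by (simp_all add: r_def)
    let ?v = "(1 / r) *\<^sub>R u"
    have g: "gc c y u u = \<epsilon> * (r * r)" using r(2) sign_square by (simp add: mult.assoc[symmetric])
    have vv: "gc c y ?v ?v = \<epsilon>" using r(1) by (simp add: bl g)
    have "T a v v = 0" if v: "gc c y v v = \<epsilon>" for v
    proof -
      have "Rc c y a v v = a - (\<epsilon> * gc c y a v) *\<^sub>R v" using R c y v by blast
      then show ?thesis by (simp add: T_def v sign_square scaleR_diff_right)
    qed
    then have "T a ?v ?v = 0" using vv .
    moreover have "T a ?v ?v = (1 / r) *\<^sub>R (1 / r) *\<^sub>R T a u u"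
      by (simp add: T_def bl linear_scale[OF Rl(1)] linear_scale[OF Rl(2)] algebra_simps)
    ultimately show "T a u u = 0" using r(1) by simp
  qed
  then show "Rc c y a b z = \<epsilon> *\<^sub>R (gc c y b z *\<^sub>R a - gc c y a z *\<^sub>R b)" by (simp add: T_def)
next
  fix c y u a
  assume R: "\<forall>c\<in>A. \<forall>y\<in>cimage c. \<forall>a b z. Rc c y a b z = \<epsilon> *\<^sub>R (gc c y b z *\<^sub>R a - gc c y a z *\<^sub>R b)"
    and cy: "c \<in> A" "y \<in> cimage c" and u: "gc c y u u = \<epsilon>"
  have "Rc c y a u u = \<epsilon> *\<^sub>R (gc c y u u *\<^sub>R a - gc c y a u *\<^sub>R u)" using R cy by blast
  then show "Rc c y a u u = a - (\<epsilon> * gc c y a u) *\<^sub>R u"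
    by (simp add: u scaleR_diff_right sign_square)
qed

theorem theorem4p3:
  fixes A :: "('a, 'e::euclidean_space) chart set"
    and g :: "'a \<Rightarrow> ('a, 'e) tangent \<Rightarrow> ('a, 'e) tangent \<Rightarrow> real"
    and nabla :: "'a \<Rightarrow> ('a, 'e) tangent \<Rightarrow> ('a \<Rightarrow> ('a, 'e) tangent) \<Rightarrow> ('a, 'e) tangent"
    and \<epsilon> :: real
  assumes "pseudo_riemannian_manifold A g"
    and "levi_civita A g nabla"
    and "\<epsilon> \<in> {1, -1}"
    and "unit_bundle A g \<epsilon> \<noteq> {}"
  shows "K_contact (bundle_atlas A) (unit_bundle A g \<epsilon>) (standard_structure A g nabla \<epsilon>)
    \<longleftrightarrow> constant_sectional_curvature A g nabla \<epsilon>"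
proof -
  interpret unit_tangent_bundle A g nabla \<epsilon>
    using assms(1-3) by unfold_locales auto
  show ?thesis using assms(4) by (rule K_contact_iff_constant_curvature)
qed

end
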